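(* Let $f,g\in M^!_{k,\rho}$ and let $G\in\mathcal H_{2-k,\overline\rho}$ with $\xi_{2-k}(G)=g$. Then for every $\varphi\in(\pi/2,3\pi/2)\setminus\{\pi\}$, \[ \langle f,g\rangle_\varphi=\{f,G\}:=\sum_{n\in\mathbb{Q}}c_f(n)\cdot c_G^+(-n) \] (a finite sum).
   Context: Let $k\in\frac12\mathbb{Z}$, $\mathrm{Mp}_2(\mathbb{Z})$ the group of pairs $(M,\phi)$ ($M=\left(\begin{smallmatrix}a&b\\c&d\end{smallmatrix}\right)\in\mathrm{SL}_2(\mathbb{Z})$, $\phi$ holomorphic, $\phi^2=c\tau+d$), $\rho$ a unitary representation of it on a finite-dimensional space $V$ with hermitian product $(\cdot,\cdot)_V$, factoring through a finite quotient; $\overline V,\overline\rho$ the complex conjugates; $v_1\cdot\overline{v_2}:=(v_1,v_2)_V$ gives a bilinear pairing $V\times\overline V\to\mathbb{C}$. Slash: $(f|_{\kappa,\rho}(M,\phi))(\tau)=\phi(\tau)^{-2\kappa}\rho((M,\phi))^{-1}f(M\tau)$. $\tau=u+iv$, $q=e^{2\pi i\tau}$. $M^!_{k,\rho}$: holomorphic $f:\mathbb{H}\to V$, invariant under $|_{k,\rho}$, $f=O(e^{Cv})$; $f=\sum_{n\in\mathbb{Q}}c_f(n)q^n$ with finitely many nonzero $n<0$ terms. $\mathcal H_{\kappa,\overline\rho}$ (harmonic Maass forms): $C^2$ functions $G:\mathbb{H}\to\overline V$ invariant under $|_{\kappa,\overline\rho}$, $G=O(e^{Cv})$ uniformly in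 $u$, and $\Delta_\kappa G=0$ with $\Delta_\kappa=-v^2(\partial_u^2+\partial_v^2)+i\kappa v(\partial_u+i\partial_v)$. Each such $G$ has a unique decomposition $G=G^++G^-$ with $G^+=\sum_{n\in\mathbb{Q}}c_G^+(n)q^n$ (finitely many $n<0$) and $G^-=c_G^-(0)v^{1-\kappa}+\sum_{n\ne0}c_G^-(n)W_\kappa(2\pi nv)q^n$ if $\kappa\ne1$ (with $c_G^-(0)\log v$ instead of $c^-_G(0)v^{1-\kappa}$ if $\kappa=1$), where $W_\kappa(x):=(-2x)^{1-\kappa}\Re(E_\kappa(-2x))$ for real $x\neq0$, using principal branches with $\mathrm{Log}(-x)=\log x+\pi i$ and $E_\kappa$ evaluated on the negative real axis as boundary value from above. $\xi_\kappa(G)(\tau):=2iv^\kappa\overline{\partial G/\partial\bar\tau}$. For $r\in\mathbb{C}$, $E_r(z)=\int_1^\infty e^{-zt}t^{-r}dt$ ($\Re z>0$); $E_{r,\varphi}$ is its analytic continuation to $\mathbb{C}\setminus\{xe^{i\varphi}:x\ge0\}$. With $\mathcal F_t=\{|u|\le\frac12,|\tau|\ge1,v\le t\}$, define $I_\varphi(f,g;0,s):=\lim_{t\to\infty}\big(\int_{\mathcal F_t}f\cdot\overline g\,v^{k-s}\frac{du\,dv}{v^2}-\sum_{n\ge0}c_f(-n)\cdot\overline{c_g(-n)}\int_1^tv^{k-2-s}e^{4\pi nv}dv\big)+\sum_{n>0}c_f(-n)\cdot\overline{c_g(-n)}E_{2-k+s,\varphi}(-4\pi n)+\frac{c_f(0)\cdot\overline{c_g(0)}}{1-k+s}$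 (the limit is entire in $s$) and $\langle f,g\rangle_\varphi:=\mathrm{CT}_{s=0}I_\varphi(f,g;0,s)-i\sum_{n>0}c_f(-n)\cdot\overline{c_g(-n)}\Im(E_{2-k,\varphi}(-4\pi n))$, $\mathrm{CT}_{s=0}$ denoting the constant Laurent coefficient at $s=0$. *)

theory Defs
  imports "HOL-Complex_Analysis.Complex_Analysis" "HOL-Algebra.Coset"
begin

no_notation fps_nth (infixl "$" 75)

section \<open>The metaplectic group\<close>

definition upper_half_plane :: "complex set" ("\<H>")
  where "\<H> = {\<tau>. 0 < Im \<tau>}"

definition moebius :: "int^2^2 \<Rightarrow> complex \<Rightarrow> complex"
  where "moebius M \<tau> =
    (of_int (M$1$1) * \<tau> + of_int (M$1$2)) / (of_int (M$2$1) * \<tau> + of_int (M$2$2))"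

type_synonym mp2 = "(int^2^2) \<times> (complex \<Rightarrow> complex)"

text \<open>The second component is a function on the upper half-plane only; it is made
  extensional so that equality of pairs is the equality of the mathematical objects.\<close>

definition Mp2Z :: "mp2 monoid"
  where "Mp2Z =
    \<lparr>carrier = {(M, \<phi>). det M = 1 \<and> \<phi> \<in> extensional \<H> \<and> \<phi> holomorphic_on \<H> \<and>
        (\<forall>\<tau>\<in>\<H>. (\<phi> \<tau>)\<^sup>2 = of_int (M$2$1) * \<tau> + of_int (M$2$2))},
     mult = (\<lambda>(M, \<phi>) (N, \<psi>). (M ** N, \<lambda>\<tau>\<in>\<H>. \<phi> (moebius N \<tau>) * \<psi> \<tau>)),
     one = (mat 1, \<lambda>\<tau>\<in>\<H>. 1)\<rparr>"

lemma moebius_denom_nz: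
  fixes M :: "int^2^2"
  assumes "det M = 1" "\<tau> \<in> \<H>"
  shows "of_int (M$2$1) * \<tau> + of_int (M$2$2) \<noteq> (0::complex)"
proof
  assume z: "of_int (M$2$1) * \<tau> + of_int (M$2$2) = (0::complex)"
  then have "of_int (M$2$1) * Im \<tau> = 0" by (simp add: complex_eq_iff)
  then have c: "M$2$1 = 0" using assms(2) by (simp add: upper_half_plane_def)
  then have "M$2$2 = 0" using z by simp
  then show False using c assms(1) by (simp add: det_2)
qed

lemma moebius_in:
  assumes "det M = 1" "\<tau> \<in> \<H>"
  shows "moebius M \<tau> \<in> \<H>"
proof -
  define d where "d = of_int (M$2$1) * \<tau> + of_int (M$2$2)"
  have d: "d \<noteq> 0" using moebius_denom_nz[OF assms] by (simp add: d_def)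
  have dt: "real_of_int (M$1$1) * of_int (M$2$2) - of_int (M$1$2) * of_int (M$2$1) = 1"
    using assms(1) by (simp add: det_2 flip: of_int_mult of_int_diff)
  have "moebius M \<tau> = (of_int (M$1$1) * \<tau> + of_int (M$1$2)) * cnj d / of_real ((norm d)\<^sup>2)"
    unfolding moebius_def d_def[symmetric] by (subst complex_div_cnj) simp
  then have "Im (moebius M \<tau>) = Im ((of_int (M$1$1) * \<tau> + of_int (M$1$2)) * cnj d) / (norm d)\<^sup>2"
    by (simp del: of_real_power)
  also have "Im ((of_int (M$1$1) * \<tau> + of_int (M$1$2)) * cnj d) =
      (real_of_int (M$1$1) * of_int (M$2$2) - of_int (M$1$2) * of_int (M$2$1)) * Im \<tau>"
    by (simp add: d_def algebra_simps)
  finally show ?thesis using d assms(2) dt by (simp add: upper_half_plane_def)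
qed

lemma moebius_mult:
  assumes "det M = 1" "det N = 1" "\<tau> \<in> \<H>"
  shows "moebius (M ** N) \<tau> = moebius M (moebius N \<tau>)"
    and "of_int ((M ** N)$2$1) * \<tau> + of_int ((M ** N)$2$2) =
      (of_int (M$2$1) * moebius N \<tau> + of_int (M$2$2)) * (of_int (N$2$1) * \<tau> + of_int (N$2$2))"
proof -
  have n: "of_int (N$2$1) * \<tau> + of_int (N$2$2) \<noteq> (0::complex)"
    by (rule moebius_denom_nz[OF assms(2,3)])
  have m: "of_int (M$2$1) * moebius N \<tau> + of_int (M$2$2) \<noteq> (0::complex)"
    by (rule moebius_denom_nz[OF assms(1) moebius_in[OF assms(2,3)]])
  show 2: "of_int ((M ** N)$2$1) * \<tau> + of_int ((M ** N)$2$2) =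
      (of_int (M$2$1) * moebius N \<tau> + of_int (M$2$2)) * (of_int (N$2$1) * \<tau> + of_int (N$2$2))"
    using n by (simp add: moebius_def matrix_matrix_mult_def sum_2 field_simps)
  have 1: "of_int ((M ** N)$1$1) * \<tau> + of_int ((M ** N)$1$2) =
      (of_int (M$1$1) * moebius N \<tau> + of_int (M$1$2)) * (of_int (N$2$1) * \<tau> + of_int (N$2$2))"
    using n by (simp add: moebius_def matrix_matrix_mult_def sum_2 field_simps)
  show "moebius (M ** N) \<tau> = moebius M (moebius N \<tau>)"
    unfolding moebius_def[of "M ** N"] 1 2 moebius_def[of M] using n m by simp
qed

lemma moebius_one: "moebius (mat 1) \<tau> = \<tau>"
  by (simp add: moebius_def mat_def)

lemma holomorphic_moebius: "det M = 1 \<Longrightarrow> moebius M holomorphic_on \<H>"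
  unfolding moebius_def[abs_def] by (intro holomorphic_intros) (auto dest: moebius_denom_nz)

lemma group_Mp2Z: "group Mp2Z"
proof (rule groupI)
  fix x y assume "x \<in> carrier Mp2Z" "y \<in> carrier Mp2Z"
  then obtain M \<phi> N \<psi> where x: "x = (M, \<phi>)" and y: "y = (N, \<psi>)"
    and M: "det M = 1" "\<phi> holomorphic_on \<H>" and N: "det N = 1" "\<psi> holomorphic_on \<H>"
    and sq: "\<And>\<tau>. \<tau> \<in> \<H> \<Longrightarrow> (\<phi> \<tau>)\<^sup>2 = of_int (M$2$1) * \<tau> + of_int (M$2$2)"
      "\<And>\<tau>. \<tau> \<in> \<H> \<Longrightarrow> (\<psi> \<tau>)\<^sup>2 = of_int (N$2$1) * \<tau> + of_int (N$2$2)"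
    by (auto simp: Mp2Z_def)
  have "(\<phi> \<circ> moebius N) holomorphic_on \<H>"
    by (rule holomorphic_on_compose_gen[OF holomorphic_moebius[OF N(1)] M(2)])
      (auto intro: moebius_in N)
  then have "(\<lambda>\<tau>. \<phi> (moebius N \<tau>) * \<psi> \<tau>) holomorphic_on \<H>"
    using N(2) by (intro holomorphic_on_mult) (simp_all add: o_def)
  then have "(\<lambda>\<tau>\<in>\<H>. \<phi> (moebius N \<tau>) * \<psi> \<tau>) holomorphic_on \<H>"
    by (rule holomorphic_transform) simp
  then show "x \<otimes>\<^bsub>Mp2Z\<^esub> y \<in> carrier Mp2Z"
    using M(1) N(1) by (auto simp: Mp2Z_def x y det_mul power_mult_distrib sq moebius_in moebius_mult)
next
  have "(\<lambda>\<tau>\<in>\<H>. 1 :: complex) holomorphic_on \<H>"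
    by (rule holomorphic_transform[of "\<lambda>_. 1"]) auto
  then show "\<one>\<^bsub>Mp2Z\<^esub> \<in> carrier Mp2Z" by (auto simp: Mp2Z_def) (simp add: mat_def)
next
  fix x y z assume "x \<in> carrier Mp2Z" "y \<in> carrier Mp2Z" "z \<in> carrier Mp2Z"
  then show "x \<otimes>\<^bsub>Mp2Z\<^esub> y \<otimes>\<^bsub>Mp2Z\<^esub> z = x \<otimes>\<^bsub>Mp2Z\<^esub> (y \<otimes>\<^bsub>Mp2Z\<^esub> z)"
    by (auto simp: Mp2Z_def moebius_in moebius_mult matrix_mul_assoc restrict_def fun_eq_iff)
next
  fix x assume "x \<in> carrier Mp2Z"
  then show "\<one>\<^bsub>Mp2Z\<^esub> \<otimes>\<^bsub>Mp2Z\<^esub> x = x"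
    by (auto simp: Mp2Z_def moebius_in restrict_def extensional_def fun_eq_iff)
next
  fix x assume "x \<in> carrier Mp2Z"
  then obtain M \<phi> where x: "x = (M, \<phi>)" and M: "det M = 1" "\<phi> holomorphic_on \<H>"
    and sq: "\<And>\<tau>. \<tau> \<in> \<H> \<Longrightarrow> (\<phi> \<tau>)\<^sup>2 = of_int (M$2$1) * \<tau> + of_int (M$2$2)"
    by (auto simp: Mp2Z_def)
  define N :: "int^2^2" where "N = (\<chi> i j. if i = 1 then (if j = 1 then M$2$2 else - (M$1$2))
    else (if j = 1 then - (M$2$1) else M$1$1))"
  have MN: "N ** M = mat 1" "M ** N = mat 1" and N: "det N = 1"
    using M(1) by (auto simp: N_def det_2 vec_eq_iff matrix_matrix_mult_def sum_2 mat_def forall_2 algebra_simps)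
  have nz: "\<phi> \<tau> \<noteq> 0" if "\<tau> \<in> \<H>" for \<tau>
    using sq[OF that] moebius_denom_nz[OF M(1) that] by auto
  have inv: "moebius N (moebius M \<tau>) = \<tau>" "moebius M (moebius N \<tau>) = \<tau>" if "\<tau> \<in> \<H>" for \<tau>
    using moebius_mult(1)[OF N M(1) that] moebius_mult(1)[OF M(1) N that]
    by (simp_all add: MN moebius_one)
  define \<psi> where "\<psi> = (\<lambda>\<tau>\<in>\<H>. 1 / \<phi> (moebius N \<tau>))"
  have "(\<phi> \<circ> moebius N) holomorphic_on \<H>"
    by (rule holomorphic_on_compose_gen[OF holomorphic_moebius[OF N] M(2)])
      (auto intro: moebius_in N)
  then have "(\<lambda>\<tau>. 1 / \<phi> (moebius N \<tau>)) holomorphic_on \<H>"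
    by (intro holomorphic_intros) (auto simp: o_def nz moebius_in N)
  then have h: "\<psi> holomorphic_on \<H>"
    unfolding \<psi>_def by (rule holomorphic_transform) simp
  have sq': "(\<psi> \<tau>)\<^sup>2 = of_int (N$2$1) * \<tau> + of_int (N$2$2)" if t: "\<tau> \<in> \<H>" for \<tau>
  proof -
    have "1 = (of_int (M$2$1) * moebius N \<tau> + of_int (M$2$2)) * (of_int (N$2$1) * \<tau> + of_int (N$2$2))"
      using moebius_mult(2)[OF M(1) N t] by (simp add: MN mat_def)
    then show ?thesis
      using t sq[OF moebius_in[OF N t]] nz[OF moebius_in[OF N t]]
      by (simp add: \<psi>_def power_divide) (metis nonzero_mult_div_cancel_left power_not_zero mult_zero_left zero_neq_one)
  qed
  have "(N, \<psi>) \<in> carrier Mp2Z"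
    using N h sq' by (auto simp: Mp2Z_def) (simp add: \<psi>_def)
  moreover have "(N, \<psi>) \<otimes>\<^bsub>Mp2Z\<^esub> x = \<one>\<^bsub>Mp2Z\<^esub>"
    using M(1) by (auto simp: Mp2Z_def x MN \<psi>_def moebius_in inv nz fun_eq_iff restrict_def)
  ultimately show "\<exists>y\<in>carrier Mp2Z. y \<otimes>\<^bsub>Mp2Z\<^esub> x = \<one>\<^bsub>Mp2Z\<^esub>" by blast
qed


section \<open>Hermitian spaces and unitary representations\<close>

text \<open>A finite-dimensional complex vector space is rendered as a Euclidean space (which
  provides the topology) with a complex scalar multiplication \<open>sc\<close> extending the
  real one.  The Euclidean inner product is not related to the hermitian product \<open>herm\<close>;
  it only enters through the topology, which does not depend on it.\<close>

locale hermitian_space = vector_space sc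
  for sc :: "complex \<Rightarrow> 'v::euclidean_space \<Rightarrow> 'v" +
  fixes herm :: "'v \<Rightarrow> 'v \<Rightarrow> complex"
  assumes sc_of_real: "sc (complex_of_real r) x = r *\<^sub>R x"
    and herm_add_left: "herm (x + y) z = herm x z + herm y z"
    and herm_scale_left: "herm (sc a x) y = a * herm x y"
    and herm_commute: "herm y x = cnj (herm x y)"
    and herm_pos: "x \<noteq> 0 \<Longrightarrow> 0 < Re (herm x x)"

text \<open>The complex conjugate of the space \<open>V\<close> with scalar multiplication \<open>sc\<close> has the same
  elements and the same addition, but scalar multiplication \<open>conj_sc sc\<close>.  So the canonical
  antilinear bijection from \<open>V\<close> to its conjugate is the identity map, the conjugate representation consists
  of the same maps \<open>\<rho> \<gamma>\<close>, and the bilinear pairing of \<open>V\<close> with its conjugate is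
  \<open>herm\<close> itself.  The notions below take the scalar multiplication as a parameter, and are used
  for functions into \<open>V\<close> with \<open>sc\<close>, and into its conjugate with \<open>conj_sc sc\<close>.\<close>

definition conj_sc :: "(complex \<Rightarrow> 'v \<Rightarrow> 'v) \<Rightarrow> complex \<Rightarrow> 'v \<Rightarrow> 'v"
  where "conj_sc sc z x = sc (cnj z) x"

lemma (in hermitian_space) vector_space_conj_sc: "vector_space (conj_sc sc)"
  by unfold_locales (simp_all add: conj_sc_def scale_right_distrib scale_left_distrib)

definition unitary_group ::
    "(complex \<Rightarrow> 'v::euclidean_space \<Rightarrow> 'v) \<Rightarrow> ('v \<Rightarrow> 'v \<Rightarrow> complex) \<Rightarrow> ('v \<Rightarrow> 'v) monoid"
  where "unitary_group sc herm =
    \<lparr>carrier = {U. Vector_Spaces.linear sc sc U \<and> bij U \<and> (\<forall>x y. herm (U x) (U y) = herm x y)},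
     mult = (\<circ>), one = id\<rparr>"

definition factors_through_finite_quotient :: "(mp2 \<Rightarrow> 'v \<Rightarrow> 'v) \<Rightarrow> bool"
  where "factors_through_finite_quotient \<rho> \<longleftrightarrow>
    (\<exists>N. N \<lhd> Mp2Z \<and> finite (carrier (Mp2Z Mod N)) \<and> (\<forall>\<gamma>\<in>N. \<rho> \<gamma> = id))"


section \<open>Modular forms and harmonic Maass forms\<close>

text \<open>Weights \<open>\<kappa>\<close> are real numbers with \<open>2 * \<kappa>\<close> integral, so the floor below is \<open>2 * \<kappa>\<close>.\<close>

definition slash ::
    "(complex \<Rightarrow> 'v \<Rightarrow> 'v) \<Rightarrow> real \<Rightarrow> (mp2 \<Rightarrow> 'v \<Rightarrow> 'v) \<Rightarrow> (complex \<Rightarrow> 'v) \<Rightarrow> mp2 \<Rightarrow> complex \<Rightarrow> 'v"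
  where "slash sc \<kappa> \<rho> f \<gamma> \<tau> =
    sc (snd \<gamma> \<tau> powi (- \<lfloor>2 * \<kappa>\<rfloor>)) (inv_into UNIV (\<rho> \<gamma>) (f (moebius (fst \<gamma>) \<tau>)))"

definition slash_invariant ::
    "(complex \<Rightarrow> 'v \<Rightarrow> 'v) \<Rightarrow> real \<Rightarrow> (mp2 \<Rightarrow> 'v \<Rightarrow> 'v) \<Rightarrow> (complex \<Rightarrow> 'v) \<Rightarrow> bool"
  where "slash_invariant sc \<kappa> \<rho> f \<longleftrightarrow>
    (\<forall>\<gamma>\<in>carrier Mp2Z. \<forall>\<tau>\<in>\<H>. slash sc \<kappa> \<rho> f \<gamma> \<tau> = f \<tau>)"

definition exp_growth :: "(complex \<Rightarrow> 'v::real_normed_vector) \<Rightarrow> bool"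
  where "exp_growth f \<longleftrightarrow>
    (\<exists>C A v\<^sub>0. \<forall>\<tau>\<in>\<H>. v\<^sub>0 \<le> Im \<tau> \<longrightarrow> norm (f \<tau>) \<le> A * exp (C * Im \<tau>))"

definition holomorphic_into ::
    "(complex \<Rightarrow> 'v \<Rightarrow> 'v) \<Rightarrow> (complex \<Rightarrow> 'v::real_normed_vector) \<Rightarrow> bool"
  where "holomorphic_into sc f \<longleftrightarrow> (\<forall>\<tau>\<in>\<H>. \<exists>d. (f has_derivative (\<lambda>h. sc h d)) (at \<tau>))"

definition weakly_holomorphic_forms ::
    "(complex \<Rightarrow> 'v \<Rightarrow> 'v) \<Rightarrow> real \<Rightarrow> (mp2 \<Rightarrow> 'v \<Rightarrow> 'v) \<Rightarrow> (complex \<Rightarrow> 'v::euclidean_space) set"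
  where "weakly_holomorphic_forms sc k \<rho> =
    {f. holomorphic_into sc f \<and> slash_invariant sc k \<rho> f \<and> exp_growth f}"

definition d_u :: "(complex \<Rightarrow> 'v::real_normed_vector) \<Rightarrow> complex \<Rightarrow> 'v"
  where "d_u F \<tau> = vector_derivative (\<lambda>t::real. F (\<tau> + of_real t)) (at 0)"

definition d_v :: "(complex \<Rightarrow> 'v::real_normed_vector) \<Rightarrow> complex \<Rightarrow> 'v"
  where "d_v F \<tau> = vector_derivative (\<lambda>t::real. F (\<tau> + \<i> * of_real t)) (at 0)"

definition C1_on_H :: "(complex \<Rightarrow> 'v::real_normed_vector) \<Rightarrow> bool"
  where "C1_on_H F \<longleftrightarrow>
    (\<forall>\<tau>\<in>\<H>. (\<lambda>t::real. F (\<tau> + of_real t)) differentiable (at 0) \<and>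
            (\<lambda>t::real. F (\<tau> + \<i> * of_real t)) differentiable (at 0)) \<and>
    continuous_on \<H> (d_u F) \<and> continuous_on \<H> (d_v F)"

definition C2_on_H :: "(complex \<Rightarrow> 'v::real_normed_vector) \<Rightarrow> bool"
  where "C2_on_H F \<longleftrightarrow> C1_on_H F \<and> C1_on_H (d_u F) \<and> C1_on_H (d_v F)"

definition laplace ::
    "(complex \<Rightarrow> 'v \<Rightarrow> 'v) \<Rightarrow> real \<Rightarrow> (complex \<Rightarrow> 'v::real_normed_vector) \<Rightarrow> complex \<Rightarrow> 'v"
  where "laplace sc \<kappa> G \<tau> =
    - ((Im \<tau>)\<^sup>2 *\<^sub>R (d_u (d_u G) \<tau> + d_v (d_v G) \<tau>))
    + sc (\<i> * of_real \<kappa> * of_real (Im \<tau>)) (d_u G \<tau> + sc \<i> (d_v G \<tau>))"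

definition harmonic_maass_forms ::
    "(complex \<Rightarrow> 'v \<Rightarrow> 'v) \<Rightarrow> real \<Rightarrow> (mp2 \<Rightarrow> 'v \<Rightarrow> 'v) \<Rightarrow> (complex \<Rightarrow> 'v::euclidean_space) set"
  where "harmonic_maass_forms sc \<kappa> \<rho> =
    {G. C2_on_H G \<and> slash_invariant sc \<kappa> \<rho> G \<and> exp_growth G \<and> (\<forall>\<tau>\<in>\<H>. laplace sc \<kappa> G \<tau> = 0)}"

definition d_taubar ::
    "(complex \<Rightarrow> 'v \<Rightarrow> 'v) \<Rightarrow> (complex \<Rightarrow> 'v::real_normed_vector) \<Rightarrow> complex \<Rightarrow> 'v"
  where "d_taubar sc G \<tau> = (1/2) *\<^sub>R (d_u G \<tau> + sc \<i> (d_v G \<tau>))"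

text \<open>Here \<open>sc\<close> is the scalar multiplication of \<open>V\<close> and \<open>G\<close> has values in its conjugate: the
  derivative is formed there, its conjugate is the same element regarded in \<open>V\<close>.\<close>

definition xi ::
    "(complex \<Rightarrow> 'v \<Rightarrow> 'v) \<Rightarrow> real \<Rightarrow> (complex \<Rightarrow> 'v::real_normed_vector) \<Rightarrow> complex \<Rightarrow> 'v"
  where "xi sc \<kappa> G \<tau> = sc (2 * \<i> * of_real (Im \<tau> powr \<kappa>)) (d_taubar (conj_sc sc) G \<tau>)"


section \<open>Generalized exponential integrals\<close>

definition expint :: "complex \<Rightarrow> complex \<Rightarrow> complex"
  where "expint r z = integral {1..} (\<lambda>t::real. exp (- z * of_real t) * of_real t powr (- r))"

definition cut_plane :: "real \<Rightarrow> complex set"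
  where "cut_plane \<phi> = - {of_real x * cis \<phi> | x. 0 \<le> x}"

text \<open>Meaningful for \<open>\<phi>\<close> strictly between \<open>pi / 2\<close> and \<open>3 * pi / 2\<close> and \<open>z \<in> cut_plane \<phi>\<close>; the
  cut plane is then connected and contains the right half-plane, so the value is unique.\<close>

definition expint_cont :: "complex \<Rightarrow> real \<Rightarrow> complex \<Rightarrow> complex"
  where "expint_cont r \<phi> z =
    (THE w. \<exists>F. F holomorphic_on cut_plane \<phi> \<and> (\<forall>z'. 0 < Re z' \<longrightarrow> F z' = expint r z') \<and> F z = w)"

definition expint_real :: "real \<Rightarrow> real \<Rightarrow> complex"
  where "expint_real \<kappa> x =
    (if 0 < x then expint (of_real \<kappa>) (of_real x)
     else Lim (at_right 0) (\<lambda>\<epsilon>. expint_cont (of_real \<kappa>) pi (Complex x \<epsilon>)))"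

text \<open>The complex \<open>powr\<close> uses the principal branch with \<open>Ln (- x) = ln x + \<i> * pi\<close> for \<open>x > 0\<close>.\<close>

definition W_fun :: "real \<Rightarrow> real \<Rightarrow> complex"
  where "W_fun \<kappa> x =
    complex_of_real (- 2 * x) powr complex_of_real (1 - \<kappa>) * of_real (Re (expint_real \<kappa> (- 2 * x)))"


section \<open>Fourier expansions\<close>

definition qpow :: "rat \<Rightarrow> complex \<Rightarrow> complex"
  where "qpow n \<tau> = exp (2 * of_real pi * \<i> * of_rat n * \<tau>)"

definition has_q_expansion ::
    "(complex \<Rightarrow> 'v \<Rightarrow> 'v) \<Rightarrow> (complex \<Rightarrow> 'v::euclidean_space) \<Rightarrow> (rat \<Rightarrow> 'v) \<Rightarrow> bool"
  where "has_q_expansion sc f c \<longleftrightarrow>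
    finite {n. n < 0 \<and> c n \<noteq> 0} \<and>
    (\<forall>\<tau>\<in>\<H>. ((\<lambda>n. sc (qpow n \<tau>) (c n)) has_sum f \<tau>) UNIV)"

definition q_coeff ::
    "(complex \<Rightarrow> 'v \<Rightarrow> 'v) \<Rightarrow> (complex \<Rightarrow> 'v::euclidean_space) \<Rightarrow> rat \<Rightarrow> 'v"
  where "q_coeff sc f = (THE c. has_q_expansion sc f c)"

definition has_nonhol_expansion ::
    "(complex \<Rightarrow> 'v \<Rightarrow> 'v) \<Rightarrow> real \<Rightarrow> (complex \<Rightarrow> 'v::euclidean_space) \<Rightarrow> (rat \<Rightarrow> 'v) \<Rightarrow> bool"
  where "has_nonhol_expansion sc \<kappa> G c \<longleftrightarrow>
    (\<forall>\<tau>\<in>\<H>. ((\<lambda>n. sc (if n = 0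
                      then of_real (if \<kappa> = 1 then ln (Im \<tau>) else Im \<tau> powr (1 - \<kappa>))
                      else W_fun \<kappa> (2 * pi * of_rat n * Im \<tau>) * qpow n \<tau>) (c n))
            has_sum G \<tau>) UNIV)"

definition q_coeff_plus ::
    "(complex \<Rightarrow> 'v \<Rightarrow> 'v) \<Rightarrow> real \<Rightarrow> (complex \<Rightarrow> 'v::euclidean_space) \<Rightarrow> rat \<Rightarrow> 'v"
  where "q_coeff_plus sc \<kappa> G = (THE cp. \<exists>cm Gp Gm.
    (\<forall>\<tau>\<in>\<H>. G \<tau> = Gp \<tau> + Gm \<tau>) \<and>
    has_q_expansion sc Gp cp \<and> has_nonhol_expansion sc \<kappa> Gm cm)"


section \<open>The regularized pairing\<close>

definition fund_dom :: "real \<Rightarrow> complex set"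
  where "fund_dom t = {\<tau>\<in>\<H>. \<bar>Re \<tau>\<bar> \<le> 1/2 \<and> 1 \<le> norm \<tau> \<and> Im \<tau> \<le> t}"

text \<open>All infinite sums over rational \<open>n\<close> in this section have finite support.\<close>

definition reg_integral ::
    "(complex \<Rightarrow> 'v \<Rightarrow> 'v) \<Rightarrow> ('v \<Rightarrow> 'v \<Rightarrow> complex) \<Rightarrow> real \<Rightarrow> real \<Rightarrow>
     (complex \<Rightarrow> 'v::euclidean_space) \<Rightarrow> (complex \<Rightarrow> 'v) \<Rightarrow> complex \<Rightarrow> complex"
  where "reg_integral sc herm k \<phi> f g s =
    (let a = (\<lambda>n. herm (q_coeff sc f n) (q_coeff sc g n)) in
      Lim at_top (\<lambda>t::real.
        integral (fund_dom t) (\<lambda>\<tau>. herm (f \<tau>) (g \<tau>) *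
          of_real (Im \<tau>) powr (of_real k - s) / of_real ((Im \<tau>)\<^sup>2))
        - (\<Sum>\<^sub>\<infinity>n\<in>{0..}. a (- n) *
            integral {1..t} (\<lambda>v. of_real v powr (of_real k - 2 - s) *
              of_real (exp (4 * pi * of_rat n * v)))))
      + (\<Sum>\<^sub>\<infinity>n\<in>{0<..}. a (- n) *
          expint_cont (2 - of_real k + s) \<phi> (of_real (- 4 * pi * of_rat n)))
      + a 0 / (1 - of_real k + s))"

definition constant_term_at_0 :: "(complex \<Rightarrow> complex) \<Rightarrow> complex"
  where "constant_term_at_0 h = fls_nth (laurent_expansion h 0) 0"

definition reg_pairing ::
    "(complex \<Rightarrow> 'v \<Rightarrow> 'v) \<Rightarrow> ('v \<Rightarrow> 'v \<Rightarrow> complex) \<Rightarrow> real \<Rightarrow> real \<Rightarrow>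
     (complex \<Rightarrow> 'v::euclidean_space) \<Rightarrow> (complex \<Rightarrow> 'v) \<Rightarrow> complex"
  where "reg_pairing sc herm k \<phi> f g =
    constant_term_at_0 (reg_integral sc herm k \<phi> f g)
    - \<i> * (\<Sum>\<^sub>\<infinity>n\<in>{0<..}. herm (q_coeff sc f (- n)) (q_coeff sc g (- n)) *
        of_real (Im (expint_cont (2 - of_real k) \<phi> (of_real (- 4 * pi * of_rat n)))))"

end

theory Submission
  imports Defs
begin

text \<open>Write \<open>\<kappa> = 2 - k\<close>, let \<open>a(n)\<close> be the pairing of the \<open>n\<close>-th coefficients of \<open>f\<close> and \<open>g\<close>, and let
  \<open>h\<close> be the pairing of \<open>f\<close> with \<open>G\<close>.  Then \<open>h d\<tau>\<close> is invariant under the modular group, and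
  \<open>\<xi>(G) = g\<close> says that its exterior derivative is, up to sign, the integrand of the regularized pairing
  at \<open>s = 0\<close>.  By Stokes' theorem the integral over the fundamental domain truncated at height \<open>t\<close> is
  therefore the constant Fourier coefficient of \<open>h\<close> at height \<open>t\<close>.  The non-holomorphic
  coefficients of \<open>G\<close> are determined by the coefficients of \<open>g\<close>, so this coefficient is
  \<open>{f, G}\<close> plus the sum of all \<open>a(n) r\<^sub>n(t)\<close>, where \<open>r\<^sub>n\<close> has derivative \<open>v\<^sup>-\<^sup>\<kappa> exp (- 4 \<pi> n v)\<close>.
  Subtracting the divergent integrals replaces \<open>r\<^sub>n(t)\<close> by \<open>r\<^sub>n(1)\<close> for \<open>n \<le> 0\<close>, and the terms with \<open>n > 0\<close>
  tend to \<open>0\<close>.  For \<open>n = - m < 0\<close> the value \<open>r\<^sub>n(1)\<close> is \<open>- Re E\<^sub>\<kappa>(- 4 \<pi> m)\<close>.  On the negative axis the continuations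
  of \<open>E\<^sub>\<kappa>\<close> for the various \<open>\<phi>\<close> are the boundary value from above or its complex
  conjugate, so this cancels the real part of the added exponential integral, while its imaginary part is
  removed by the definition of the pairing.  The terms with \<open>n = 0\<close> cancel as well, since everything is
  holomorphic in \<open>s\<close> except for the explicit pole.\<close>

text \<open>The coefficients \<open>q_coeff\<close> and \<open>q_coeff_plus\<close> and the
  continuation \<open>expint_cont\<close> are definite descriptions, so existence and uniqueness
  must be proved before anything can be computed, and uniqueness has to hold among expansions over
  all rational frequencies. Bounded denominators come from the finite quotient: some power of the
  translation by 1 acts trivially. For the decomposition of \<open>G\<close>, the coefficients of
  \<open>g\<close> define an explicit series with the same derivative in the conjugate variable as
  \<open>G\<close>; the difference is then holomorphic, periodic and of exponential growth. Stokes'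
  theorem only speaks about \<open>s = 0\<close>, whereas the pairing takes a constant term. The
  bridge is that the limit, once the divergent terms are removed, is entire in \<open>s\<close>, so
  its value at \<open>0\<close> may be computed with real powers of \<open>v\<close>. There
  \<open>r\<^sub>0(1)\<close> is \<open>1 / (k - 1)\<close>, the negative of the constant term of
  \<open>1 / (1 - k + s)\<close>; for \<open>k = 1\<close> both are \<open>0\<close>, since
  \<open>ln 1 = 0\<close> and \<open>1 / s\<close> has no constant term.\<close>

section \<open>Generalized exponential integrals\<close>

text \<open>Dominated convergence for the difference quotients. For
  \<open>norm s \<le> \<delta> / 2\<close> they are bounded by
  \<open>norm (l x) * exp (\<delta> / 2 * norm (l x))\<close>, and the other half of
  \<open>\<delta>\<close> absorbs the linear factor; this is the origin of
  \<open>2 / \<delta>\<close>. With \<open>l\<close> equal to \<open>- t\<close> or to a negative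
  logarithm it yields holomorphy in the argument, in the order and in \<open>s\<close>.\<close>

lemma has_field_derivative_integral_exp_at_0:
  fixes \<phi> l :: "'a \<Rightarrow> complex"
  assumes [measurable]: "\<phi> \<in> borel_measurable M" "l \<in> borel_measurable M"
    and d: "0 < \<delta>" and int: "integrable M (\<lambda>x. norm (\<phi> x) * exp (\<delta> * norm (l x)))"
  shows "((\<lambda>s. \<integral>x. \<phi> x * exp (s * l x) \<partial>M) has_field_derivative (\<integral>x. \<phi> x * l x \<partial>M)) (at 0)"
proof -
  have bd: "norm (\<phi> x * exp (s * l x)) \<le> norm (\<phi> x) * exp (\<delta> * norm (l x))" if "norm s \<le> \<delta>" for s x
  proof -
    have "Re (s * l x) \<le> norm s * norm (l x)"
      by (metis complex_Re_le_cmod norm_mult)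
    also have "\<dots> \<le> \<delta> * norm (l x)"
      using that by (intro mult_right_mono) auto
    finally show ?thesis by (simp add: norm_mult mult_left_mono)
  qed
  have intg: "integrable M (\<lambda>x. \<phi> x * exp (s * l x))" if "norm s \<le> \<delta>" for s
    by (rule Bochner_Integration.integrable_bound[OF int]) (use bd[OF that] in auto)
  have intg0: "integrable M \<phi>"
    using intg[of 0] d by simp
  have lim: "((\<lambda>s. \<integral>x. \<phi> x * ((exp (s * l x) - 1) / s) \<partial>M) \<longlongrightarrow> (\<integral>x. \<phi> x * l x \<partial>M)) (at 0)"
    unfolding tendsto_at_iff_sequentially comp_def
  proof (intro allI impI)
    fix X :: "nat \<Rightarrow> complex" assume X: "\<forall>i. X i \<in> UNIV - {0}" "X \<longlonglongrightarrow> 0"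
    have "\<forall>\<^sub>F i in sequentially. norm (X i) < \<delta> / 2"
      using tendstoD[OF X(2), of "\<delta> / 2"] d by simp
    then obtain n0 where n0: "\<And>i. i \<ge> n0 \<Longrightarrow> norm (X i) < \<delta> / 2"
      by (auto simp: eventually_sequentially)
    have "(\<lambda>i. \<integral>x. \<phi> x * ((exp (X (i + n0) * l x) - 1) / X (i + n0)) \<partial>M) \<longlonglongrightarrow> (\<integral>x. \<phi> x * l x \<partial>M)"
    proof (rule integral_dominated_convergence[where w = "\<lambda>x. 2 / \<delta> * (norm (\<phi> x) * exp (\<delta> * norm (l x)))"])
      show "integrable M (\<lambda>x. 2 / \<delta> * (norm (\<phi> x) * exp (\<delta> * norm (l x))))"
        using int by simp
      show "AE x in M. (\<lambda>i. \<phi> x * ((exp (X (i + n0) * l x) - 1) / X (i + n0))) \<longlonglongrightarrow> \<phi> x * l x"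
      proof (rule AE_I2)
        fix x
        have "((\<lambda>s. exp (s * l x)) has_field_derivative l x) (at 0)"
          by (auto intro!: derivative_eq_intros)
        then have "((\<lambda>s. (exp (s * l x) - 1) / s) \<longlongrightarrow> l x) (at 0)"
          by (simp add: has_field_derivative_iff)
        then have "(\<lambda>i. (exp (X i * l x) - 1) / X i) \<longlonglongrightarrow> l x"
          using X unfolding tendsto_at_iff_sequentially comp_def by blast
        then have "(\<lambda>i. (exp (X (i + n0) * l x) - 1) / X (i + n0)) \<longlonglongrightarrow> l x"
          by (rule LIMSEQ_ignore_initial_segment)
        then show "(\<lambda>i. \<phi> x * ((exp (X (i + n0) * l x) - 1) / X (i + n0))) \<longlonglongrightarrow> \<phi> x * l x"
          by (intro tendsto_intros)
      qed
      fix i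
      show "AE x in M. norm (\<phi> x * ((exp (X (i + n0) * l x) - 1) / X (i + n0))) \<le> 2 / \<delta> * (norm (\<phi> x) * exp (\<delta> * norm (l x)))"
      proof (rule AE_I2)
        fix x
        define s where "s = X (i + n0)"
        have s: "s \<noteq> 0" "norm s \<le> \<delta> / 2" using X(1) n0[of "i + n0"] by (auto simp: s_def)
        have "norm (exp (s * l x) - 1) \<le> exp \<bar>Re (s * l x)\<bar> * norm (s * l x)"
          using Taylor_exp[of "s * l x" 0] by simp
        also have "\<bar>Re (s * l x)\<bar> \<le> norm s * norm (l x)"
          by (metis abs_Re_le_cmod norm_mult)
        also have "norm s * norm (l x) \<le> \<delta> / 2 * norm (l x)"
          using s by (intro mult_right_mono) auto
        finally have "norm (exp (s * l x) - 1) \<le> exp (\<delta> / 2 * norm (l x)) * norm (s * l x)"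
          by (simp add: mult_right_mono)
        then have 1: "norm (exp (s * l x) - 1) / norm s \<le> exp (\<delta> / 2 * norm (l x)) * norm (l x)"
          using s by (simp add: norm_mult field_simps)
        have "\<delta> / 2 * norm (l x) \<le> exp (\<delta> / 2 * norm (l x))"
          using exp_ge_add_one_self[of "\<delta> / 2 * norm (l x)"] by linarith
        then have "norm (l x) \<le> 2 / \<delta> * exp (\<delta> / 2 * norm (l x))"
          using d by (simp add: field_simps)
        then have "exp (\<delta> / 2 * norm (l x)) * norm (l x) \<le>
            exp (\<delta> / 2 * norm (l x)) * (2 / \<delta> * exp (\<delta> / 2 * norm (l x)))"
          by (intro mult_left_mono) auto
        also have "\<dots> = 2 / \<delta> * exp (\<delta> * norm (l x))"
          by (simp add: mult_exp_exp)
        finally have "norm (exp (s * l x) - 1) / norm s \<le> 2 / \<delta> * exp (\<delta> * norm (l x))"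
          using 1 by linarith
        then have "norm (\<phi> x) * (norm (exp (s * l x) - 1) / norm s) \<le> norm (\<phi> x) * (2 / \<delta> * exp (\<delta> * norm (l x)))"
          by (intro mult_left_mono) auto
        then show "norm (\<phi> x * ((exp (X (i + n0) * l x) - 1) / X (i + n0))) \<le> 2 / \<delta> * (norm (\<phi> x) * exp (\<delta> * norm (l x)))"
          unfolding norm_mult norm_divide s_def by (simp only: mult_ac)
      qed
    qed measurable
    then show "(\<lambda>i. \<integral>x. \<phi> x * ((exp (X i * l x) - 1) / X i) \<partial>M) \<longlonglongrightarrow> (\<integral>x. \<phi> x * l x \<partial>M)"
      by (rule LIMSEQ_offset)
  qed
  have ev: "\<forall>\<^sub>F s in at 0. norm s < \<delta>"
    using d by (auto simp: eventually_at dist_norm)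
  show ?thesis
    unfolding has_field_derivative_iff
  proof (rule Lim_transform_eventually[OF lim])
    show "\<forall>\<^sub>F s in at 0. (\<integral>x. \<phi> x * ((exp (s * l x) - 1) / s) \<partial>M) =
        ((\<integral>x. \<phi> x * exp (s * l x) \<partial>M) - (\<integral>x. \<phi> x * exp (0 * l x) \<partial>M)) / (s - 0)"
      using ev
    proof eventually_elim
      case (elim s)
      have "(\<integral>x. \<phi> x * ((exp (s * l x) - 1) / s) \<partial>M) = (\<integral>x. (\<phi> x * exp (s * l x) - \<phi> x) / s \<partial>M)"
        by (intro Bochner_Integration.integral_cong) (auto simp: field_simps diff_divide_distrib)
      then show ?case
        using intg[of s] intg0 elim by simp
    qed
  qed
qed

text \<open>The factor \<open>exp (s * l x)\<close> is absorbed into \<open>\<phi>\<close>, which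
  moves the base point to \<open>0\<close> and leaves the margin
  \<open>\<delta> - norm s\<close>.\<close>

lemma has_field_derivative_integral_exp:
  fixes \<phi> l :: "'a \<Rightarrow> complex"
  assumes [measurable]: "\<phi> \<in> borel_measurable M" "l \<in> borel_measurable M"
    and int: "integrable M (\<lambda>x. norm (\<phi> x) * exp (\<delta> * norm (l x)))" and s: "norm s < \<delta>"
  shows "((\<lambda>s. \<integral>x. \<phi> x * exp (s * l x) \<partial>M) has_field_derivative (\<integral>x. \<phi> x * l x * exp (s * l x) \<partial>M)) (at s)"
proof -
  have "((\<lambda>h. \<integral>x. \<phi> x * exp (s * l x) * exp (h * l x) \<partial>M) has_field_derivative
      (\<integral>x. \<phi> x * exp (s * l x) * l x \<partial>M)) (at 0)"
  proof (rule has_field_derivative_integral_exp_at_0[where \<delta> = "\<delta> - norm s"])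
    show "integrable M (\<lambda>x. norm (\<phi> x * exp (s * l x)) * exp ((\<delta> - norm s) * norm (l x)))"
    proof (rule Bochner_Integration.integrable_bound[OF int])
      show "AE x in M. norm (norm (\<phi> x * exp (s * l x)) * exp ((\<delta> - norm s) * norm (l x))) \<le>
          norm (norm (\<phi> x) * exp (\<delta> * norm (l x)))"
      proof (rule AE_I2)
        fix x
        have "Re (s * l x) \<le> norm s * norm (l x)"
          by (metis complex_Re_le_cmod norm_mult)
        then have "exp (Re (s * l x)) * exp ((\<delta> - norm s) * norm (l x)) \<le> exp (\<delta> * norm (l x))"
          by (simp add: mult_exp_exp algebra_simps)
        then have "norm (\<phi> x) * (exp (Re (s * l x)) * exp ((\<delta> - norm s) * norm (l x))) \<le> norm (\<phi> x) * exp (\<delta> * norm (l x))"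
          by (intro mult_left_mono) auto
        then show "norm (norm (\<phi> x * exp (s * l x)) * exp ((\<delta> - norm s) * norm (l x))) \<le>
          norm (norm (\<phi> x) * exp (\<delta> * norm (l x)))"
          by (simp add: norm_mult mult.assoc)
      qed
    qed measurable
  qed (use s in auto)
  then have "((\<lambda>h. \<integral>x. \<phi> x * exp ((h + s) * l x) \<partial>M) has_field_derivative
      (\<integral>x. \<phi> x * l x * exp (s * l x) \<partial>M)) (at 0)"
    by (simp add: mult.assoc mult_exp_exp ring_distribs add.commute mult.commute[of "l _" "exp _"])
  then show ?thesis
    using DERIV_at_within_shift[of "\<lambda>s. \<integral>x. \<phi> x * exp (s * l x) \<partial>M" "\<integral>x. \<phi> x * l x * exp (s * l x) \<partial>M" s 0 UNIV]
    by (simp add: add.commute)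
qed

section \<open>The exponential integral on the right half-plane\<close>

lemma set_integrable_exp_powr:
  fixes x p :: real
  assumes x: "0 < x"
  shows "set_integrable lborel {1..} (\<lambda>t. exp (- x * t) * t powr p)"
proof -
  \<comment> \<open>From \<open>ln (\<epsilon> * t) \<le> \<epsilon> * t\<close> one gets
    \<open>ln t \<le> \<epsilon> * t - ln \<epsilon>\<close>; with this \<open>\<epsilon>\<close>
    the factor \<open>t powr p\<close> costs at most half of the decay of
    \<open>exp (- x * t)\<close>. The \<open>1\<close> in the denominator covers
    \<open>p = 0\<close>.\<close>
  define \<epsilon> where "\<epsilon> = x / (2 * \<bar>p\<bar> + 1)"
  have e: "\<epsilon> > 0" "\<bar>p\<bar> * \<epsilon> \<le> x / 2" using x by (auto simp: \<epsilon>_def field_simps)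
  define C where "C = exp (- \<bar>p\<bar> * ln \<epsilon>)"
  have "(\<lambda>t::real. exp (- (x / 2) * t)) absolutely_integrable_on {1..}"
    using x by (intro nonnegative_absolutely_integrable_1 integrable_on_exp_minus_to_infinity) auto
  then have I: "set_integrable lborel {1..} (\<lambda>t::real. exp (- (x / 2) * t))"
    unfolding set_integrable_def by (subst (asm) integrable_completion) auto
  show ?thesis
  proof (rule set_integrable_bound[where f = "\<lambda>t. C * exp (- (x / 2) * t)"])
    show "set_integrable lborel {1..} (\<lambda>t. C * exp (- (x / 2) * t))"
      using I by simp
    show "set_borel_measurable lborel {1..} (\<lambda>t. exp (- x * t) * t powr p)"
      unfolding set_borel_measurable_def by measurable
    show "AE t in lborel. t \<in> {1..} \<longrightarrow> norm (exp (- x * t) * t powr p) \<le> norm (C * exp (- (x / 2) * t))"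
    proof (intro AE_I2 impI)
      fix t :: real assume "t \<in> {1..}"
      then have t: "1 \<le> t" by simp
      have "ln (\<epsilon> * t) \<le> \<epsilon> * t" using e t by (intro ln_bound) simp
      then have l: "ln t \<le> \<epsilon> * t - ln \<epsilon>" using e t by (simp add: ln_mult)
      have "p * ln t \<le> \<bar>p\<bar> * ln t" using t by (intro mult_right_mono) auto
      also have "\<dots> \<le> \<bar>p\<bar> * (\<epsilon> * t - ln \<epsilon>)" using l by (intro mult_left_mono) auto
      also have "\<dots> \<le> x / 2 * t - \<bar>p\<bar> * ln \<epsilon>"
        using mult_right_mono[OF e(2), of t] t by (simp add: algebra_simps)
      finally have "- x * t + p * ln t \<le> - \<bar>p\<bar> * ln \<epsilon> + - (x / 2) * t" by simp
      then have "exp (- x * t + p * ln t) \<le> exp (- \<bar>p\<bar> * ln \<epsilon> + - (x / 2) * t)" by simp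
      then show "norm (exp (- x * t) * t powr p) \<le> norm (C * exp (- (x / 2) * t))"
        using t unfolding exp_add C_def by (simp add: powr_def)
    qed
  qed
qed

text \<open>The real logarithm makes the order \<open>r\<close> a parameter inside an exponential,
  as differentiation under the integral requires; the indicator gives a function on all reals whose
  measurability is automatic.\<close>

definition expint_integrand :: "complex \<Rightarrow> complex \<Rightarrow> real \<Rightarrow> complex" where
  "expint_integrand r z t = indicator {1..} t *\<^sub>R (exp (- z * of_real t) * exp (- r * of_real (ln t)))"

lemma expint_integrand_measurable [measurable]: "expint_integrand r z \<in> borel_measurable borel"
  unfolding expint_integrand_def[abs_def] by measurable

lemma norm_expint_integrand:
  "norm (expint_integrand r z t) = indicator {1..} t * (exp (- Re z * t) * t powr (- Re r))"
  by (cases "t \<ge> 1") (auto simp: expint_integrand_def norm_mult powr_def)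

lemma integrable_expint_integrand: "0 < Re z \<Longrightarrow> integrable lborel (expint_integrand r z)"
  using set_integrable_exp_powr[of "Re z" "- Re r"]
  by (intro Bochner_Integration.integrable_bound[where g = "expint_integrand r z", OF _ _ AE_I2])
    (auto simp: set_integrable_def norm_expint_integrand)

lemma expint_integrand_eq:
  "expint_integrand r z t = indicator {1..} t *\<^sub>R (exp (- z * of_real t) * of_real t powr (- r))"
  by (auto simp: expint_integrand_def indicator_def powr_def Ln_of_real)

lemma expint_eq_lebesgue:
  assumes "0 < Re z"
  shows "expint r z = (\<integral>t. expint_integrand r z t \<partial>lborel)"
proof -
  have "set_integrable lborel {1..} (\<lambda>t. exp (- z * of_real t) * of_real t powr (- r))"
    unfolding set_integrable_def using integrable_expint_integrand[OF assms, of r]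
    by (simp add: expint_integrand_eq[abs_def])
  from set_borel_integral_eq_integral(2)[OF this] show ?thesis
    by (simp add: expint_def set_lebesgue_integral_def expint_integrand_eq[abs_def])
qed

text \<open>Integration by parts: \<open>A\<close> is \<open>exp (- z * t)\<close> times the power
  of \<open>t\<close> with exponent \<open>1 - r\<close>, its derivative is \<open>f\<close>, and it
  decays at infinity since \<open>Re z > 0\<close>.\<close>

lemma expint_recurrence:
  assumes z: "0 < Re z"
  shows "z * expint (r - 1) z = exp (- z) + (1 - r) * expint r z"
proof -
  define A where "A t = exp (- z * of_real t + (1 - r) * of_real (ln t))" for t :: real
  define f where "f t = (1 - r) * (exp (- z * of_real t) * exp (- r * of_real (ln t))) -
     z * (exp (- z * of_real t) * exp (- (r - 1) * of_real (ln t)))" for t :: real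
  have f: "indicator {1..} t *\<^sub>R f t = (1 - r) * expint_integrand r z t - z * expint_integrand (r - 1) z t" for t
    by (auto simp: f_def expint_integrand_def indicator_def)
  have fi: "set_integrable lborel {1..} f"
    unfolding set_integrable_def f using z by (auto intro!: integrable_expint_integrand)
  have "((\<lambda>b. set_lebesgue_integral lborel {1..b} f) \<longlongrightarrow> set_lebesgue_integral lborel {1..} f) at_top"
    by (rule tendsto_set_lebesgue_integral_at_top[OF _ fi]) auto
  also have "set_lebesgue_integral lborel {1..} f = (1 - r) * expint r z - z * expint (r - 1) z"
    unfolding set_lebesgue_integral_def f expint_eq_lebesgue[OF z]
    using z by (simp add: integrable_expint_integrand)
  finally have 1: "((\<lambda>b. set_lebesgue_integral lborel {1..b} f) \<longlongrightarrow> (1 - r) * expint r z - z * expint (r - 1) z) at_top" .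
  have FTC: "set_lebesgue_integral lborel {1..b} f = A b - A 1" if "1 \<le> b" for b
    unfolding set_lebesgue_integral_def
  proof (rule integral_FTC_atLeastAtMost[OF that])
    fix x :: real assume x: "1 \<le> x" "x \<le> b"
    have "((\<lambda>w. exp (- z * w + (1 - r) * Ln w)) has_field_derivative
        (exp (- z * of_real x + (1 - r) * Ln (of_real x)) * (- z + (1 - r) / of_real x))) (at (of_real x))"
      using x by (auto intro!: derivative_eq_intros simp: complex_nonpos_Reals_iff field_simps)
    then have "((\<lambda>t. exp (- z * of_real t + (1 - r) * Ln (of_real t))) has_vector_derivative
        (exp (- z * of_real x + (1 - r) * Ln (of_real x)) * (- z + (1 - r) / of_real x))) (at x within {1..b})"
      by (rule has_vector_derivative_real_field[THEN has_vector_derivative_at_within])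
    then have "(A has_vector_derivative
        (exp (- z * of_real x + (1 - r) * Ln (of_real x)) * (- z + (1 - r) / of_real x))) (at x within {1..b})"
      by (rule has_vector_derivative_transform[rotated 2]) (use x in \<open>auto simp: A_def Ln_of_real\<close>)
    also have "exp (- z * of_real x + (1 - r) * Ln (of_real x)) * (- z + (1 - r) / of_real x) = f x"
    proof -
      have l: "Ln (of_real x) = complex_of_real (ln x)" using x by (simp add: Ln_of_real)
      have e: "exp (of_real (ln x)) = complex_of_real x" using x by (subst exp_of_real) simp
      have "exp (- z * of_real x + (1 - r) * of_real (ln x)) = exp (- z * of_real x) * exp (- r * of_real (ln x)) * of_real x"
        by (simp add: e[symmetric] mult_exp_exp algebra_simps)
      moreover have "exp (- (r - 1) * of_real (ln x)) = exp (- r * of_real (ln x)) * of_real x"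
        by (simp add: e[symmetric] mult_exp_exp algebra_simps)
      ultimately show ?thesis
        using x unfolding f_def l by (simp only:) (simp add: field_simps)
    qed
    finally show "(A has_vector_derivative f x) (at x within {1..b})" .
  next
    show "continuous_on {1..b} f"
      unfolding f_def by (intro continuous_intros) auto
  qed
  have A: "(A \<longlongrightarrow> 0) at_top"
  proof (rule tendsto_norm_zero_cancel)
    have "((\<lambda>t. exp (- Re z * t + (1 - Re r) * ln t)) \<longlongrightarrow> 0) at_top"
      using z by real_asymp
    then show "((\<lambda>t. norm (A t)) \<longlongrightarrow> 0) at_top"
      by (simp add: A_def)
  qed
  have "((\<lambda>b. set_lebesgue_integral lborel {1..b} f) \<longlongrightarrow> 0 - A 1) at_top"
  proof (rule Lim_transform_eventually)
    show "((\<lambda>b. A b - A 1) \<longlongrightarrow> 0 - A 1) at_top" by (intro tendsto_intros A)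
    show "\<forall>\<^sub>F b in at_top. A b - A 1 = set_lebesgue_integral lborel {1..b} f"
      using eventually_ge_at_top[of 1] by eventually_elim (simp add: FTC)
  qed
  from tendsto_unique[OF _ this 1] have "- A 1 = (1 - r) * expint r z - z * expint (r - 1) z"
    by simp
  then show ?thesis by (simp add: A_def algebra_simps)
qed

text \<open>Differentiating under the integral gives \<open>- expint (r - 1) z\<close>; the
  recurrence turns this into a first-order differential equation in which only the order
  \<open>r\<close> occurs. That equation carries the function over to the cut plane.\<close>

lemma has_field_derivative_expint:
  assumes z: "0 < Re z"
  shows "(expint r has_field_derivative ((r - 1) * expint r z - exp (- z)) / z) (at z)"
proof -
  define \<delta> where "\<delta> = Re z / 2"
  have d: "0 < \<delta>" using z by (simp add: \<delta>_def)
  have z0: "z \<noteq> 0" using z by auto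
  have "((\<lambda>s. \<integral>t. expint_integrand r z t * exp (s * (- of_real t)) \<partial>lborel) has_field_derivative
      (\<integral>t. expint_integrand r z t * (- of_real t) \<partial>lborel)) (at 0)"
  proof (rule has_field_derivative_integral_exp_at_0[OF _ _ d])
    have "norm (expint_integrand r z t) * exp (\<delta> * norm (- complex_of_real t)) =
        norm (expint_integrand r (of_real \<delta>) t)" for t
      by (auto simp: norm_expint_integrand indicator_def mult_exp_exp \<delta>_def field_simps)
    then show "integrable lborel (\<lambda>t. norm (expint_integrand r z t) * exp (\<delta> * norm (- complex_of_real t)))"
      using integrable_expint_integrand[of "of_real \<delta>" r] d by simp
  qed measurable
  also have "(\<lambda>t. expint_integrand r z t * (- of_real t)) = (\<lambda>t. - expint_integrand (r - 1) z t)"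
  proof
    fix t :: real
    have e: "exp (of_real (ln t)) = complex_of_real t" if "t \<ge> 1" using that by (subst exp_of_real) simp
    show "expint_integrand r z t * (- of_real t) = - expint_integrand (r - 1) z t"
      by (auto simp: expint_integrand_def indicator_def left_diff_distrib exp_diff exp_minus e field_simps)
  qed
  also have "(\<integral>t. - expint_integrand (r - 1) z t \<partial>lborel) = ((r - 1) * expint r z - exp (- z)) / z"
    using expint_recurrence[OF z, of r] z z0 by (simp add: expint_eq_lebesgue) (simp add: field_simps)
  finally have "((\<lambda>s. expint r (s + z)) has_field_derivative ((r - 1) * expint r z - exp (- z)) / z) (at 0)"
  proof (rule DERIV_cong_ev[THEN iffD1, OF refl _ refl, rotated])
    show "\<forall>\<^sub>F s in nhds 0. (\<integral>t. expint_integrand r z t * exp (s * (- of_real t)) \<partial>lborel) = expint r (s + z)"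
      unfolding eventually_nhds_metric
    proof (intro exI[of _ \<delta>] conjI d allI impI)
      fix s :: complex assume "dist s 0 < \<delta>"
      then have "\<bar>Re s\<bar> < \<delta>" using abs_Re_le_cmod[of s] by simp
      then have "0 < Re (s + z)" by (simp add: \<delta>_def)
      then show "(\<integral>t. expint_integrand r z t * exp (s * (- of_real t)) \<partial>lborel) = expint r (s + z)"
        by (simp add: expint_eq_lebesgue expint_integrand_def mult_exp_exp algebra_simps)
    qed
  qed
  then show ?thesis
    using DERIV_at_within_shift[of "expint r" "((r - 1) * expint r z - exp (- z)) / z" z 0 UNIV]
    by (simp add: add.commute)
qed

lemma expint_holomorphic_in_order:
  assumes z: "0 < Re z"
  shows "(\<lambda>r. expint r z) holomorphic_on UNIV"
proof -
  have "(\<lambda>r. expint r z) field_differentiable (at r)" for r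
  proof -
    have "((\<lambda>s. \<integral>t. expint_integrand r z t * exp (s * (- of_real (ln t))) \<partial>lborel) has_field_derivative
        (\<integral>t. expint_integrand r z t * (- of_real (ln t)) \<partial>lborel)) (at 0)"
    proof (rule has_field_derivative_integral_exp_at_0[where \<delta> = 1])
      \<comment> \<open>For \<open>t \<ge> 1\<close> the additional majorant factor is
        \<open>exp (ln t) = t\<close>, which merely lowers the order by \<open>1\<close>.\<close>
      have "norm (expint_integrand r z t) * exp (1 * norm (- complex_of_real (ln t))) =
          norm (expint_integrand (r - 1) z t)" for t
        by (auto simp: norm_expint_integrand indicator_def powr_def exp_diff exp_minus ring_distribs divide_inverse)
      then show "integrable lborel (\<lambda>t. norm (expint_integrand r z t) * exp (1 * norm (- complex_of_real (ln t))))"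
        using integrable_expint_integrand[OF z, of "r - 1"] by simp
    qed auto
    also have "(\<lambda>s. \<integral>t. expint_integrand r z t * exp (s * (- of_real (ln t))) \<partial>lborel) = (\<lambda>s. expint (s + r) z)"
      using z by (intro ext) (simp add: expint_eq_lebesgue expint_integrand_def mult_exp_exp algebra_simps)
    finally show ?thesis
      using DERIV_at_within_shift[of "\<lambda>r. expint r z" _ r 0 UNIV] 
      by (auto simp: add.commute field_differentiable_def)
  qed
  then show ?thesis by (simp add: holomorphic_on_def)
qed

section \<open>Continuation to the cut plane\<close>

text \<open>For the admissible \<open>\<phi>\<close> the point opposite to the cut lies in the right half-plane, where the
  exponential integral is given by its integral representation, and the cut plane is star-shaped about it.\<close>

definition cut_base :: "real \<Rightarrow> complex" where
  "cut_base \<phi> = - cis \<phi>"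

text \<open>Division by the base point rotates the cut onto that of \<open>Ln\<close>; the added
  \<open>\<i> * (\<phi> - pi)\<close> is a logarithm of the base point, so the result is a logarithm
  of \<open>z\<close> itself.\<close>

definition cut_log :: "real \<Rightarrow> complex \<Rightarrow> complex" where
  "cut_log \<phi> z = Ln (z / cut_base \<phi>) + \<i> * of_real (\<phi> - pi)"

lemma cut_base_nz [simp]: "cut_base \<phi> \<noteq> 0"
  by (simp add: cut_base_def)

lemma cut_base_exp: "cut_base \<phi> = exp (\<i> * of_real (\<phi> - pi))"
  by (simp add: cut_base_def cis_conv_exp[symmetric] cis_def cos_diff sin_diff complex_eq_iff flip: of_real_diff)

lemma mem_cut_plane_iff: "z \<in> cut_plane \<phi> \<longleftrightarrow> z / cut_base \<phi> \<notin> \<real>\<^sub>\<le>\<^sub>0"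
proof -
  have "(\<exists>x\<ge>0. z = of_real x * cis \<phi>) \<longleftrightarrow> z / cut_base \<phi> \<in> \<real>\<^sub>\<le>\<^sub>0"
  proof
    assume "\<exists>x\<ge>0. z = of_real x * cis \<phi>"
    then obtain x where "x \<ge> 0" "z = of_real x * cis \<phi>" by blast
    then have "z / cut_base \<phi> = of_real (- x)" by (simp add: cut_base_def)
    then show "z / cut_base \<phi> \<in> \<real>\<^sub>\<le>\<^sub>0" using \<open>x \<ge> 0\<close> by (simp only: nonpos_Reals_of_real_iff)
  next
    assume "z / cut_base \<phi> \<in> \<real>\<^sub>\<le>\<^sub>0"
    then obtain y where "y \<le> 0" "z / cut_base \<phi> = of_real y" by (auto elim: nonpos_Reals_cases)
    then have "z = of_real (- y) * cis \<phi>" by (simp add: cut_base_def field_simps) (metis add.inverse_inverse)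
    then show "\<exists>x\<ge>0. z = of_real x * cis \<phi>" using \<open>y \<le> 0\<close> by (intro exI[of _ "- y"]) auto
  qed
  then show ?thesis by (auto simp: cut_plane_def)
qed

lemma exp_cut_log: "z \<noteq> 0 \<Longrightarrow> exp (cut_log \<phi> z) = z"
  by (simp add: cut_log_def exp_add cut_base_exp[symmetric] del: of_real_diff)

lemma cut_plane_nz: "z \<in> cut_plane \<phi> \<Longrightarrow> z \<noteq> 0"
  by (auto simp: mem_cut_plane_iff)

lemma cut_base_in [simp]: "cut_base \<phi> \<in> cut_plane \<phi>"
  by (simp add: mem_cut_plane_iff)

lemma open_cut_plane: "open (cut_plane \<phi>)"
proof -
  have "cut_plane \<phi> = (\<lambda>z. z / cut_base \<phi>) -` (- \<real>\<^sub>\<le>\<^sub>0)" by (auto simp: mem_cut_plane_iff)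
  also have "open \<dots>"
    by (intro continuous_open_vimage open_Compl closed_nonpos_Reals_complex continuous_intros) auto
  finally show ?thesis .
qed

lemma cut_plane_segment:
  assumes "z \<in> cut_plane \<phi>"
  shows "closed_segment (cut_base \<phi>) z \<subseteq> cut_plane \<phi>"
proof -
  have eq: "\<real>\<^sub>\<le>\<^sub>0 = complex_of_real ` {..0}" by (auto simp: nonpos_Reals_def)
  show ?thesis
  proof
    fix w assume "w \<in> closed_segment (cut_base \<phi>) z"
    then obtain u where u: "0 \<le> u" "u \<le> 1" "w = (1 - u) *\<^sub>R cut_base \<phi> + u *\<^sub>R z"
      by (auto simp: in_segment)
    have "w / cut_base \<phi> = (1 - u) *\<^sub>R of_real 1 + u *\<^sub>R (z / cut_base \<phi>)"
      using u by (simp add: field_simps scaleR_conv_of_real)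
    then have "w / cut_base \<phi> \<in> closed_segment (of_real 1) (z / cut_base \<phi>)"
      using u(1,2) unfolding in_segment by blast
    moreover have "closed_segment (of_real 1) (z / cut_base \<phi>) \<subseteq> - (complex_of_real ` {..0})"
      using assms by (intro starlike_slotted_complex_plane_left_aux) (auto simp: mem_cut_plane_iff eq)
    ultimately show "w \<in> cut_plane \<phi>" by (auto simp: mem_cut_plane_iff eq)
  qed
qed

lemma starlike_cut_plane: "starlike (cut_plane \<phi>)"
  unfolding starlike_def using cut_plane_segment cut_base_in by blast

lemma connected_cut_plane: "connected (cut_plane \<phi>)"
  using starlike_cut_plane by (rule starlike_imp_connected)

lemma has_field_derivative_cut_log:
  assumes "z \<in> cut_plane \<phi>"
  shows "(cut_log \<phi> has_field_derivative 1 / z) (at z)"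
  unfolding cut_log_def[abs_def] using assms cut_plane_nz[OF assms]
  by (auto intro!: derivative_eq_intros simp: mem_cut_plane_iff field_simps)

lemma continuous_on_cut_log: "continuous_on (cut_plane \<phi>) (cut_log \<phi>)"
  by (meson DERIV_continuous_on has_field_derivative_at_within has_field_derivative_cut_log)

lemma Re_pos_cut_plane:
  assumes "\<phi> \<in> {pi / 2 <..< 3 * pi / 2}" "0 < Re z"
  shows "z \<in> cut_plane \<phi>"
proof -
  have "cos \<phi> < 0"
  proof -
    have "0 < cos (\<phi> - pi)" using assms by (intro cos_gt_zero_pi) auto
    then show ?thesis by (simp add: cos_diff)
  qed
  then show ?thesis using assms(2) by (auto simp: cut_plane_def mult_nonneg_nonpos less_imp_le leD
    dest!: mult_nonneg_nonpos[of _ "cos \<phi>"])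
qed

lemma Re_cut_base: "\<phi> \<in> {pi / 2 <..< 3 * pi / 2} \<Longrightarrow> 0 < Re (cut_base \<phi>)"
  using cos_gt_zero_pi[of "\<phi> - pi"] by (auto simp: cut_base_def cos_diff)

text \<open>On the right half-plane the exponential integral satisfies \<open>z E' = (r - 1) E - exp (- z)\<close>; solving this
  equation by variation of constants along segments from the base point gives the continuation.\<close>

definition expint_ext :: "complex \<Rightarrow> real \<Rightarrow> complex \<Rightarrow> complex" where
  "expint_ext r \<phi> z = exp ((r - 1) * cut_log \<phi> z) *
     (expint r (cut_base \<phi>) * exp ((1 - r) * cut_log \<phi> (cut_base \<phi>)) -
      contour_integral (linepath (cut_base \<phi>) z) (\<lambda>w. exp (- r * cut_log \<phi> w - w)))"

lemma has_field_derivative_expint_ext: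
  assumes z: "z \<in> cut_plane \<phi>"
  shows "(expint_ext r \<phi> has_field_derivative ((r - 1) * expint_ext r \<phi> z - exp (- z)) / z) (at z)"
proof -
  let ?f = "\<lambda>w. exp (- r * cut_log \<phi> w - w)" and ?b = "cut_base \<phi>"
  \<comment> \<open>The endpoint of the contour integral varies with \<open>z\<close>; a primitive
    \<open>g\<close> on the star-shaped cut plane replaces the integral by a difference of values of
    \<open>g\<close>, which can be differentiated.\<close>
  have "\<exists>g. \<forall>x\<in>cut_plane \<phi>. (g has_field_derivative ?f x) (at x)"
  proof (rule holomorphic_starlike_primitive[OF _ starlike_cut_plane open_cut_plane finite.emptyI])
    show "continuous_on (cut_plane \<phi>) ?f"
      by (intro continuous_intros continuous_on_cut_log)
    show "?f field_differentiable at x" if "x \<in> cut_plane \<phi> - {}" for x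
      unfolding field_differentiable_def using that
      by (auto intro!: exI derivative_eq_intros has_field_derivative_cut_log)
  qed
  then obtain g where g: "\<And>x. x \<in> cut_plane \<phi> \<Longrightarrow> (g has_field_derivative ?f x) (at x)" by blast
  have ci: "contour_integral (linepath ?b x) ?f = g x - g ?b" if "x \<in> cut_plane \<phi>" for x
  proof -
    have "(?f has_contour_integral (g (pathfinish (linepath ?b x)) - g (pathstart (linepath ?b x)))) (linepath ?b x)"
      by (rule contour_integral_primitive[where S = "cut_plane \<phi>"])
        (use cut_plane_segment[OF that] has_field_derivative_at_within[OF g] in auto)
    then show ?thesis by (simp add: contour_integral_unique)
  qed
  define c where "c = expint r ?b * exp ((1 - r) * cut_log \<phi> ?b) + g ?b"
  have e: "expint_ext r \<phi> x = exp ((r - 1) * cut_log \<phi> x) * (c - g x)" if "x \<in> cut_plane \<phi>" for x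
    unfolding expint_ext_def ci[OF that] c_def by (simp add: algebra_simps)
  have "((\<lambda>x. exp ((r - 1) * cut_log \<phi> x) * (c - g x)) has_field_derivative
      (exp ((r - 1) * cut_log \<phi> z) * ((r - 1) / z)) * (c - g z) - exp ((r - 1) * cut_log \<phi> z) * ?f z) (at z)"
    using z by (auto intro!: derivative_eq_intros has_field_derivative_cut_log g)
  also have "(exp ((r - 1) * cut_log \<phi> z) * ((r - 1) / z)) * (c - g z) - exp ((r - 1) * cut_log \<phi> z) * ?f z =
      ((r - 1) * expint_ext r \<phi> z - exp (- z)) / z"
  proof -
    have "exp ((r - 1) * cut_log \<phi> z) * ?f z = exp (- cut_log \<phi> z) * exp (- z)"
      by (simp add: mult_exp_exp algebra_simps)
    also have "\<dots> = exp (- z) / z"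
      by (simp add: exp_minus[of "cut_log \<phi> z"] exp_cut_log cut_plane_nz[OF z] field_simps)
    finally have X: "exp ((r - 1) * cut_log \<phi> z) * ?f z = exp (- z) / z" .
    show ?thesis unfolding X e[OF z] using cut_plane_nz[OF z] by (simp add: divide_simps)
  qed
  finally show ?thesis
    by (rule has_field_derivative_transform_within_open[OF _ open_cut_plane z]) (simp add: e)
qed

lemma expint_ext_holomorphic: "expint_ext r \<phi> holomorphic_on cut_plane \<phi>"
  by (meson has_field_derivative_expint_ext holomorphic_on_open open_cut_plane)

text \<open>Both functions solve the same linear equation, so their difference times the integrating
  factor \<open>exp ((1 - r) * cut_log \<phi> x)\<close> has derivative zero on the right
  half-plane. It vanishes at the base point, which lies there for the admissible
  \<open>\<phi>\<close>.\<close>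

lemma expint_ext_eq_expint:
  assumes \<phi>: "\<phi> \<in> {pi / 2 <..< 3 * pi / 2}" and z: "0 < Re z"
  shows "expint_ext r \<phi> z = expint r z"
proof -
  let ?H = "{z. 0 < Re z}"
  define d where "d x = exp ((1 - r) * cut_log \<phi> x) * (expint_ext r \<phi> x - expint r x)" for x
  have "\<exists>c. \<forall>x\<in>?H. d x = c"
  proof (rule has_field_derivative_zero_constant)
    show "convex ?H" by (rule convex_halfspace_Re_gt)
    fix x assume "x \<in> ?H"
    then have x: "0 < Re x" "x \<in> cut_plane \<phi>" using Re_pos_cut_plane[OF \<phi>] by auto
    have "x \<noteq> 0" using x by auto
    have "(d has_field_derivative 0) (at x)"
      unfolding d_def[abs_def]
      by (rule derivative_eq_intros refl has_field_derivative_cut_log has_field_derivative_expint_ext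
          has_field_derivative_expint x)+ (use \<open>x \<noteq> 0\<close> in \<open>simp add: field_simps\<close>)
    then show "(d has_field_derivative 0) (at x within ?H)" by (rule has_field_derivative_at_within)
  qed
  then obtain c where c: "\<And>x. 0 < Re x \<Longrightarrow> d x = c" by auto
  have "d (cut_base \<phi>) = 0"
    by (simp add: d_def expint_ext_def mult_exp_exp) (simp add: mult.left_commute[of "exp _"] mult_exp_exp algebra_simps)
  then have "d z = 0" using c[OF z] c[OF Re_cut_base[OF \<phi>]] by simp
  then show ?thesis by (simp add: d_def)
qed

text \<open>The cut plane is connected and contains the right half-plane, so the identity theorem
  determines the continuation; this discharges the definite description.\<close>

lemma expint_cont_eq:
  assumes \<phi>: "\<phi> \<in> {pi / 2 <..< 3 * pi / 2}" and z: "z \<in> cut_plane \<phi>"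
    and F: "F holomorphic_on cut_plane \<phi>" "\<And>z'. 0 < Re z' \<Longrightarrow> F z' = expint r z'"
  shows "expint_cont r \<phi> z = F z"
  unfolding expint_cont_def
proof (rule the_equality)
  show "\<exists>F'. F' holomorphic_on cut_plane \<phi> \<and> (\<forall>z'. 0 < Re z' \<longrightarrow> F' z' = expint r z') \<and> F' z = F z"
    using F by blast
  fix w assume "\<exists>F'. F' holomorphic_on cut_plane \<phi> \<and> (\<forall>z'. 0 < Re z' \<longrightarrow> F' z' = expint r z') \<and> F' z = w"
  then obtain F' where F': "F' holomorphic_on cut_plane \<phi>" "\<And>z'. 0 < Re z' \<Longrightarrow> F' z' = expint r z'" "F' z = w" by blast
  have "F' z = F z"
  proof (rule analytic_continuation_open[where z = z and f = F' and g = F and s = "{z. 0 < Re z}" and s' = "cut_plane \<phi>"])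
    show "open {z. 0 < Re z}" by (rule open_halfspace_Re_gt)
    show "{z. 0 < Re z} \<noteq> {}" by (auto intro: exI[of _ 1])
  qed (use F F' z Re_pos_cut_plane[OF \<phi>] open_cut_plane connected_cut_plane in auto)
  then show "w = F z" using F' by simp
qed

lemma expint_cont_eq_ext:
  assumes "\<phi> \<in> {pi / 2 <..< 3 * pi / 2}" "z \<in> cut_plane \<phi>"
  shows "expint_cont r \<phi> z = expint_ext r \<phi> z"
  using assms by (intro expint_cont_eq expint_ext_holomorphic expint_ext_eq_expint)

text \<open>Needed for the constant term at \<open>s = 0\<close>, where the order is the variable.
  Every occurrence of \<open>r\<close> is in an exponential or in \<open>expint r\<close> at the
  base point, which has positive real part; the contour integral is a parameter integral over a
  compact interval.\<close>

lemma expint_ext_holomorphic_in_order: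
  assumes \<phi>: "\<phi> \<in> {pi / 2 <..< 3 * pi / 2}" and z: "z \<in> cut_plane \<phi>"
  shows "(\<lambda>r. expint_ext r \<phi> z) holomorphic_on UNIV"
proof -
  let ?b = "cut_base \<phi>"
  let ?l = "\<lambda>t. cut_log \<phi> (linepath ?b z t)"
  have [continuous_intros]: "continuous_on {0..1} ?l"
    by (rule continuous_on_compose2[OF continuous_on_cut_log continuous_on_linepath])
      (use cut_plane_segment[OF z] in \<open>auto simp: linepath_image_01[symmetric]\<close>)
  have [continuous_intros]: "continuous_on (UNIV \<times> {0..1}) (\<lambda>x. ?l (snd x))"
    by (rule continuous_on_compose2[of "{0..1}" ?l]) (auto intro!: continuous_intros)
  have [continuous_intros]: "continuous_on (UNIV \<times> {0..1}) (\<lambda>x. linepath ?b z (snd x))"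
    by (rule continuous_on_compose2[of "{0..1}" "linepath ?b z"]) (auto intro!: continuous_intros)
  have "(\<lambda>r. integral (cbox 0 1) (\<lambda>t. exp (- r * ?l t - linepath ?b z t) * (z - ?b))) holomorphic_on UNIV"
  proof (rule leibniz_rule_holomorphic[where fx = "\<lambda>r t. - ?l t * exp (- r * ?l t - linepath ?b z t) * (z - ?b)"])
    show "(\<lambda>t. exp (- r * ?l t - linepath ?b z t) * (z - ?b)) integrable_on cbox 0 1" for r
      by (rule integrable_continuous) (auto intro!: continuous_intros)
    show "continuous_on (UNIV \<times> cbox 0 1) (\<lambda>(r, t). - ?l t * exp (- r * ?l t - linepath ?b z t) * (z - ?b))"
      unfolding split_def cbox_interval by (intro continuous_intros)
  qed (auto intro!: derivative_eq_intros)
  then have "(\<lambda>r. contour_integral (linepath ?b z) (\<lambda>w. exp (- r * cut_log \<phi> w - w))) holomorphic_on UNIV"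
    by (simp add: contour_integral_integral vector_derivative_linepath_at)
  then show ?thesis
    unfolding expint_ext_def
    by (intro holomorphic_intros expint_holomorphic_in_order Re_cut_base[OF \<phi>])
qed

section \<open>Values of the continuations on the real axis\<close>

lemma real_in_cut_plane:
  assumes \<phi>: "\<phi> \<in> {pi / 2 <..< 3 * pi / 2} - {pi}" and x: "x \<noteq> 0"
  shows "complex_of_real x \<in> cut_plane \<phi>"
proof (cases "x > 0")
  case True
  then show ?thesis using \<phi> by (intro Re_pos_cut_plane) auto
next
  case False
  have "sin (\<phi> - pi) \<noteq> 0"
  proof (cases "\<phi> > pi")
    case True
    then show ?thesis using \<phi> sin_gt_zero[of "\<phi> - pi"] by auto
  next
    case False
    then show ?thesis using \<phi> sin_gt_zero[of "pi - \<phi>"] sin_minus[of "pi - \<phi>"] by auto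
  qed
  then have "sin \<phi> \<noteq> 0" by (simp add: sin_diff)
  then show ?thesis using x by (auto simp: cut_plane_def complex_eq_iff)
qed

lemma cnj_cut_plane: "cnj z \<in> cut_plane \<phi> \<longleftrightarrow> z \<in> cut_plane (2 * pi - \<phi>)"
proof -
  have "cnj z = of_real x * cis \<phi> \<longleftrightarrow> z = of_real x * cis (2 * pi - \<phi>)" for x
  proof -
    have "cis (2 * pi - \<phi>) = cnj (cis \<phi>)"
      by (simp add: complex_eq_iff cos_diff sin_diff)
    then show ?thesis
      by (metis complex_cnj_cnj complex_cnj_complex_of_real complex_cnj_mult)
  qed
  then show ?thesis by (simp add: cut_plane_def)
qed

lemma expint_cnj:
  assumes "0 < Re z"
  shows "expint (of_real \<kappa>) (cnj z) = cnj (expint (of_real \<kappa>) z)"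
proof -
  have "expint_integrand (of_real \<kappa>) (cnj z) = (\<lambda>t. cnj (expint_integrand (of_real \<kappa>) z t))"
    by (auto simp: expint_integrand_def exp_cnj)
  then show ?thesis using assms by (simp add: expint_eq_lebesgue)
qed

text \<open>For real order, the function conjugated on both sides is holomorphic on the reflected
  cut plane and agrees with \<open>expint\<close> on the right half-plane, so it is the continuation
  there.\<close>

lemma expint_ext_cnj:
  assumes \<phi>: "\<phi> \<in> {pi / 2 <..< 3 * pi / 2}" and z: "z \<in> cut_plane \<phi>"
  shows "expint_ext (of_real \<kappa>) (2 * pi - \<phi>) (cnj z) = cnj (expint_ext (of_real \<kappa>) \<phi> z)"
proof -
  have \<phi>': "2 * pi - \<phi> \<in> {pi / 2 <..< 3 * pi / 2}" using \<phi> by auto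
  have z': "cnj z \<in> cut_plane (2 * pi - \<phi>)" using z by (simp add: cnj_cut_plane[symmetric])
  let ?F = "cnj \<circ> expint_ext (of_real \<kappa>) \<phi> \<circ> cnj"
  have "?F holomorphic_on cut_plane (2 * pi - \<phi>)"
  proof (rule holomorphic_on_compose_cnj_cnj)
    show "expint_ext (of_real \<kappa>) \<phi> holomorphic_on cnj ` cut_plane (2 * pi - \<phi>)"
      by (rule holomorphic_on_subset[OF expint_ext_holomorphic]) (auto simp: cnj_cut_plane)
    show "open (cut_plane (2 * pi - \<phi>))" by (rule open_cut_plane)
  qed
  moreover have "?F w = expint (of_real \<kappa>) w" if "0 < Re w" for w
    using that expint_cnj[of w \<kappa>] expint_ext_eq_expint[OF \<phi>, of "cnj w" "of_real \<kappa>"] by simp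
  ultimately have "expint_cont (of_real \<kappa>) (2 * pi - \<phi>) (cnj z) = ?F (cnj z)"
    by (intro expint_cont_eq[OF \<phi>' z'])
  then show ?thesis using expint_cont_eq_ext[OF \<phi>' z'] by simp
qed

text \<open>With \<open>\<phi>\<close> in this range the cut lies, apart from the origin, in the
  open third quadrant, hence both cut planes contain the connected union of the right and the upper
  half-plane.\<close>

lemma expint_ext_upper:
  assumes \<phi>: "\<phi> \<in> {pi<..<3 * pi / 2}" and z: "0 < Im z"
  shows "expint_ext r pi z = expint_ext r \<phi> z"
proof -
  let ?U = "\<lambda>z::complex. 0 < Re z \<or> 0 < Im z"
  have sub: "z \<in> cut_plane pi" "z \<in> cut_plane \<phi>" if "?U z" for z
  proof -
    have "sin \<phi> < 0" "cos \<phi> < 0"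
      using \<phi> sin_gt_zero[of "\<phi> - pi"] cos_gt_zero_pi[of "\<phi> - pi"] by (auto simp: sin_diff cos_diff)
    then show "z \<in> cut_plane \<phi>"
      using that mult_nonneg_nonpos[of _ "sin \<phi>"] mult_nonneg_nonpos[of _ "cos \<phi>"]
      by (fastforce simp: cut_plane_def)
    show "z \<in> cut_plane pi" using that by (auto simp: cut_plane_def)
  qed
  have U: "Collect ?U = {z. 0 < Re z} \<union> {z. 0 < Im z}" by auto
  show ?thesis
  proof (rule analytic_continuation_open[where z = z and f = "expint_ext r pi" and g = "expint_ext r \<phi>"
        and s = "{z. 0 < Re z}" and s' = "Collect ?U"])
    show "{z. 0 < Re z} \<noteq> {}" by (auto intro: exI[of _ 1])
    show "open {z. 0 < Re z}" "open (Collect ?U)"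
      unfolding U by (auto intro: open_halfspace_Re_gt open_halfspace_Im_gt)
    have "Complex 1 1 \<in> {z. 0 < Re z} \<inter> {z. 0 < Im z}" by simp
    then show "connected (Collect ?U)"
      unfolding U by (intro connected_Un convex_connected convex_halfspace_Re_gt convex_halfspace_Im_gt) blast
    show "expint_ext r pi holomorphic_on Collect ?U" "expint_ext r \<phi> holomorphic_on Collect ?U"
      using sub by (auto intro!: holomorphic_on_subset[OF expint_ext_holomorphic])
    show "expint_ext r pi z = expint_ext r \<phi> z" if "z \<in> {z. 0 < Re z}" for z
      using that \<phi> by (simp add: expint_ext_eq_expint)
  qed (use z in auto)
qed

text \<open>For \<open>\<phi> > pi\<close> the cut lies below the negative real axis, which is then
  reached from above within the domain of holomorphy, so even the complex values agree. For
  \<open>\<phi> < pi\<close> the angle \<open>2 * pi - \<phi>\<close> is of the first kind, and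
  conjugation keeps the real part.\<close>

lemma Re_expint_real:
  assumes \<phi>: "\<phi> \<in> {pi / 2 <..< 3 * pi / 2} - {pi}" and x: "x \<noteq> 0"
  shows "Re (expint_real \<kappa> x) = Re (expint_ext (of_real \<kappa>) \<phi> (of_real x))"
proof (cases "0 < x")
  case True
  then show ?thesis using \<phi> by (simp add: expint_real_def expint_ext_eq_expint)
next
  case False
  have main: "expint_real \<kappa> x = expint_ext (of_real \<kappa>) \<phi> (of_real x)" if \<phi>: "\<phi> \<in> {pi<..<3 * pi / 2}" for \<phi>
  proof -
    have c: "of_real x \<in> cut_plane \<phi>" using \<phi> x by (intro real_in_cut_plane) auto
    have "isCont (expint_ext (of_real \<kappa>) \<phi>) (of_real x)"
      using has_field_derivative_expint_ext[OF c] by (rule DERIV_isCont)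
    moreover have "((\<lambda>\<epsilon>. Complex x \<epsilon>) \<longlongrightarrow> of_real x) (at_right 0)"
      unfolding complex_of_real_def by (intro tendsto_intros)
    ultimately have "((\<lambda>\<epsilon>. expint_ext (of_real \<kappa>) \<phi> (Complex x \<epsilon>)) \<longlongrightarrow> expint_ext (of_real \<kappa>) \<phi> (of_real x)) (at_right 0)"
      by (rule isCont_tendsto_compose)
    moreover have "\<forall>\<^sub>F \<epsilon> in at_right 0. expint_ext (of_real \<kappa>) \<phi> (Complex x \<epsilon>) = expint_cont (of_real \<kappa>) pi (Complex x \<epsilon>)"
      using eventually_at_right_less[of "0::real"]
    proof eventually_elim
      case (elim \<epsilon>)
      then have "Complex x \<epsilon> \<in> cut_plane pi" by (auto simp: cut_plane_def complex_eq_iff)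
      then show ?case using elim \<phi> by (simp add: expint_cont_eq_ext expint_ext_upper)
    qed
    ultimately have "((\<lambda>\<epsilon>. expint_cont (of_real \<kappa>) pi (Complex x \<epsilon>)) \<longlongrightarrow> expint_ext (of_real \<kappa>) \<phi> (of_real x)) (at_right 0)"
      by (rule Lim_transform_eventually)
    then have "Lim (at_right 0) (\<lambda>\<epsilon>. expint_cont (of_real \<kappa>) pi (Complex x \<epsilon>)) = expint_ext (of_real \<kappa>) \<phi> (of_real x)"
      by (intro tendsto_Lim) auto
    then show ?thesis using False by (simp add: expint_real_def)
  qed
  show ?thesis
  proof (cases "\<phi> > pi")
    case True
    then show ?thesis using \<phi> main[of \<phi>] by simp
  next
    case False
    then have "2 * pi - \<phi> \<in> {pi<..<3 * pi / 2}" using \<phi> by auto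
    from main[OF this] expint_ext_cnj[of \<phi> "of_real x" \<kappa>] \<phi> real_in_cut_plane[OF \<phi> x]
    show ?thesis by simp
  qed
qed

section \<open>Real tails of the exponential integral and their decay\<close>

text \<open>In the notation of the paper, \<open>expint_tail \<kappa> (- 4 * pi * n) v\<close> is
  \<open>W\<^sub>\<kappa>(2 \<pi> n v)\<close> up to a constant factor; see \<open>W_fun_eq\<close>.\<close>

definition expint_tail :: "real \<Rightarrow> real \<Rightarrow> real \<Rightarrow> real" where
  "expint_tail \<kappa> c v = v powr (1 - \<kappa>) * Re (expint_real \<kappa> (c * v))"

text \<open>The factor \<open>v powr (1 - \<kappa>)\<close> is the integrating factor of the
  differential equation: the two terms containing the exponential integral cancel, and only the
  elementary inhomogeneity remains, in the same form for both signs of \<open>c\<close>.\<close>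

lemma has_field_derivative_expint_tail:
  assumes c: "c \<noteq> 0" and v: "0 < v"
  shows "(expint_tail \<kappa> c has_real_derivative - (v powr (- \<kappa>) * exp (- c * v))) (at v)"
proof -
  \<comment> \<open>An arbitrary admissible angle; the real part does not depend on it, whereas
    \<open>pi\<close> itself would put the cut on the negative axis.\<close>
  define \<phi> where "\<phi> = 5 / 4 * pi"
  have \<phi>: "\<phi> \<in> {pi / 2 <..< 3 * pi / 2} - {pi}" by (auto simp: \<phi>_def)
  let ?E = "expint_ext (of_real \<kappa>) \<phi>"
  have cp: "complex_of_real (c * v) \<in> cut_plane \<phi>" using c v by (intro real_in_cut_plane[OF \<phi>]) auto
  have "((\<lambda>x. ?E (of_real c * x)) has_field_derivative
      ((of_real \<kappa> - 1) * ?E (of_real (c * v)) - exp (- of_real (c * v))) / of_real (c * v) * of_real c) (at (of_real v))"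
    using has_field_derivative_expint_ext[OF cp, of "of_real \<kappa>"]
    by (intro DERIV_chain2[where g = "\<lambda>x. of_real c * x" and f = ?E]) (auto intro!: derivative_eq_intros)
  then have "((\<lambda>x. Re (?E (of_real c * of_real x))) has_vector_derivative
      Re (((of_real \<kappa> - 1) * ?E (of_real (c * v)) - exp (- of_real (c * v))) / of_real (c * v) * of_real c)) (at v)"
    by (intro bounded_linear.has_vector_derivative[OF bounded_linear_Re] has_vector_derivative_real_field)
  moreover have "Re (((of_real \<kappa> - 1) * ?E (of_real (c * v)) - exp (- of_real (c * v))) / of_real (c * v) * of_real c)
      = ((\<kappa> - 1) * Re (?E (of_real (c * v))) - exp (- c * v)) / v"
  proof -
    have "((of_real \<kappa> - 1) * ?E (of_real (c * v)) - exp (- of_real (c * v))) / of_real (c * v) * of_real c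
       = (of_real (\<kappa> - 1) * ?E (of_real (c * v)) - of_real (exp (- c * v))) / of_real v"
      using c v by (simp add: field_simps flip: exp_of_real)
    also have "Re \<dots> = ((\<kappa> - 1) * Re (?E (of_real (c * v))) - exp (- c * v)) / v"
      by (simp only: Re_divide_of_real minus_complex.simps Re_complex_of_real times_complex.simps Im_complex_of_real) simp
    finally show ?thesis .
  qed
  ultimately have "((\<lambda>x. Re (?E (of_real (c * x)))) has_real_derivative
      ((\<kappa> - 1) * Re (?E (of_real (c * v))) - exp (- c * v)) / v) (at v)"
    by (simp add: has_real_derivative_iff_has_vector_derivative)
  then have "((\<lambda>x. x powr (1 - \<kappa>) * Re (?E (of_real (c * x)))) has_real_derivative
      (1 - \<kappa>) * v powr (1 - \<kappa> - 1) * Re (?E (of_real (c * v))) +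
      ((\<kappa> - 1) * Re (?E (of_real (c * v))) - exp (- c * v)) / v * v powr (1 - \<kappa>)) (at v)"
    using v by (intro DERIV_mult has_real_derivative_powr) auto
  moreover have "(1 - \<kappa>) * v powr (1 - \<kappa> - 1) * Re (?E (of_real (c * v))) +
      ((\<kappa> - 1) * Re (?E (of_real (c * v))) - exp (- c * v)) / v * v powr (1 - \<kappa>) = - (v powr (- \<kappa>) * exp (- c * v))"
  proof -
    have 1: "v powr (1 - \<kappa>) = v * v powr (- \<kappa>)" using v by (simp add: powr_diff powr_minus field_simps)
    have 2: "1 - \<kappa> - 1 = - \<kappa>" by simp
    show ?thesis unfolding 1 2 using v by (simp add: divide_simps) (simp add: algebra_simps)
  qed
  ultimately have "((\<lambda>x. x powr (1 - \<kappa>) * Re (?E (of_real (c * x)))) has_real_derivative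
      - (v powr (- \<kappa>) * exp (- c * v))) (at v)"
    by simp
  then show ?thesis
    by (rule has_field_derivative_transform_within_open[where S = "{0<..}"])
      (use v c in \<open>auto simp: expint_tail_def Re_expint_real[OF \<phi>]\<close>)
qed

text \<open>For positive argument the exponential integral is the integral of a nonnegative function
  over \<open>t \<ge> 1\<close>, where the additional factor \<open>exp (- d * v * t)\<close> is at
  most \<open>exp (- d * v)\<close>. The second part allows all frequencies to be compared with a
  single one in the majorants below.\<close>

lemma expint_tail_nonneg: "0 < c \<Longrightarrow> 0 < v \<Longrightarrow> 0 \<le> expint_tail \<kappa> c v"
  and expint_tail_decay: "0 < c \<Longrightarrow> 0 < v \<Longrightarrow> 0 \<le> d \<Longrightarrow> expint_tail \<kappa> (c + d) v \<le> exp (- d * v) * expint_tail \<kappa> c v"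
proof -
  have R: "Re (expint_real \<kappa> x) = (\<integral>t. norm (expint_integrand (of_real \<kappa>) (of_real x) t) \<partial>lborel)" if "0 < x" for x
  proof -
    have "expint_integrand (of_real \<kappa>) (of_real x) = (\<lambda>t. of_real (norm (expint_integrand (of_real \<kappa>) (of_real x) t)))"
      by (rule ext, unfold norm_expint_integrand)
        (auto simp: expint_integrand_def indicator_def powr_def simp flip: exp_of_real)
    then have "expint (of_real \<kappa>) (of_real x) = (\<integral>t. complex_of_real (norm (expint_integrand (of_real \<kappa>) (of_real x) t)) \<partial>lborel)"
      using that expint_eq_lebesgue[of "of_real x" "of_real \<kappa>"] by simp
    then show ?thesis using that by (simp add: expint_real_def)
  qed
  show 1: "0 \<le> expint_tail \<kappa> c v" if "0 < c" "0 < v"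
    using that by (simp add: expint_tail_def R)
  show "expint_tail \<kappa> (c + d) v \<le> exp (- d * v) * expint_tail \<kappa> c v" if "0 < c" "0 < v" "0 \<le> d"
  proof -
    have "0 < (c + d) * v" "0 < c * v" using that by auto
    have "Re (expint_real \<kappa> ((c + d) * v)) \<le> exp (- d * v) * Re (expint_real \<kappa> (c * v))"
      unfolding R[OF \<open>0 < (c + d) * v\<close>] R[OF \<open>0 < c * v\<close>] integral_mult_right_zero[symmetric]
    proof (rule integral_mono)
      fix t
      have "exp (- ((c + d) * v) * t) \<le> exp (- d * v) * exp (- (c * v) * t)" if "1 \<le> t"
      proof -
        have "d * v \<le> d * v * t" using that \<open>0 < v\<close> \<open>0 \<le> d\<close> using mult_left_mono[of 1 t "d * v"] by simp
        then show ?thesis by (simp add: mult_exp_exp algebra_simps)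
      qed
      then show "norm (expint_integrand (of_real \<kappa>) (of_real ((c + d) * v)) t) \<le>
          exp (- d * v) * norm (expint_integrand (of_real \<kappa>) (of_real (c * v)) t)"
        by (auto simp: norm_expint_integrand indicator_def mult.assoc[symmetric] intro!: mult_right_mono)
    qed (use that \<open>0 < (c + d) * v\<close> \<open>0 < c * v\<close> in \<open>auto intro!: integrable_norm integrable_expint_integrand integrable_mult_right\<close>)
    then have "v powr (1 - \<kappa>) * Re (expint_real \<kappa> ((c + d) * v)) \<le> v powr (1 - \<kappa>) * (exp (- d * v) * Re (expint_real \<kappa> (c * v)))"
      by (intro mult_left_mono) auto
    then show ?thesis by (simp add: expint_tail_def mult_ac)
  qed
qed

text \<open>The power of the product splits because \<open>v\<close> is a positive real. The
  constant factor may be non-real, since its base is negative for \<open>n > 0\<close>.\<close>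

lemma W_fun_eq:
  assumes "n \<noteq> 0" "0 < v"
  shows "W_fun \<kappa> (2 * pi * n * v) = of_real (- 4 * pi * n) powr (1 - of_real \<kappa>) * of_real (expint_tail \<kappa> (- 4 * pi * n) v)"
proof -
  have "complex_of_real (- 2 * (2 * pi * n * v)) = of_real (- 4 * pi * n) * of_real v" by simp
  also have "\<dots> powr complex_of_real (1 - \<kappa>) = of_real (- 4 * pi * n) powr (1 - of_real \<kappa>) * of_real v powr (1 - of_real \<kappa>)"
    using assms by (subst mult.commute, subst powr_times_real_left) (auto simp: mult.commute)
  also have "complex_of_real v powr (1 - of_real \<kappa>) = of_real (v powr (1 - \<kappa>))"
    using assms by (simp add: powr_of_real[symmetric])
  finally show ?thesis
    unfolding W_fun_def expint_tail_def by (simp add: mult_ac)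
qed

section \<open>Fourier series with rational frequencies\<close>

lemma integral_has_sum:
  fixes f :: "'i \<Rightarrow> real \<Rightarrow> 'b::banach"
  assumes cont: "\<And>n. continuous_on {a..b} (f n)"
    and bd: "\<And>n u. u \<in> {a..b} \<Longrightarrow> norm (f n u) \<le> M n" and M: "M summable_on UNIV"
    and S: "\<And>u. u \<in> {a..b} \<Longrightarrow> ((\<lambda>n. f n u) has_sum S u) UNIV"
  shows "((\<lambda>n. integral {a..b} (f n)) has_sum integral {a..b} S) UNIV" "continuous_on {a..b} S"
proof -
  have ul: "uniform_limit {a..b} (\<lambda>X u. \<Sum>n\<in>X. f n u) S (finite_subsets_at_top UNIV)"
    by (rule Weierstrass_m_test_general'[OF bd S M]) auto
  have c: "continuous_on {a..b} (\<lambda>u. \<Sum>n\<in>X. f n u)" for X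
    by (intro continuous_intros cont)
  show "continuous_on {a..b} S"
    by (rule uniform_limit_theorem[OF _ ul]) (use c in auto)
  obtain I J where I: "\<And>X. ((\<lambda>u. \<Sum>n\<in>X. f n u) has_integral I X) {a..b}"
    and J: "(S has_integral J) {a..b}" and IJ: "(I \<longlongrightarrow> J) (finite_subsets_at_top UNIV)"
    by (rule uniform_limit_integral[OF ul c]) auto
  have "((\<lambda>X. \<Sum>n\<in>X. integral {a..b} (f n)) \<longlongrightarrow> J) (finite_subsets_at_top UNIV)"
  proof (rule Lim_transform_eventually[OF IJ])
    show "\<forall>\<^sub>F X in finite_subsets_at_top UNIV. I X = (\<Sum>n\<in>X. integral {a..b} (f n))"
    proof (rule eventually_finite_subsets_at_top_weakI)
      fix X :: "'i set" assume "finite X"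
      then show "I X = (\<Sum>n\<in>X. integral {a..b} (f n))"
        using integral_unique[OF I[of X]] by (simp add: integral_sum cont integrable_continuous_real)
    qed
  qed
  then show "((\<lambda>n. integral {a..b} (f n)) has_sum integral {a..b} S) UNIV"
    using integral_unique[OF J] by (simp add: has_sum_def)
qed

text \<open>Unconditional convergence in finite dimension is absolute, because each coordinate is a
  real series. This supplies majorants from nothing but the pointwise convergence that
  \<open>has_q_expansion\<close> demands.\<close>

lemma summable_on_imp_abs_summable_on:
  fixes f :: "'i \<Rightarrow> 'v::euclidean_space"
  assumes "f summable_on A"
  shows "(\<lambda>i. norm (f i)) summable_on A"
proof -
  have s: "(\<lambda>i. \<bar>f i \<bullet> b\<bar>) summable_on A" for b
  proof -
    have "(\<lambda>i. f i \<bullet> b) summable_on A"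
      using assms by (rule summable_on_bounded_linear[OF bounded_linear_inner_left])
    then show ?thesis by (rule summable_on_iff_abs_summable_on_real[THEN iffD1, unfolded real_norm_def])
  qed
  have "(\<lambda>i. \<Sum>b\<in>B. \<bar>f i \<bullet> b\<bar>) summable_on A" if "finite B" for B
    using that by (induction B rule: finite_induct) (auto intro: summable_on_add s)
  then have "(\<lambda>i. \<Sum>b\<in>Basis. \<bar>f i \<bullet> b\<bar>) summable_on A"
    using finite_Basis by blast
  then show ?thesis
    by (rule Infinite_Sum.abs_summable_on_comparison_test') (rule norm_le_l1)
qed

lemma integral_unit_translate:
  fixes p :: "real \<Rightarrow> 'b::banach"
  assumes "continuous_on UNIV p" "\<And>u. p (u + 1) = p u"
  shows "integral {a + real j..b + real j} p = integral {a..b} p"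
proof (induction j)
  case (Suc j)
  have "integral {a + real (Suc j)..b + real (Suc j)} p = integral {a + real j..b + real j} (p \<circ> (\<lambda>u. u + 1))"
    using integral_shift_Icc_real[of "a + real j" "b + real j" p 1]
    by (simp add: comp_def add_ac)
  also have "p \<circ> (\<lambda>u. u + 1) = p" using assms(2) by (simp add: comp_def)
  finally show ?case using Suc by simp
qed auto

lemma integral_periodic:
  fixes p :: "real \<Rightarrow> 'b::banach"
  assumes c: "continuous_on UNIV p" and p: "\<And>u. p (u + 1) = p u"
  shows "integral {0..real N} p = real N *\<^sub>R integral {- (1 / 2)..1 / 2} p"
proof -
  have i: "p integrable_on {a..b}" for a b
    using c continuous_on_subset by (intro integrable_continuous_real) blast
  have 1: "integral {0..1} p = integral {- (1 / 2)..1 / 2} p"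
  proof -
    have "integral {0..1} p = integral {0..1 / 2} p + integral {1 / 2..1} p"
      by (rule Henstock_Kurzweil_Integration.integral_combine[symmetric]) (auto intro: i)
    also have "integral {1 / 2..1} p = integral {- (1 / 2)..0} p"
      using integral_unit_translate[OF c p, of "- (1 / 2)" 1 0] by simp
    also have "integral {0..1 / 2} p + integral {- (1 / 2)..0} p = integral {- (1 / 2)..1 / 2} p"
      by (subst add.commute, rule Henstock_Kurzweil_Integration.integral_combine) (auto intro: i)
    finally show ?thesis .
  qed
  show ?thesis
  proof (induction N)
    case (Suc N)
    have "integral {0..real (Suc N)} p = integral {0..real N} p + integral {real N..real (Suc N)} p"
      by (rule Henstock_Kurzweil_Integration.integral_combine[symmetric]) (auto intro: i)
    also have "integral {real N..real (Suc N)} p = integral {0..1} p"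
      using integral_unit_translate[OF c p, of 0 N 1] by (simp add: add.commute)
    finally show ?case using Suc 1 by (simp add: algebra_simps)
  qed auto
qed

abbreviation e2pi :: "rat \<Rightarrow> real \<Rightarrow> complex" where
  "e2pi n u \<equiv> cis (2 * pi * of_rat n * u)"

lemma of_real_of_rat: "of_real (of_rat n) = (of_rat n :: complex)"
proof -
  obtain a b where "quotient_of n = (a, b)" by (cases "quotient_of n")
  then have "n = of_int a / of_int b" by (rule quotient_of_div)
  then show ?thesis by (simp add: of_rat_divide)
qed

lemma qpow_eq: "qpow n \<tau> = of_real (exp (- 2 * pi * of_rat n * Im \<tau>)) * e2pi n (Re \<tau>)"
proof -
  have "2 * of_real pi * \<i> * of_rat n * \<tau> = of_real (- 2 * pi * of_rat n * Im \<tau>) + \<i> * of_real (2 * pi * of_rat n * Re \<tau>)"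
    by (subst complex_eq[of \<tau>]) (simp add: algebra_simps of_real_of_rat)
  then show ?thesis
    unfolding qpow_def by (simp only: exp_add exp_of_real cis_conv_exp)
qed

text \<open>The last branch returns the integral unchanged, so that the two informative cases fit
  into one equation.\<close>

lemma integral_e2pi:
  assumes T: "0 < T"
  shows "integral {0..real T} (e2pi n) = (if n = 0 then of_nat T else if n * of_nat T \<in> \<int> then 0 else integral {0..real T} (e2pi n))"
proof -
  consider "n = 0" | "n \<noteq> 0" "n * of_nat T \<in> \<int>" | "n \<noteq> 0" "n * of_nat T \<notin> \<int>" by blast
  then show ?thesis
  proof cases
    case 2
    define a where "a = 2 * pi * real_of_rat n"
    have a: "a \<noteq> 0" using 2 by (simp add: a_def)
    from 2 obtain j where j: "n * of_nat T = of_int j" by (auto elim: Ints_cases)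
    have "real_of_rat n * real T = real_of_rat (n * of_nat T)" by (simp add: of_rat_mult)
    also have "\<dots> = real_of_int j" by (simp add: j)
    finally have "a * real T = 2 * pi * of_int j" by (simp add: a_def)
    then have "cis (a * real T) = 1" by (metis cis_multiple_2pi Ints_of_int)
    moreover have "((\<lambda>u. cis (a * u)) has_integral (cis (a * real T) / (\<i> * a) - cis (a * 0) / (\<i> * a))) {0..real T}"
    proof (intro fundamental_theorem_of_calculus)
      fix u :: real
      have "((\<lambda>u. exp (\<i> * (of_real a * u)) / (\<i> * of_real a)) has_field_derivative exp (\<i> * (of_real a * of_real u))) (at (of_real u))"
        using a by (auto intro!: derivative_eq_intros simp: mult_ac)
      then have "((\<lambda>u. exp (\<i> * (of_real a * of_real u)) / (\<i> * of_real a)) has_vector_derivative exp (\<i> * (of_real a * of_real u))) (at u within {0..real T})"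
        by (rule has_vector_derivative_real_field)
      then show "((\<lambda>u. cis (a * u) / (\<i> * a)) has_vector_derivative cis (a * u)) (at u within {0..real T})"
        by (simp add: cis_conv_exp)
    qed simp
    ultimately show ?thesis using 2 by (simp add: a_def integral_unique)
  qed (auto simp: scaleR_conv_of_real)
qed

lemma norm_integral_e2pi: "norm (integral {0..real T} (e2pi n)) \<le> real T"
proof -
  have "norm (integral {0..real T} (e2pi n)) \<le> 1 * (real T - 0)"
    by (rule integral_bound) (auto intro!: continuous_intros)
  then show ?thesis by simp
qed

text \<open>What V and its conjugate share without reference to the hermitian product: the Fourier
  theory is developed once and interpreted for \<open>sc\<close> and for
  \<open>conj_sc sc\<close>.\<close>

locale complex_space = vector_space sc
  for sc :: "complex \<Rightarrow> 'v::euclidean_space \<Rightarrow> 'v" +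
  assumes sc_of_real: "sc (complex_of_real r) x = r *\<^sub>R x"
begin

lemma scaleR_sc: "r *\<^sub>R sc z x = sc (of_real r * z) x" "sc z (r *\<^sub>R x) = sc (of_real r * z) x"
proof -
  show "r *\<^sub>R sc z x = sc (of_real r * z) x"
    using sc_of_real[of r "sc z x"] scale_scale[of "of_real r" z x] by metis
  show "sc z (r *\<^sub>R x) = sc (of_real r * z) x"
    using sc_of_real[of r x] scale_scale[of z "of_real r" x] by (metis mult.commute)
qed

lemma bounded_bilinear_sc: "bounded_bilinear sc"
proof -
  have "bilinear sc"
    unfolding bilinear_def
    by (auto intro!: linearI simp: scale_right_distrib scale_left_distrib scaleR_sc scaleR_conv_of_real)
  then show ?thesis by (simp add: bilinear_conv_bounded_bilinear)
qed

sublocale bsc: bounded_bilinear sc by (rule bounded_bilinear_sc)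

text \<open>A maximal independent subset of the real basis is a complex basis, as the scalars extend
  the real ones. Its coordinate functionals are complex linear, so they carry vector-valued
  holomorphic functions to scalar ones, while Euclidean coordinates are only real linear.\<close>

lemma complex_coordinates:
  obtains B :: "'v set" and r :: "'v \<Rightarrow> 'v \<Rightarrow> complex" where "finite B"
    "\<And>b x y. r b (x + y) = r b x + r b y" "\<And>b a x. r b (sc a x) = a * r b x"
    "\<And>b. bounded_linear (r b)" "\<And>x. x = (\<Sum>b\<in>B. sc (r b x) b)"
proof -
  have spanB: "span (Basis :: 'v set) = UNIV"
  proof -
    have "x \<in> span Basis" for x :: 'v
    proof -
      have "(\<Sum>b\<in>Basis. sc (of_real (x \<bullet> b)) b) \<in> span Basis"
        by (intro span_sum span_scale span_base)
      then show ?thesis by (simp add: sc_of_real euclidean_representation)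
    qed
    then show ?thesis by auto
  qed
  obtain B where B: "B \<subseteq> Basis" "independent B" "Basis \<subseteq> span B"
    using maximal_independent_subset by blast
  have fB: "finite B" using B(1) finite_Basis finite_subset by blast
  have sB: "span B = UNIV"
    using B(3) spanB by (metis span_mono span_span top.extremum_uniqueI)
  define r where "r b x = representation B x b" for b x
  have add: "r b (x + y) = r b x + r b y" for b x y
    unfolding r_def using B sB by (subst representation_add) auto
  have scale: "r b (sc a x) = a * r b x" for b a x
    unfolding r_def using B sB by (subst representation_scale) auto
  have "r b (c *\<^sub>R x) = c *\<^sub>R r b x" for b c x
    unfolding sc_of_real[symmetric] scale scaleR_conv_of_real ..
  then have "linear (r b)" for b
    by (intro linearI add)
  then have "bounded_linear (r b)" for b by (simp add: linear_conv_bounded_linear)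
  moreover have "x = (\<Sum>b\<in>B. sc (r b x) b)" for x
    unfolding r_def using sum_representation_eq[of B x B] B sB fB by simp
  ultimately show thesis using that fB add scale by blast
qed

section \<open>Absolutely convergent vector-valued Fourier series\<close>

context
  fixes \<beta> :: "rat \<Rightarrow> 'v" and H :: "real \<Rightarrow> 'v"
  assumes H: "\<And>u. ((\<lambda>n. sc (e2pi n u) (\<beta> n)) has_sum H u) UNIV"
begin

lemma fourier_abs_summable: "(\<lambda>n. norm (\<beta> n)) summable_on UNIV"
proof (rule summable_on_imp_abs_summable_on)
  have "((\<lambda>n. \<beta> n) has_sum H 0) UNIV" using H[of 0] by simp
  then show "\<beta> summable_on UNIV" by (rule has_sum_imp_summable)
qed

lemma fourier_mean:
  "((\<lambda>n. sc (integral {a..b} (e2pi (n - m))) (\<beta> n)) has_sum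
     integral {a..b} (\<lambda>u. sc (e2pi (- m) u) (H u))) UNIV"
proof -
  from bsc.bounded obtain K where K: "\<And>z x. norm (sc z x) \<le> norm z * norm x * K" by blast
  have "((\<lambda>n. integral {a..b} (\<lambda>u. sc (e2pi (n - m) u) (\<beta> n))) has_sum
     integral {a..b} (\<lambda>u. sc (e2pi (- m) u) (H u))) UNIV"
  proof (rule integral_has_sum(1))
    show "continuous_on {a..b} (\<lambda>u. sc (e2pi (n - m) u) (\<beta> n))" for n
      by (intro bsc.continuous_on continuous_intros)
    show "norm (sc (e2pi (n - m) u) (\<beta> n)) \<le> norm (\<beta> n) * K" for n u
      using K[of "e2pi (n - m) u" "\<beta> n"] by simp
    show "(\<lambda>n. norm (\<beta> n) * K) summable_on UNIV"
      by (intro summable_on_cmult_left fourier_abs_summable)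
    fix u
    have "((\<lambda>n. sc (e2pi (- m) u) (sc (e2pi n u) (\<beta> n))) has_sum sc (e2pi (- m) u) (H u)) UNIV"
      by (rule has_sum_bounded_linear[OF bsc.bounded_linear_right H])
    then show "((\<lambda>n. sc (e2pi (n - m) u) (\<beta> n)) has_sum sc (e2pi (- m) u) (H u)) UNIV"
      by (simp add: cis_mult of_rat_diff of_rat_minus algebra_simps)
  qed
  moreover have "integral {a..b} (\<lambda>u. sc (e2pi (n - m) u) (\<beta> n)) = sc (integral {a..b} (e2pi (n - m))) (\<beta> n)" for n
    using integral_linear[OF _ bsc.bounded_linear_left, of "e2pi (n - m)" "{a..b}" "\<beta> n"]
    by (simp add: o_def integrable_continuous_real continuous_intros)
  ultimately show ?thesis by simp
qed

lemma fourier_continuous: "continuous_on {a..b} H"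
proof -
  from bsc.bounded obtain K where K: "\<And>z x. norm (sc z x) \<le> norm z * norm x * K" by blast
  show ?thesis
  proof (rule integral_has_sum(2))
    show "continuous_on {a..b} (\<lambda>u. sc (e2pi n u) (\<beta> n))" for n
      by (intro bsc.continuous_on continuous_intros)
    show "norm (sc (e2pi n u) (\<beta> n)) \<le> norm (\<beta> n) * K" for n u
      using K[of "e2pi n u" "\<beta> n"] by simp
    show "(\<lambda>n. norm (\<beta> n) * K) summable_on UNIV"
      by (intro summable_on_cmult_left fourier_abs_summable)
  qed (rule H)
qed

text \<open>Over the common period \<open>N\<close> the exponentials with frequencies in
  \<open>(1/N) Z\<close> are orthogonal.\<close>

lemma fourier_coefficient:
  assumes N: "0 < N" and supp: "\<And>n. \<beta> n \<noteq> 0 \<Longrightarrow> n * of_nat N \<in> \<int>" and m: "m * of_nat N \<in> \<int>"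
  shows "integral {0..real N} (\<lambda>u. sc (e2pi (- m) u) (H u)) = real N *\<^sub>R \<beta> m"
proof -
  have "sc (integral {0..real N} (e2pi (n - m))) (\<beta> n) = (if n = m then real N *\<^sub>R \<beta> m else 0)" for n
  proof (cases "\<beta> n = 0 \<or> n = m")
    case True
    then show ?thesis
      using sc_of_real[of "real N" "\<beta> m"] integral_e2pi[OF N, of 0] by auto
  next
    case False
    then have "(n - m) * of_nat N \<in> \<int>" using supp[of n] m by (auto simp: left_diff_distrib)
    then have "integral {0..real N} (e2pi (n - m)) = 0"
      using False by (subst integral_e2pi[OF N]) simp
    then show ?thesis using False by simp
  qed
  then have "((\<lambda>n. if n = m then real N *\<^sub>R \<beta> m else 0) has_sum
     integral {0..real N} (\<lambda>u. sc (e2pi (- m) u) (H u))) UNIV"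
    using fourier_mean[of 0 "real N" m] by simp
  moreover have "((\<lambda>n. if n = m then real N *\<^sub>R \<beta> m else 0) has_sum real N *\<^sub>R \<beta> m) UNIV"
    by (rule has_sum_finite_neutralI[of "{m}"]) auto
  ultimately show ?thesis by (rule has_sum_unique)
qed

end

text \<open>The denominators of the frequencies need not be bounded.  Integrating over a common period of
  finitely many terms isolates one coefficient up to an arbitrarily small tail.\<close>

lemma fourier_unique_0:
  fixes \<beta> :: "rat \<Rightarrow> 'v"
  assumes H: "\<And>u. ((\<lambda>n. sc (e2pi n u) (\<beta> n)) has_sum 0) UNIV"
  shows "\<beta> m = 0"
proof (rule ccontr)
  assume nz: "\<beta> m \<noteq> 0"
  from bsc.bounded obtain K0 where K0: "\<And>z x. norm (sc z x) \<le> norm z * norm x * K0" by blast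
  define K where "K = \<bar>K0\<bar> + 1"
  have K: "norm (sc z x) \<le> norm z * norm x * K" for z x
    by (rule order_trans[OF K0]) (auto simp: K_def intro!: mult_left_mono)
  have Kpos: "K > 0" by (simp add: K_def)
  \<comment> \<open>Chosen such that the tail contributes at most
    \<open>real T * norm (\<beta> m) / 2\<close>, half of the norm of the term to be
    isolated.\<close>
  define \<epsilon> where "\<epsilon> = norm (\<beta> m) / (2 * K)"
  have e: "\<epsilon> > 0" using nz Kpos by (simp add: \<epsilon>_def)
  have sm: "(\<lambda>n. norm (\<beta> n)) summable_on UNIV" by (rule fourier_abs_summable[OF H])
  have "\<forall>\<^sub>F S in finite_subsets_at_top UNIV. dist (\<Sum>n\<in>S. norm (\<beta> n)) (\<Sum>\<^sub>\<infinity>n. norm (\<beta> n)) < \<epsilon>"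
    using tendstoD[OF has_sum_infsum[OF sm, unfolded has_sum_def] e] .
  then obtain S0 where S0: "finite S0" "\<And>S. finite S \<Longrightarrow> S0 \<subseteq> S \<Longrightarrow> dist (\<Sum>n\<in>S. norm (\<beta> n)) (\<Sum>\<^sub>\<infinity>n. norm (\<beta> n)) < \<epsilon>"
    unfolding eventually_finite_subsets_at_top by auto
  define S where "S = insert m S0"
  have S: "finite S" "m \<in> S" "\<bar>(\<Sum>n\<in>S. norm (\<beta> n)) - (\<Sum>\<^sub>\<infinity>n. norm (\<beta> n))\<bar> < \<epsilon>"
    using S0 by (auto simp: S_def dist_real_def)
  \<comment> \<open>A common period for the finitely many differences \<open>n - m\<close>: each
    becomes an integer when multiplied by the product of all their denominators.\<close>
  define T where "T = nat (\<Prod>n\<in>S. snd (quotient_of (n - m)))"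
  have den: "0 < snd (quotient_of n)" for n by (simp add: quotient_of_denom_pos')
  have Tpos: "T > 0" unfolding T_def zero_less_nat_eq by (rule prod_pos) (use den in auto)
  have TI: "(n - m) * of_nat T \<in> \<int>" if "n \<in> S" for n
  proof -
    have "of_nat T = (rat_of_int (\<Prod>n\<in>S. snd (quotient_of (n - m))))"
      unfolding T_def by (rule of_nat_nat, rule prod_nonneg, rule less_imp_le, rule den)
    also have "\<dots> = of_int (snd (quotient_of (n - m))) * of_int (\<Prod>n\<in>S - {n}. snd (quotient_of (n - m)))"
      using prod.remove[OF S(1) that, of "\<lambda>n. snd (quotient_of (n - m))"] by simp
    finally have "(n - m) * of_nat T = (n - m) * of_int (snd (quotient_of (n - m))) * of_int (\<Prod>n\<in>S - {n}. snd (quotient_of (n - m)))"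
      by simp
    also have "(n - m) * of_int (snd (quotient_of (n - m))) = of_int (fst (quotient_of (n - m)))"
      using den[of "n - m"] quotient_of_div[of "n - m", OF prod.collapse[symmetric]] by (simp add: field_simps)
    finally show ?thesis by (simp del: of_int_prod add: Ints_mult)
  qed
  define w where "w n = sc (integral {0..real T} (e2pi (n - m))) (\<beta> n)" for n
  have w0: "(w has_sum 0) UNIV"
    using fourier_mean[OF H, of 0 "real T" m] by (simp add: w_def[abs_def])
  have wz: "w n = 0" if "n \<in> S - {m}" for n
    using that TI[of n] by (simp add: w_def) (subst integral_e2pi[OF Tpos], simp)
  have wm: "w m = real T *\<^sub>R \<beta> m" using sc_of_real[of "real T" "\<beta> m"] integral_e2pi[OF Tpos, of 0] by (simp add: w_def)
  have "(w has_sum (0 - (\<Sum>n\<in>S. w n))) (UNIV - S)"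
    by (rule has_sum_Diff[OF w0 has_sum_finite]) (use S in auto)
  also have "(\<Sum>n\<in>S. w n) = w m"
    using S wz by (simp add: sum.remove)
  finally have w1: "(w has_sum (- w m)) (UNIV - S)" by simp
  have n1: "((\<lambda>n. norm (\<beta> n)) has_sum ((\<Sum>\<^sub>\<infinity>n. norm (\<beta> n)) - (\<Sum>n\<in>S. norm (\<beta> n)))) (UNIV - S)"
    by (rule has_sum_Diff[OF has_sum_infsum[OF sm] has_sum_finite]) (use S in auto)
  have "norm (- w m) \<le> real T * K * ((\<Sum>\<^sub>\<infinity>n. norm (\<beta> n)) - (\<Sum>n\<in>S. norm (\<beta> n)))"
  proof (rule norm_infsum_le[OF w1 has_sum_cmult_right[OF n1]])
    fix n
    have "norm (w n) \<le> norm (integral {0..real T} (e2pi (n - m))) * norm (\<beta> n) * K"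
      unfolding w_def by (rule K)
    also have "\<dots> \<le> real T * norm (\<beta> n) * K"
      using Kpos by (intro mult_right_mono norm_integral_e2pi) auto
    finally show "norm (w n) \<le> real T * K * norm (\<beta> n)" by (simp add: mult_ac)
  qed
  also have "\<dots> \<le> real T * K * \<epsilon>"
    using S(3) Kpos by (intro mult_left_mono) auto
  also have "\<dots> = real T * norm (\<beta> m) / 2"
    using Kpos by (simp add: \<epsilon>_def)
  finally show False using wm nz Tpos by simp
qed


text \<open>On the line \<open>Im \<tau> = 1\<close> the difference of the two expansions is a
  Fourier series with sum \<open>0\<close>, whose coefficients are \<open>c n - c' n\<close> up to
  nonzero factors. So \<open>q_coeff\<close> is meaningful whenever an expansion exists.\<close>

lemma q_expansion_unique:
  assumes "has_q_expansion sc f c" "has_q_expansion sc f c'"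
  shows "c = c'"
proof
  fix n
  have "((\<lambda>n. sc (qpow n \<tau>) (c n) + - sc (qpow n \<tau>) (c' n)) has_sum f \<tau> + - f \<tau>) UNIV" if "\<tau> \<in> \<H>" for \<tau>
    using assms that unfolding has_q_expansion_def by (intro has_sum_add) (auto simp: has_sum_uminus)
  then have *: "((\<lambda>n. sc (e2pi n u) (sc (of_real (exp (- 2 * pi * of_rat n))) (c n - c' n))) has_sum 0) UNIV" for u
    by (drule_tac meta_spec[of _ "Complex u 1"])
      (simp add: qpow_eq upper_half_plane_def scale_right_diff_distrib mult.commute)
  have "sc (of_real (exp (- 2 * pi * of_rat n))) (c n - c' n) = 0"
    by (rule fourier_unique_0[OF *])
  then show "c n = c' n" by (simp del: of_real_exp)
qed

lemma q_coeff_eqI: "has_q_expansion sc f c \<Longrightarrow> q_coeff sc f = c"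
  unfolding q_coeff_def by (rule the_equality) (auto intro: q_expansion_unique)

end

lemma (in hermitian_space) complex_space: "complex_space sc"
  by unfold_locales (rule sc_of_real)

lemma (in hermitian_space) complex_space_conj: "complex_space (conj_sc sc)"
proof -
  interpret c: vector_space "conj_sc sc" by (rule vector_space_conj_sc)
  show ?thesis by unfold_locales (simp add: conj_sc_def sc_of_real)
qed

section \<open>Mean value of the pairing of two Fourier series\<close>

context hermitian_space
begin

lemma herm_add_right: "herm x (y + z) = herm x y + herm x z"
  using herm_add_left[of y z x] herm_commute by (metis complex_cnj_add)

lemma herm_scale_right: "herm x (sc a y) = cnj a * herm x y"
  using herm_scale_left[of a y x] herm_commute by (metis complex_cnj_mult)

lemma herm_conj_sc_right: "herm x (conj_sc sc a y) = a * herm x y"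
  by (simp add: conj_sc_def herm_scale_right)

lemma bounded_bilinear_herm: "bounded_bilinear herm"
proof -
  have "herm (r *\<^sub>R x) y = r *\<^sub>R herm x y" "herm x (r *\<^sub>R y) = r *\<^sub>R herm x y" for r x y
    by (simp_all add: sc_of_real[symmetric] herm_scale_left herm_scale_right scaleR_conv_of_real del: sc_of_real)
  then have "bilinear herm"
    unfolding bilinear_def by (auto intro!: linearI simp: herm_add_left herm_add_right)
  then show ?thesis by (simp add: bilinear_conv_bounded_bilinear)
qed

sublocale bh: bounded_bilinear herm by (rule bounded_bilinear_herm)
sublocale cs: complex_space sc by (rule complex_space)
sublocale cc: complex_space "conj_sc sc" by (rule complex_space_conj)

text \<open>\<open>F\<close> and \<open>H\<close> may have period \<open>N\<close> only, while their
  pairing has period 1. The coefficients are therefore separated on an interval of length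
  \<open>N\<close>, and the result is averaged back to the unit interval. Only \<open>F\<close> is
  expanded termwise; what remains under the integral is a Fourier coefficient of
  \<open>H\<close>.\<close>

lemma fourier_pairing:
  fixes \<alpha> \<beta> :: "rat \<Rightarrow> 'v" and F H :: "real \<Rightarrow> 'v"
  assumes F: "\<And>u. ((\<lambda>n. sc (e2pi n u) (\<alpha> n)) has_sum F u) UNIV"
    and H: "\<And>u. ((\<lambda>n. conj_sc sc (e2pi n u) (\<beta> n)) has_sum H u) UNIV"
    and N: "0 < N" and supp: "\<And>n. \<alpha> n \<noteq> 0 \<Longrightarrow> n * of_nat N \<in> \<int>" "\<And>n. \<beta> n \<noteq> 0 \<Longrightarrow> n * of_nat N \<in> \<int>"
    and per: "\<And>u. herm (F (u + 1)) (H (u + 1)) = herm (F u) (H u)"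
  shows "((\<lambda>n. herm (\<alpha> n) (\<beta> (- n))) has_sum integral {- (1 / 2)..1 / 2} (\<lambda>u. herm (F u) (H u))) UNIV"
proof -
  have cF: "continuous_on {a..b} F" for a b by (rule cs.fourier_continuous[OF F])
  have cH: "continuous_on {a..b} H" for a b by (rule cc.fourier_continuous[OF H])
  have cont: "continuous_on UNIV (\<lambda>u. herm (F u) (H u))"
  proof (rule continuous_at_imp_continuous_on, rule ballI)
    fix u :: real
    have "continuous_on {u - 1..u + 1} (\<lambda>u. herm (F u) (H u))"
      by (intro bh.continuous_on cF cH)
    then show "isCont (\<lambda>u. herm (F u) (H u)) u"
      by (rule continuous_on_interior) simp
  qed
  from bh.bounded obtain K0 where K0: "\<And>x y. norm (herm x y) \<le> norm x * norm y * K0" by blast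
  from cs.bsc.bounded obtain K1 where K1: "\<And>z x. norm (sc z x) \<le> norm z * norm x * K1" by blast
  have "bounded (H ` {0..real N})"
    by (intro compact_imp_bounded compact_continuous_image cH) auto
  then obtain D where D: "\<And>u. u \<in> {0..real N} \<Longrightarrow> norm (H u) \<le> D" unfolding bounded_iff by blast
  have K: "norm (herm (sc (e2pi n u) x) (H u)) \<le> norm x * (\<bar>K1\<bar> * \<bar>D\<bar> * \<bar>K0\<bar>)" if "u \<in> {0..real N}" for n u x
  proof -
    have "norm (sc (e2pi n u) x) \<le> norm x * \<bar>K1\<bar>"
      using K1[of "e2pi n u" x] by (rule order_trans) (auto intro!: mult_left_mono)
    moreover have "norm (H u) \<le> \<bar>D\<bar>" using D[OF that] by simp
    ultimately have "norm (sc (e2pi n u) x) * norm (H u) * \<bar>K0\<bar> \<le> norm x * \<bar>K1\<bar> * \<bar>D\<bar> * \<bar>K0\<bar>"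
      by (intro mult_mono) auto
    moreover have "norm (herm (sc (e2pi n u) x) (H u)) \<le> norm (sc (e2pi n u) x) * norm (H u) * \<bar>K0\<bar>"
      by (rule order_trans[OF K0]) (auto intro!: mult_left_mono)
    ultimately show ?thesis by (simp add: mult.assoc)
  qed
  have "((\<lambda>n. integral {0..real N} (\<lambda>u. herm (sc (e2pi n u) (\<alpha> n)) (H u))) has_sum
      integral {0..real N} (\<lambda>u. herm (F u) (H u))) UNIV"
  proof (rule integral_has_sum(1))
    show "continuous_on {0..real N} (\<lambda>u. herm (sc (e2pi n u) (\<alpha> n)) (H u))" for n
      by (intro bh.continuous_on cs.bsc.continuous_on cH continuous_intros)
    show "norm (herm (sc (e2pi n u) (\<alpha> n)) (H u)) \<le> norm (\<alpha> n) * (\<bar>K1\<bar> * \<bar>D\<bar> * \<bar>K0\<bar>)"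
      if "u \<in> {0..real N}" for n u by (rule K[OF that])
    show "(\<lambda>n. norm (\<alpha> n) * (\<bar>K1\<bar> * \<bar>D\<bar> * \<bar>K0\<bar>)) summable_on UNIV"
      by (intro summable_on_cmult_left cs.fourier_abs_summable[OF F])
    show "((\<lambda>n. herm (sc (e2pi n u) (\<alpha> n)) (H u)) has_sum herm (F u) (H u)) UNIV" for u
      by (rule has_sum_bounded_linear[OF bh.bounded_linear_left F])
  qed
  moreover have "integral {0..real N} (\<lambda>u. herm (sc (e2pi n u) (\<alpha> n)) (H u)) = real N *\<^sub>R herm (\<alpha> n) (\<beta> (- n))" for n
  proof (cases "\<alpha> n = 0")
    case True
    then show ?thesis by (simp add: bh.zero_left)
  next
    case False
    then have "- n * of_nat N \<in> \<int>" using supp(1)[of n] by simp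
    from cc.fourier_coefficient[OF H N supp(2) this]
    have "integral {0..real N} (\<lambda>u. conj_sc sc (e2pi n u) (H u)) = real N *\<^sub>R \<beta> (- n)" by simp
    moreover have "(\<lambda>u. conj_sc sc (e2pi n u) (H u)) integrable_on {0..real N}"
      by (intro integrable_continuous_real cc.bsc.continuous_on cH continuous_intros)
    ultimately have "integral {0..real N} (\<lambda>u. herm (\<alpha> n) (conj_sc sc (e2pi n u) (H u))) = herm (\<alpha> n) (real N *\<^sub>R \<beta> (- n))"
      using integral_linear[of "\<lambda>u. conj_sc sc (e2pi n u) (H u)" "{0..real N}", OF _ bh.bounded_linear_right[of "\<alpha> n"]]
      by (simp only: o_def)
    then show ?thesis by (simp add: herm_conj_sc_right herm_scale_left bh.scaleR_right)
  qed
  ultimately have "((\<lambda>n. real N *\<^sub>R herm (\<alpha> n) (\<beta> (- n))) has_sum integral {0..real N} (\<lambda>u. herm (F u) (H u))) UNIV"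
    by simp
  then have "((\<lambda>n. (1 / real N) *\<^sub>R (real N *\<^sub>R herm (\<alpha> n) (\<beta> (- n)))) has_sum
      (1 / real N) *\<^sub>R integral {0..real N} (\<lambda>u. herm (F u) (H u))) UNIV"
    by (rule has_sum_bounded_linear[OF bounded_linear_scaleR_right])
  then show ?thesis
    using N integral_periodic[OF cont per, of N] by simp
qed

end

section \<open>Fourier expansion of periodic holomorphic functions\<close>

lemma periodic_imp_int_periodic:
  assumes per: "\<And>\<tau>. \<tau> \<in> \<H> \<Longrightarrow> F (\<tau> + of_nat N) = F \<tau>" and t: "\<tau> \<in> \<H>"
  shows "F (\<tau> + of_int m * of_nat N) = F \<tau>"
proof -
  have *: "F (\<tau> + of_nat j * of_nat N) = F \<tau>" if "\<tau> \<in> \<H>" for \<tau> j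
  proof (induction j)
    case (Suc j)
    have "\<tau> + of_nat j * of_nat N \<in> \<H>" using that by (simp add: upper_half_plane_def)
    from per[OF this] Suc show ?case by (simp add: algebra_simps)
  qed auto
  show ?thesis
  proof (cases m)
    case (nonneg j)
    then show ?thesis using *[OF t] by simp
  next
    case (neg j)
    have "\<tau> + of_int m * of_nat N \<in> \<H>" using t by (simp add: upper_half_plane_def)
    from *[OF this, of "Suc j"] have "F (\<tau> + of_int m * of_nat N + of_nat (Suc j) * of_nat N) = F (\<tau> + of_int m * of_nat N)" .
    moreover have "\<tau> + of_int m * of_nat N + of_nat (Suc j) * of_nat N = \<tau>"
      unfolding neg by (simp add: algebra_simps)
    ultimately show ?thesis by metis
  qed
qed

text \<open>\<open>P\<close> is \<open>F\<close> composed with a multiple of the discontinuous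
  principal logarithm. Periodicity makes the value independent of the branch, so near each point a
  local branch may be used instead.\<close>

lemma holomorphic_periodic_factor:
  fixes F :: "complex \<Rightarrow> complex"
  assumes F: "F holomorphic_on \<H>" and N: "0 < N"
    and per: "\<And>\<tau>. \<tau> \<in> \<H> \<Longrightarrow> F (\<tau> + of_nat N) = F \<tau>"
  obtains P where "P holomorphic_on (ball 0 1 - {0})"
    "\<And>\<tau>. \<tau> \<in> \<H> \<Longrightarrow> F \<tau> = P (exp (2 * pi * \<i> * \<tau> / of_nat N))"
proof -
  define w where "w x = of_nat N * x / (2 * pi * \<i>)" for x :: complex
  define P where "P q = F (w (Ln q))" for q
  have Imw: "Im (w x) = - (real N * Re x / (2 * pi))" for x
    by (simp add: w_def Im_divide) (simp add: power2_eq_square)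
  have wH: "w x \<in> \<H>" if "norm (exp x) < 1" for x
    using that N by (auto simp: upper_half_plane_def Imw field_simps mult_neg_pos)
  have key: "P (exp x) = F (w x)" if "norm (exp x) < 1" for x
  proof -
    have "exp (Ln (exp x)) = exp x" by simp
    then obtain m :: int where m: "Ln (exp x) = x + of_int (2 * m) * pi * \<i>"
      unfolding exp_eq by auto
    have "w (Ln (exp x)) = w x + of_int m * of_nat N"
      unfolding m w_def by (simp add: field_simps)
    then show ?thesis
      unfolding P_def using periodic_imp_int_periodic[of F N, OF per wH[OF that]] by simp
  qed
  have "P field_differentiable at q0" if q0: "q0 \<in> ball 0 1 - {0}" for q0
  proof -
    have nz: "q0 \<noteq> 0" and lt: "norm q0 < 1" using q0 by auto
    define S where "S = ball q0 (norm q0) \<inter> ball 0 1"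
    \<comment> \<open>A logarithm near \<open>q0\<close>: on the disc of radius
      \<open>norm q0\<close> about \<open>q0\<close> the quotient \<open>q / q0\<close> has positive
      real part.\<close>
    define g where "g q = Ln q0 + Ln (q / q0)" for q
    have S: "open S" "q0 \<in> S" using nz lt by (auto simp: S_def)
    have quot: "q / q0 \<notin> \<real>\<^sub>\<le>\<^sub>0" "q \<noteq> 0" if "q \<in> S" for q
    proof -
      have "norm (q0 - q) < norm q0" using that by (simp add: S_def dist_norm)
      moreover have "1 - q / q0 = (q0 - q) / q0" using nz by (simp add: field_simps)
      ultimately have "norm (1 - q / q0) < 1" using nz by (simp add: norm_divide)
      moreover have "1 - Re (q / q0) \<le> norm (1 - q / q0)"
        using complex_Re_le_cmod[of "1 - q / q0"] by simp
      ultimately have "0 < Re (q / q0)" by linarith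
      then show "q / q0 \<notin> \<real>\<^sub>\<le>\<^sub>0" "q \<noteq> 0" by (auto simp: complex_nonpos_Reals_iff)
    qed
    have gexp: "exp (g q) = q" if "q \<in> S" for q
      using quot[OF that] nz by (simp add: g_def exp_add)
    have Pg: "P q = F (w (g q))" if "q \<in> S" for q
    proof -
      have "norm (exp (g q)) < 1" using gexp[OF that] that by (simp add: S_def)
      from key[OF this] gexp[OF that] show ?thesis by simp
    qed
    have "(w \<circ> g) holomorphic_on S"
      unfolding w_def g_def o_def using quot nz by (intro holomorphic_intros) auto
    moreover have "(w \<circ> g) ` S \<subseteq> \<H>"
    proof (clarsimp)
      fix q assume "q \<in> S"
      then show "w (g q) \<in> \<H>" using gexp[of q] by (intro wH) (simp add: S_def)
    qed
    ultimately have "(F \<circ> (w \<circ> g)) holomorphic_on S"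
      by (rule holomorphic_on_compose_gen[OF _ F])
    then have "P holomorphic_on S"
      by (rule holomorphic_transform) (simp add: Pg)
    then show ?thesis using S by (simp add: holomorphic_on_imp_differentiable_at)
  qed
  then have "P holomorphic_on (ball 0 1 - {0})"
    by (simp add: holomorphic_on_def field_differentiable_at_within)
  moreover have "F \<tau> = P (exp (2 * pi * \<i> * \<tau> / of_nat N))" if t: "\<tau> \<in> \<H>" for \<tau>
  proof -
    have "w (2 * pi * \<i> * \<tau> / of_nat N) = \<tau>" using N by (simp add: w_def)
    moreover have "norm (exp (2 * pi * \<i> * \<tau> / of_nat N)) < 1"
      using t N by (simp add: upper_half_plane_def)
    ultimately show ?thesis using key by metis
  qed
  ultimately show thesis using that by blast
qed

text \<open>In the variable \<open>q = exp (2 * pi * \<i> * \<tau> / N)\<close> exponential growth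
  means at most a pole at \<open>0\<close>; multiplication by \<open>q ^ M\<close> removes it, and
  the Taylor series shifted by \<open>M\<close> is the expansion.\<close>

lemma fourier_expansion_scalar:
  fixes F :: "complex \<Rightarrow> complex"
  assumes F: "F holomorphic_on \<H>" and N: "0 < N"
    and per: "\<And>\<tau>. \<tau> \<in> \<H> \<Longrightarrow> F (\<tau> + of_nat N) = F \<tau>"
    and growth: "\<And>\<tau>. \<tau> \<in> \<H> \<Longrightarrow> v\<^sub>0 \<le> Im \<tau> \<Longrightarrow> norm (F \<tau>) \<le> A * exp (C * Im \<tau>)"
  obtains c :: "rat \<Rightarrow> complex" where "\<And>n. c n \<noteq> 0 \<Longrightarrow> n * of_nat N \<in> \<int>" "finite {n. n < 0 \<and> c n \<noteq> 0}"
    "\<And>\<tau>. \<tau> \<in> \<H> \<Longrightarrow> ((\<lambda>n. qpow n \<tau> * c n) has_sum F \<tau>) UNIV"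
proof -
  obtain P where P: "P holomorphic_on (ball 0 1 - {0})"
    and FP: "\<And>\<tau>. \<tau> \<in> \<H> \<Longrightarrow> F \<tau> = P (exp (2 * pi * \<i> * \<tau> / of_nat N))"
    by (rule holomorphic_periodic_factor[OF F N per]) auto
  \<comment> \<open>\<open>exp (C * Im \<tau>)\<close> is \<open>norm q\<close> to the power
    \<open>- C * N / (2 * pi)\<close>. The additional \<open>1\<close> makes \<open>R\<close>
    bounded by a multiple of \<open>norm q\<close>, hence continuous at the origin with value
    \<open>0\<close>.\<close>
  define M where "M = nat \<lceil>\<bar>C\<bar> * real N / (2 * pi) + 1\<rceil>"
  have M: "\<bar>C\<bar> * real N / (2 * pi) + 1 \<le> real M" by (simp add: M_def) linarith
  define R where "R q = (if q = 0 then 0 else q ^ M * P q)" for q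
  \<comment> \<open>For \<open>q \<noteq> 0\<close>, \<open>norm q < r\<close> guarantees both
    \<open>\<tau> \<in> \<H>\<close> and \<open>v\<^sub>0 \<le> Im \<tau>\<close> for the preimage
    of \<open>q\<close>.\<close>
  define r where "r = min 1 (exp (- 2 * pi * v\<^sub>0 / real N))"
  have r: "0 < r" by (simp add: r_def)
  have Rb: "norm (R q) \<le> \<bar>A\<bar> * norm q" if "norm q < r" for q
  proof (cases "q = 0")
    case False
    define \<tau> where "\<tau> = of_nat N * Ln q / (2 * pi * \<i>)"
    have im: "Im \<tau> = - (real N * ln (norm q) / (2 * pi))"
      using False by (simp add: \<tau>_def Im_divide) (simp add: power2_eq_square)
    have q1: "norm q < 1" "norm q < exp (- 2 * pi * v\<^sub>0 / real N)" using that by (auto simp: r_def)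
    have l1: "ln (norm q) < 0" using q1 False by simp
    have "ln (norm q) < ln (exp (- 2 * pi * v\<^sub>0 / real N))"
      using q1 False by (subst ln_less_cancel_iff) auto
    then have "ln (norm q) < - 2 * pi * v\<^sub>0 / real N" by simp
    then have "v\<^sub>0 \<le> Im \<tau>" using N by (simp add: im field_simps)
    have H: "\<tau> \<in> \<H>" using l1 N by (simp add: upper_half_plane_def im field_simps mult_pos_neg)
    have "exp (2 * pi * \<i> * \<tau> / of_nat N) = q" using N False by (simp add: \<tau>_def)
    then have "norm (P q) = norm (F \<tau>)" using FP[OF H] by simp
    also have "\<dots> \<le> A * exp (C * Im \<tau>)" by (rule growth[OF H]) fact
    also have "\<dots> \<le> \<bar>A\<bar> * exp (\<bar>C\<bar> * Im \<tau>)"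
      using H by (intro mult_mono) (auto simp: upper_half_plane_def intro!: mult_right_mono)
    also have "\<bar>C\<bar> * Im \<tau> = - (\<bar>C\<bar> * real N / (2 * pi)) * ln (norm q)" by (simp add: im)
    also have "\<dots> \<le> - (real M - 1) * ln (norm q)"
      using l1 M by (intro mult_right_mono_neg) auto
    finally have "norm (P q) \<le> \<bar>A\<bar> * exp (- (real M - 1) * ln (norm q))" by (simp add: mult_left_mono)
    then have "norm (R q) \<le> norm q ^ M * (\<bar>A\<bar> * exp (- (real M - 1) * ln (norm q)))"
      using False by (simp add: R_def norm_mult norm_power mult_left_mono)
    also have "norm q ^ M = exp (real M * ln (norm q))" using False by (simp add: exp_of_nat_mult)
    also have "exp (real M * ln (norm q)) * (\<bar>A\<bar> * exp (- (real M - 1) * ln (norm q))) =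
        \<bar>A\<bar> * exp (real M * ln (norm q) + - (real M - 1) * ln (norm q))"
      by (simp only: exp_add mult_ac)
    also have "real M * ln (norm q) + - (real M - 1) * ln (norm q) = ln (norm q)" by (simp add: algebra_simps)
    finally show ?thesis using False by simp
  qed (simp add: R_def)
  have R: "R holomorphic_on ball 0 1"
  proof (rule no_isolated_singularity'[where K = "{0}"])
    have "(R \<longlongrightarrow> 0) (at 0)"
    proof (rule Lim_null_comparison[where g = "\<lambda>q. \<bar>A\<bar> * norm q"])
      show "\<forall>\<^sub>F q in at 0. norm (R q) \<le> \<bar>A\<bar> * norm q"
        using Rb r unfolding eventually_at dist_norm by (intro exI[of _ r]) auto
      show "((\<lambda>q::complex. \<bar>A\<bar> * norm q) \<longlongrightarrow> 0) (at 0)"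
        by (auto intro!: tendsto_eq_intros)
    qed
    then show "(R \<longlongrightarrow> R z) (at z within ball 0 1)" if "z \<in> {0}" for z
      using that by (auto simp: R_def intro: tendsto_within_subset)
    have "(\<lambda>q. q ^ M * P q) holomorphic_on ball 0 1 - {0}"
      by (intro holomorphic_intros P)
    then show "R holomorphic_on ball 0 1 - {0}"
      by (rule holomorphic_transform) (simp add: R_def)
  qed auto
  define a where "a j = (deriv ^^ j) R 0 / fact j" for j
  have sums: "(\<lambda>j. a j * q ^ j) sums R q" if "norm q < 1" for q
    using holomorphic_power_series[OF R, of q] that by (simp add: a_def)
  have hs: "((\<lambda>j. a j * q ^ j) has_sum R q) UNIV" if q: "norm q < 1" for q
  proof (rule norm_summable_imp_has_sum[OF _ sums[OF q]])
    obtain s where s: "norm q < s" "s < 1" using dense[OF q] by blast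
    then have s0: "0 \<le> s" using norm_ge_zero[of q] by linarith
    have "summable (\<lambda>j. a j * of_real s ^ j)"
      using sums[of "of_real s"] s s0 by (simp add: sums_iff)
    then show "summable (\<lambda>j. norm (a j * q ^ j))"
      by (rule powser_insidea) (use s s0 in simp)
  qed
  \<comment> \<open>The frequency of the \<open>j\<close>-th Taylor term after division by
    \<open>q ^ M\<close>.\<close>
  define \<iota> where "\<iota> j = (of_nat j - of_nat M) / (of_nat N :: rat)" for j
  have inj: "inj \<iota>" using N by (auto simp: inj_def \<iota>_def)
  define c where "c n = (if n \<in> range \<iota> then a (the_inv \<iota> n) else 0)" for n
  have c\<iota>: "c (\<iota> j) = a j" for j using inj by (simp add: c_def the_inv_f_f)
  show thesis
  proof (rule that)
    show "n * of_nat N \<in> \<int>" if "c n \<noteq> 0" for n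
    proof -
      from that obtain j where "n = \<iota> j" by (auto simp: c_def split: if_splits)
      then have "n * of_nat N = of_nat j - of_nat M" using N by (simp add: \<iota>_def)
      then show ?thesis by simp
    qed
    have "{n. n < 0 \<and> c n \<noteq> 0} \<subseteq> \<iota> ` {..<M}"
    proof
      fix n assume n: "n \<in> {n. n < 0 \<and> c n \<noteq> 0}"
      then obtain j where j: "n = \<iota> j" by (auto simp: c_def split: if_splits)
      with n N have "(of_nat j :: rat) < of_nat M" by (simp add: \<iota>_def divide_less_0_iff)
      then show "n \<in> \<iota> ` {..<M}" using j by auto
    qed
    then show "finite {n. n < 0 \<and> c n \<noteq> 0}" by (rule finite_subset) auto
    fix \<tau> assume t: "\<tau> \<in> \<H>"
    define q where "q = exp (2 * pi * \<i> * \<tau> / of_nat N)"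
    have q: "norm q < 1" "q \<noteq> 0" using t N by (auto simp: q_def upper_half_plane_def)
    have qp: "qpow (\<iota> j) \<tau> = inverse (q ^ M) * q ^ j" for j
    proof -
      have "2 * of_real pi * \<i> * of_rat (\<iota> j) * \<tau> =
          of_nat j * (2 * pi * \<i> * \<tau> / of_nat N) - of_nat M * (2 * pi * \<i> * \<tau> / of_nat N)"
        using N by (simp add: \<iota>_def of_rat_divide of_rat_diff field_simps)
      then show ?thesis
        unfolding qpow_def by (simp only: exp_diff exp_of_nat_mult q_def) (simp add: field_simps)
    qed
    have "((\<lambda>j. inverse (q ^ M) * (a j * q ^ j)) has_sum inverse (q ^ M) * R q) UNIV"
      by (rule has_sum_cmult_right[OF hs[OF q(1)]])
    also have "inverse (q ^ M) * R q = F \<tau>"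
      using q FP[OF t] by (simp add: R_def q_def)
    also have "(\<lambda>j. inverse (q ^ M) * (a j * q ^ j)) = (\<lambda>n. qpow n \<tau> * c n) \<circ> \<iota>"
      by (auto simp: qp c\<iota> mult_ac)
    finally have "((\<lambda>n. qpow n \<tau> * c n) has_sum F \<tau>) (range \<iota>)"
      using has_sum_reindex[OF inj] by metis
    then show "((\<lambda>n. qpow n \<tau> * c n) has_sum F \<tau>) UNIV"
      by (rule has_sum_cong_neutral[THEN iffD1, rotated 3]) (auto simp: c_def)
  qed
qed


lemma has_sum_sum:
  fixes f :: "'i \<Rightarrow> 'j \<Rightarrow> 'b::{comm_monoid_add, topological_comm_monoid_add}"
  assumes "finite B" "\<And>b. b \<in> B \<Longrightarrow> (f b has_sum S b) A"
  shows "((\<lambda>n. \<Sum>b\<in>B. f b n) has_sum (\<Sum>b\<in>B. S b)) A"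
  using assms by (induction B rule: finite_induct) (auto intro!: has_sum_add)

lemma (in complex_space) q_expansion_exists:
  assumes hol: "holomorphic_into sc f" and growth: "exp_growth f" and N: "0 < N"
    and per: "\<And>\<tau>. \<tau> \<in> \<H> \<Longrightarrow> f (\<tau> + of_nat N) = f \<tau>"
  obtains c where "has_q_expansion sc f c" "\<And>n. c n \<noteq> 0 \<Longrightarrow> n * of_nat N \<in> \<int>"
proof -
  obtain B r where fB: "finite B" and r: "\<And>b x y. r b (x + y) = r b x + r b y"
    "\<And>b a x. r b (sc a x) = a * r b x" "\<And>b. bounded_linear (r b)" "\<And>x. x = (\<Sum>b\<in>B. sc (r b x) b)"
    by (rule complex_coordinates) blast
  from growth obtain C A v\<^sub>0 where gr: "\<And>\<tau>. \<tau> \<in> \<H> \<Longrightarrow> v\<^sub>0 \<le> Im \<tau> \<Longrightarrow> norm (f \<tau>) \<le> A * exp (C * Im \<tau>)"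
    unfolding exp_growth_def by blast
  define Q where "Q b c \<longleftrightarrow> (\<forall>n. c n \<noteq> 0 \<longrightarrow> n * of_nat N \<in> \<int>) \<and> finite {n. n < 0 \<and> c n \<noteq> 0} \<and>
      (\<forall>\<tau>\<in>\<H>. ((\<lambda>n. qpow n \<tau> * c n) has_sum r b (f \<tau>)) UNIV)" for b and c :: "rat \<Rightarrow> complex"
  have ex: "\<exists>c. Q b c" for b
  proof -
    from bounded_linear.bounded[OF r(3)] obtain K where K: "\<And>x. norm (r b x) \<le> norm x * K" by blast
    have K': "norm (r b x) \<le> \<bar>K\<bar> * norm x" for x
      using K[of x] by (rule order_trans) (simp add: mult.commute mult_right_mono)
    have h: "(\<lambda>\<tau>. r b (f \<tau>)) holomorphic_on \<H>"
      unfolding holomorphic_on_def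
    proof
      fix \<tau> assume "\<tau> \<in> \<H>"
      then obtain d where "(f has_derivative (\<lambda>h. sc h d)) (at \<tau>)" using hol by (auto simp: holomorphic_into_def)
      from bounded_linear.has_derivative[OF r(3) this]
      have "((\<lambda>\<tau>. r b (f \<tau>)) has_field_derivative r b d) (at \<tau>)"
        by (simp add: has_field_derivative_def r(2) mult_commute_abs)
      then show "(\<lambda>\<tau>. r b (f \<tau>)) field_differentiable (at \<tau> within \<H>)"
        by (meson field_differentiable_at_within field_differentiable_def)
    qed
    have g: "norm (r b (f \<tau>)) \<le> (\<bar>K\<bar> * A) * exp (C * Im \<tau>)" if "\<tau> \<in> \<H>" "v\<^sub>0 \<le> Im \<tau>" for \<tau>
      using order_trans[OF K'[of "f \<tau>"] mult_left_mono[OF gr[OF that]]] by (simp add: mult.assoc)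
    have p: "r b (f (\<tau> + of_nat N)) = r b (f \<tau>)" if "\<tau> \<in> \<H>" for \<tau> using per[OF that] by simp
    show ?thesis
    proof (rule fourier_expansion_scalar[OF h N p g])
      fix c :: "rat \<Rightarrow> complex"
      assume "\<And>n. c n \<noteq> 0 \<Longrightarrow> n * of_nat N \<in> \<int>" "finite {n. n < 0 \<and> c n \<noteq> 0}"
        "\<And>\<tau>. \<tau> \<in> \<H> \<Longrightarrow> ((\<lambda>n. qpow n \<tau> * c n) has_sum r b (f \<tau>)) UNIV"
      then have "Q b c" unfolding Q_def by blast
      then show ?thesis by blast
    qed
  qed
  define c where "c b = (SOME c. Q b c)" for b
  have Q: "Q b (c b)" for b unfolding c_def by (rule someI_ex[OF ex])
  have c: "\<And>b n. c b n \<noteq> 0 \<Longrightarrow> n * of_nat N \<in> \<int>" "\<And>b. finite {n. n < 0 \<and> c b n \<noteq> 0}"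
    "\<And>b \<tau>. \<tau> \<in> \<H> \<Longrightarrow> ((\<lambda>n. qpow n \<tau> * c b n) has_sum r b (f \<tau>)) UNIV"
    using Q unfolding Q_def by blast+
  define c' where "c' n = (\<Sum>b\<in>B. sc (c b n) b)" for n
  have nz: "\<exists>b\<in>B. c b n \<noteq> 0" if "c' n \<noteq> 0" for n
  proof (rule ccontr)
    assume "\<not> ?thesis"
    then have "c' n = 0" unfolding c'_def by (intro sum.neutral) auto
    with that show False by blast
  qed
  have "has_q_expansion sc f c'"
    unfolding has_q_expansion_def
  proof (intro conjI ballI)
    have "{n. n < 0 \<and> c' n \<noteq> 0} \<subseteq> (\<Union>b\<in>B. {n. n < 0 \<and> c b n \<noteq> 0})" using nz by blast
    then show "finite {n. n < 0 \<and> c' n \<noteq> 0}" by (rule finite_subset) (use fB c(2) in blast)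
    fix \<tau> assume t: "\<tau> \<in> \<H>"
    have "((\<lambda>n. \<Sum>b\<in>B. sc (qpow n \<tau> * c b n) b) has_sum (\<Sum>b\<in>B. sc (r b (f \<tau>)) b)) UNIV"
      by (intro has_sum_sum fB has_sum_bounded_linear[OF bsc.bounded_linear_left c(3)[OF t]])
    then show "((\<lambda>n. sc (qpow n \<tau>) (c' n)) has_sum f \<tau>) UNIV"
      by (simp add: c'_def scale_sum_right r(4)[symmetric])
  qed
  moreover have "n * of_nat N \<in> \<int>" if "c' n \<noteq> 0" for n using nz[OF that] c(1) by blast
  ultimately show thesis using that by blast
qed

section \<open>Integration over the fundamental domain\<close>

lemma integral_exp_holomorphic:
  fixes X l :: "'a::euclidean_space \<Rightarrow> complex"
  assumes S: "compact S" and X: "continuous_on S X" and l: "continuous_on S l"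
  shows "(\<lambda>s. integral S (\<lambda>x. X x * exp (s * l x))) holomorphic_on UNIV"
proof -
  define \<phi> where "\<phi> x = indicator S x *\<^sub>R X x" for x
  define l' where "l' x = indicator S x *\<^sub>R l x" for x
  have \<phi>: "integrable lborel \<phi>" unfolding \<phi>_def by (rule borel_integrable_compact[OF S X])
  have [measurable]: "\<phi> \<in> borel_measurable lborel" using \<phi> by simp
  have [measurable]: "l' \<in> borel_measurable lborel"
    using borel_integrable_compact[OF S l] unfolding l'_def by (rule borel_measurable_integrable)
  have eq: "integral S (\<lambda>x. X x * exp (s * l x)) = (\<integral>x. \<phi> x * exp (s * l' x) \<partial>lborel)" for s
  proof -
    have "continuous_on S (\<lambda>x. X x * exp (s * l x))" by (intro continuous_intros X l)
    then have "set_integrable lborel S (\<lambda>x. X x * exp (s * l x))"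
      unfolding set_integrable_def by (rule borel_integrable_compact[OF S])
    from set_borel_integral_eq_integral(2)[OF this]
    have "integral S (\<lambda>x. X x * exp (s * l x)) = (\<integral>x. indicator S x *\<^sub>R (X x * exp (s * l x)) \<partial>lborel)"
      by (simp add: set_lebesgue_integral_def)
    also have "(\<lambda>x. indicator S x *\<^sub>R (X x * exp (s * l x))) = (\<lambda>x. \<phi> x * exp (s * l' x))"
      by (auto simp: \<phi>_def l'_def indicator_def)
    finally show ?thesis .
  qed
  have "(\<lambda>s. \<integral>x. \<phi> x * exp (s * l' x) \<partial>lborel) field_differentiable (at s)" for s
  proof -
    define \<delta> where "\<delta> = norm s + 1"
    have "continuous_on S (\<lambda>x. norm (X x) * exp (\<delta> * norm (l x)))" by (intro continuous_intros X l)
    from borel_integrable_compact[OF S this]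
    have "integrable lborel (\<lambda>x. indicator S x *\<^sub>R (norm (X x) * exp (\<delta> * norm (l x))))" .
    also have "(\<lambda>x. indicator S x *\<^sub>R (norm (X x) * exp (\<delta> * norm (l x)))) = (\<lambda>x. norm (\<phi> x) * exp (\<delta> * norm (l' x)))"
      by (auto simp: \<phi>_def l'_def indicator_def)
    finally have int: "integrable lborel (\<lambda>x. norm (\<phi> x) * exp (\<delta> * norm (l' x)))" .
    have "norm s < \<delta>" by (simp add: \<delta>_def)
    from has_field_derivative_integral_exp[OF _ _ int this]
    show ?thesis by (auto simp: field_differentiable_def)
  qed
  then show ?thesis by (simp add: eq holomorphic_on_def)
qed

lemma measurable_Complex: "(\<lambda>(x, y). Complex x y) \<in> borel_measurable (lborel \<Otimes>\<^sub>M lborel)"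
proof -
  have "(\<lambda>p. Complex (fst p) (snd p)) \<in> borel_measurable borel"
    by (intro borel_measurable_continuous_onI continuous_intros)
  then show ?thesis by (simp add: lborel_prod split_def)
qed

text \<open>Lebesgue measure is determined by its values on boxes. The identification brings
  integrals over subsets of the complex plane under Fubini's theorem for pairs of reals.\<close>

lemma lborel_complex: "(lborel :: complex measure) = distr (lborel \<Otimes>\<^sub>M lborel) borel (\<lambda>(x, y). Complex x y)"
proof (rule lborel_eqI)
  note measurable_Complex [measurable]
  fix l u :: complex assume lu: "\<And>b. b \<in> Basis \<Longrightarrow> l \<bullet> b \<le> u \<bullet> b"
  have le: "Re l \<le> Re u" "Im l \<le> Im u" using lu[of 1] lu[of \<i>] by (simp_all add: Basis_complex_def)
  have "emeasure (distr (lborel \<Otimes>\<^sub>M lborel) borel (\<lambda>(x, y). Complex x y)) (box l u) =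
      emeasure (lborel \<Otimes>\<^sub>M lborel) (box (Re l) (Re u) \<times> box (Im l) (Im u))"
    by (subst emeasure_distr) (auto simp: box_def Basis_complex_def space_pair_measure intro!: arg_cong2[where f = emeasure])
  also have "\<dots> = (\<Prod>b\<in>Basis. (u - l) \<bullet> b)"
    using le by (simp add: lborel.emeasure_pair_measure_Times Basis_complex_def ennreal_mult)
  finally show "emeasure (distr (lborel \<Otimes>\<^sub>M lborel) borel (\<lambda>(x, y). Complex x y)) (box l u) = (\<Prod>b\<in>Basis. (u - l) \<bullet> b)" .
qed simp

section \<open>The truncated fundamental domain as a region above the unit circle\<close>

definition arc_height :: "real \<Rightarrow> real" where "arc_height u = sqrt (1 - u\<^sup>2)"

lemma arc_height_bounds:
  assumes "u \<in> {- (1 / 2)..1 / 2}"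
  shows "1 / 2 < arc_height u" "arc_height u \<le> 1" "u\<^sup>2 + (arc_height u)\<^sup>2 = 1"
proof -
  have "\<bar>u\<bar> \<le> 1 / 2" using assms by auto
  then have "\<bar>u\<bar>\<^sup>2 \<le> (1 / 2)\<^sup>2" by (intro power_mono) auto
  then have u: "u\<^sup>2 \<le> 1 / 4" by (simp add: power2_eq_square)
  show "1 / 2 < arc_height u" unfolding arc_height_def by (rule real_less_rsqrt) (use u in \<open>simp add: power2_eq_square\<close>)
  show "arc_height u \<le> 1" "u\<^sup>2 + (arc_height u)\<^sup>2 = 1" using u by (auto simp: arc_height_def)
qed

lemma mem_fund_dom:
  "Complex u v \<in> fund_dom t \<longleftrightarrow> u \<in> {- (1 / 2)..1 / 2} \<and> v \<in> {arc_height u..t}"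
proof -
  have "v > 0 \<and> 1 \<le> norm (Complex u v) \<longleftrightarrow> arc_height u \<le> v" if "u \<in> {- (1 / 2)..1 / 2}"
  proof -
    have "1 \<le> norm (Complex u v) \<longleftrightarrow> 1 \<le> u\<^sup>2 + v\<^sup>2" by (simp add: complex_norm)
    also have "\<dots> \<longleftrightarrow> (arc_height u)\<^sup>2 \<le> v\<^sup>2" using arc_height_bounds(3)[OF that] by linarith
    finally show ?thesis
      using arc_height_bounds(1)[OF that] power2_le_imp_le[of "arc_height u" v] power_mono[of "arc_height u" v 2] by auto
  qed
  moreover have "\<bar>u\<bar> \<le> 1 / 2 \<longleftrightarrow> u \<in> {- (1 / 2)..1 / 2}" by auto
  ultimately show ?thesis unfolding fund_dom_def upper_half_plane_def by fastforce
qed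

lemma fund_dom_subset: "fund_dom t \<subseteq> \<H>"
  by (auto simp: fund_dom_def)

lemma Im_fund_dom: "\<tau> \<in> fund_dom t \<Longrightarrow> 1 / 2 < Im \<tau>"
  using mem_fund_dom[of "Re \<tau>" "Im \<tau>" t] arc_height_bounds(1)[of "Re \<tau>"] by simp

lemma compact_fund_dom: "compact (fund_dom t)"
proof -
  have "fund_dom t = {\<tau>. Re \<tau> \<le> 1 / 2} \<inter> {\<tau>. - (1 / 2) \<le> Re \<tau>} \<inter> {\<tau>. 1 \<le> norm \<tau>} \<inter> {\<tau>. Im \<tau> \<le> t} \<inter> {\<tau>. 1 / 2 \<le> Im \<tau>}"
    using Im_fund_dom[of _ t] by (auto simp: fund_dom_def upper_half_plane_def abs_le_iff) (fastforce dest: less_imp_le)+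
  also have "closed \<dots>"
    by (intro closed_Int closed_Collect_le continuous_intros)
  finally have "closed (fund_dom t)" .
  moreover have "bounded (fund_dom t)"
  proof (rule boundedI)
    fix \<tau> assume "\<tau> \<in> fund_dom t"
    then have "\<bar>Re \<tau>\<bar> \<le> 1 / 2" "\<bar>Im \<tau>\<bar> \<le> \<bar>t\<bar>" by (auto simp: fund_dom_def upper_half_plane_def)
    then show "norm \<tau> \<le> 1 / 2 + \<bar>t\<bar>" using cmod_le[of \<tau>] by linarith
  qed
  ultimately show ?thesis by (simp add: compact_eq_bounded_closed)
qed

lemma continuous_on_vertical:
  assumes "continuous_on \<H> X" "A \<subseteq> {0<..}"
  shows "continuous_on A (\<lambda>v. X (Complex u v))"
  by (rule continuous_on_compose2[OF assms(1)])
    (use assms(2) in \<open>auto intro!: continuous_intros simp: upper_half_plane_def\<close>)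

lemma fund_dom_iterated:
  fixes X :: "complex \<Rightarrow> complex"
  assumes X: "continuous_on \<H> X"
  shows "integral (fund_dom t) X = integral {- (1 / 2)..1 / 2} (\<lambda>u. integral {arc_height u..t} (\<lambda>v. X (Complex u v)))"
    and "(\<lambda>u. integral {arc_height u..t} (\<lambda>v. X (Complex u v))) integrable_on {- (1 / 2)..1 / 2}"
proof -
  let ?f = "\<lambda>\<tau>. indicator (fund_dom t) \<tau> *\<^sub>R X \<tau>"
  let ?g = "\<lambda>(x, y). ?f (Complex x y)"
  note measurable_Complex [measurable]
  have "continuous_on (fund_dom t) X" using X fund_dom_subset by (rule continuous_on_subset)
  then have i: "integrable lborel ?f" by (rule borel_integrable_compact[OF compact_fund_dom])
  then have [measurable]: "?f \<in> borel_measurable borel" by simp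
  have gi: "integrable (lborel \<Otimes>\<^sub>M lborel) ?g"
    using i unfolding lborel_complex by (subst (asm) integrable_distr_eq) (auto simp: split_def)
  have "integral (fund_dom t) X = (\<integral>\<tau>. ?f \<tau> \<partial>lborel)"
    using set_borel_integral_eq_integral(2)[of "fund_dom t" X] i
    by (simp add: set_integrable_def set_lebesgue_integral_def)
  also have "\<dots> = (\<integral>p. ?g p \<partial>(lborel \<Otimes>\<^sub>M lborel))"
    unfolding lborel_complex by (subst integral_distr) (auto simp: split_def)
  also have "\<dots> = (\<integral>x. (\<integral>y. ?g (x, y) \<partial>lborel) \<partial>lborel)"
    by (rule lborel_pair.integral_fst'[OF gi, symmetric])
  finally have 1: "integral (fund_dom t) X = (\<integral>x. (\<integral>y. ?g (x, y) \<partial>lborel) \<partial>lborel)" .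
  have inner: "(\<integral>y. ?g (x, y) \<partial>lborel) = indicator {- (1 / 2)..1 / 2} x *\<^sub>R integral {arc_height x..t} (\<lambda>v. X (Complex x v))" for x
  proof (cases "x \<in> {- (1 / 2)..1 / 2}")
    case True
    have "continuous_on {arc_height x..t} (\<lambda>v. X (Complex x v))"
      by (rule continuous_on_vertical[OF X]) (use arc_height_bounds(1)[OF True] in auto)
    then have "set_integrable lborel {arc_height x..t} (\<lambda>v. X (Complex x v))"
      unfolding set_integrable_def by (intro borel_integrable_compact) auto
    from set_borel_integral_eq_integral(2)[OF this]
    have "(\<integral>y. indicator {arc_height x..t} y *\<^sub>R X (Complex x y) \<partial>lborel) = integral {arc_height x..t} (\<lambda>v. X (Complex x v))"
      by (simp add: set_lebesgue_integral_def)
    moreover have eq: "(\<lambda>y. ?g (x, y)) = (\<lambda>y. indicator {arc_height x..t} y *\<^sub>R X (Complex x y))"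
      using True by (auto simp: indicator_def mem_fund_dom)
    ultimately show ?thesis unfolding eq using True by simp
  next
    case False
    then have eq: "(\<lambda>y. ?g (x, y)) = (\<lambda>y. 0)" by (auto simp: indicator_def mem_fund_dom)
    show ?thesis unfolding eq using False by simp
  qed
  have si: "set_integrable lborel {- (1 / 2)..1 / 2} (\<lambda>u. integral {arc_height u..t} (\<lambda>v. X (Complex u v)))"
    using lborel_pair.integrable_fst'[OF gi] unfolding set_integrable_def inner .
  show "integral (fund_dom t) X = integral {- (1 / 2)..1 / 2} (\<lambda>u. integral {arc_height u..t} (\<lambda>v. X (Complex u v)))"
    using 1 set_borel_integral_eq_integral(2)[OF si] unfolding inner by (simp add: set_lebesgue_integral_def)
  show "(\<lambda>u. integral {arc_height u..t} (\<lambda>v. X (Complex u v))) integrable_on {- (1 / 2)..1 / 2}"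
    by (rule set_borel_integral_eq_integral(1)[OF si])
qed

text \<open>Above height 1 the domain is a rectangle. The integration over \<open>u\<close> is
  placed inside, because over a full period it selects a Fourier coefficient.\<close>

lemma fund_dom_split:
  fixes X :: "complex \<Rightarrow> complex"
  assumes X: "continuous_on \<H> X" and t: "1 \<le> t"
  shows "integral (fund_dom t) X = integral (fund_dom 1) X +
    integral {1..t} (\<lambda>v. integral {- (1 / 2)..1 / 2} (\<lambda>u. X (Complex u v)))"
proof -
  let ?I = "{- (1 / 2)..1 / 2} :: real set"
  have c: "continuous_on (cbox (- (1 / 2), 1) (1 / 2, t)) (\<lambda>(u, v). X (Complex u v))"
    unfolding split_def
    by (rule continuous_on_compose2[OF X]) (auto intro!: continuous_intros simp: upper_half_plane_def cbox_Pair_eq)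
  have "integral {arc_height u..t} (\<lambda>v. X (Complex u v)) =
      integral {arc_height u..1} (\<lambda>v. X (Complex u v)) + integral {1..t} (\<lambda>v. X (Complex u v))" if "u \<in> ?I" for u
    using arc_height_bounds[OF that] t
    by (intro Henstock_Kurzweil_Integration.integral_combine[symmetric] integrable_continuous_real continuous_on_vertical[OF X]) auto
  then have "integral (fund_dom t) X = integral ?I (\<lambda>u. integral {arc_height u..1} (\<lambda>v. X (Complex u v)) + integral {1..t} (\<lambda>v. X (Complex u v)))"
    unfolding fund_dom_iterated(1)[OF X] by (intro Henstock_Kurzweil_Integration.integral_cong)
  also have "\<dots> = integral (fund_dom 1) X + integral ?I (\<lambda>u. integral {1..t} (\<lambda>v. X (Complex u v)))"
    unfolding fund_dom_iterated(1)[OF X]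
  proof (rule Henstock_Kurzweil_Integration.integral_add[OF fund_dom_iterated(2)[OF X]])
    show "(\<lambda>u. integral {1..t} (\<lambda>v. X (Complex u v))) integrable_on ?I"
      using integral_integrable_2dim[OF c] by (simp add: cbox_interval)
  qed
  also have "integral ?I (\<lambda>u. integral {1..t} (\<lambda>v. X (Complex u v))) = integral {1..t} (\<lambda>v. integral ?I (\<lambda>u. X (Complex u v)))"
    using integral_swap_continuous[OF c] by (simp add: cbox_interval)
  finally show ?thesis .
qed

section \<open>Stokes' theorem on the truncated fundamental domain\<close>

definition arc_slope :: "real \<Rightarrow> real" where "arc_slope u = - u / arc_height u"

lemma has_real_derivative_arc_height:
  assumes "u \<in> {- (1 / 2)..1 / 2}"
  shows "(arc_height has_real_derivative arc_slope u) (at u within A)"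
proof -
  have "(arc_height u)\<^sup>2 > 0" using arc_height_bounds(1)[OF assms] by simp
  then have "1 - u\<^sup>2 > 0" using arc_height_bounds(3)[OF assms] by linarith
  then show ?thesis
    unfolding arc_height_def[abs_def] arc_slope_def
    by (auto intro!: derivative_eq_intros simp: field_simps)
qed

lemma continuous_on_arc_height: "continuous_on {- (1 / 2)..1 / 2} arc_height"
  unfolding arc_height_def[abs_def] by (intro continuous_intros)

lemma continuous_on_arc_slope: "continuous_on {- (1 / 2)..1 / 2} arc_slope"
proof -
  have "\<forall>u\<in>{- (1 / 2)..1 / 2}. arc_height u \<noteq> 0" using arc_height_bounds(1) by force
  then show ?thesis unfolding arc_slope_def[abs_def] by (intro continuous_intros continuous_on_arc_height)
qed

lemma integral_odd:
  fixes p :: "real \<Rightarrow> 'b::euclidean_space"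
  assumes "\<And>u. u \<in> {- a..a} \<Longrightarrow> p (- u) = - p u"
  shows "integral {- a..a} p = 0"
proof -
  have "integral {- a..a} p = integral {- a..a} (\<lambda>u. p (- u))"
    using Henstock_Kurzweil_Integration.integral_reflect_real[of a "- a" p] by simp
  also have "\<dots> = integral {- a..a} (\<lambda>u. - p u)"
    using assms by (intro Henstock_Kurzweil_Integration.integral_cong)
  also have "\<dots> = - integral {- a..a} p" by simp
  finally have "2 *\<^sub>R integral {- a..a} p = 0" by (simp add: scaleR_2 eq_neg_iff_add_eq_0)
  then show ?thesis by simp
qed

text \<open>Stokes' theorem for \<open>h d\<tau>\<close> on the truncated fundamental domain, by deforming the arc of the
  unit circle linearly into the horizontal top edge: the arc contributes nothing by the
  transformation under \<open>\<tau> \<mapsto> - 1 / \<tau>\<close>, and the vertical edges cancel by periodicity.\<close>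

lemma fund_dom_stokes:
  fixes h hu hv :: "complex \<Rightarrow> complex"
  assumes dh: "\<And>\<tau>. \<tau> \<in> \<H> \<Longrightarrow> (h has_derivative (\<lambda>z. Re z *\<^sub>R hu \<tau> + Im z *\<^sub>R hv \<tau>)) (at \<tau>)"
    and cu: "continuous_on \<H> hu" and cv: "continuous_on \<H> hv"
    and T: "\<And>\<tau>. \<tau> \<in> \<H> \<Longrightarrow> h (\<tau> + 1) = h \<tau>"
    and S: "\<And>\<tau>. \<tau> \<in> \<H> \<Longrightarrow> h (- 1 / \<tau>) = \<tau>\<^sup>2 * h \<tau>"
    and t: "1 \<le> t"
  shows "integral (fund_dom t) (\<lambda>\<tau>. hv \<tau> - \<i> * hu \<tau>) = integral {- (1 / 2)..1 / 2} (\<lambda>u. h (Complex u t))"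
proof -
  let ?I = "{- (1 / 2)..1 / 2} :: real set"
  \<comment> \<open>\<open>w\<close> runs from the arc (\<open>w = 0\<close>) to the top edge
    (\<open>w = 1\<close>); \<open>yu\<close> is the derivative of \<open>y\<close> in
    \<open>u\<close>, so \<open>1 + \<i> * yu w u\<close> is the velocity of the curve
    \<open>\<gamma> w\<close>.\<close>
  define y where "y w u = (1 - w) * arc_height u + w * t" for w u
  define yu where "yu w u = (1 - w) * arc_slope u" for w u
  define \<gamma> where "\<gamma> w u = Complex u (y w u)" for w u
  define X where "X \<tau> = hv \<tau> - \<i> * hu \<tau>" for \<tau>
  have ch: "continuous_on \<H> h"
    by (meson continuous_at_imp_continuous_on dh has_derivative_continuous)
  have cX: "continuous_on \<H> X" unfolding X_def by (intro continuous_intros cu cv)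
  have yb: "1 / 2 < y w u" "arc_height u \<le> y w u" "y w u \<le> t" if "w \<in> {0..1}" "u \<in> ?I" for w u
  proof -
    have a: "1 / 2 < arc_height u" "arc_height u \<le> t" using arc_height_bounds[OF that(2)] t by auto
    define d1 d2 where "d1 = w * (t - arc_height u)" and "d2 = (1 - w) * (t - arc_height u)"
    have "0 \<le> d1" "0 \<le> d2" using that a by (auto simp: d1_def d2_def)
    moreover have "y w u = arc_height u + d1" "y w u = t - d2"
      by (simp_all add: y_def d1_def d2_def algebra_simps)
    ultimately show "1 / 2 < y w u" "arc_height u \<le> y w u" "y w u \<le> t" using a by linarith+
  qed
  have \<gamma>H: "\<gamma> w u \<in> \<H>" if "w \<in> {0..1}" "u \<in> ?I" for w u
    using yb(1)[OF that] by (simp add: \<gamma>_def upper_half_plane_def)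
  have ca: "continuous_on ({0..1} \<times> ?I) (\<lambda>p. arc_height (snd p))"
    by (rule continuous_on_compose2[OF continuous_on_arc_height]) (auto intro: continuous_intros)
  have cs: "continuous_on ({0..1} \<times> ?I) (\<lambda>p. arc_slope (snd p))"
    by (rule continuous_on_compose2[OF continuous_on_arc_slope]) (auto intro: continuous_intros)
  have c\<gamma>: "continuous_on ({0..1} \<times> ?I) (\<lambda>p. \<gamma> (fst p) (snd p))"
    unfolding \<gamma>_def y_def by (intro continuous_intros ca)
  have comp: "continuous_on ({0..1} \<times> ?I) (\<lambda>p. F (\<gamma> (fst p) (snd p)))" if "continuous_on \<H> F" for F :: "complex \<Rightarrow> complex"
    by (rule continuous_on_compose2[OF that c\<gamma>]) (use \<gamma>H in auto)
  \<comment> \<open>The integral of \<open>h d\<tau>\<close> along the \<open>w\<close>-th curve;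
    \<open>K\<close> is the derivative of its integrand in \<open>w\<close>.\<close>
  define J where "J w = integral ?I (\<lambda>u. h (\<gamma> w u) * (1 + \<i> * of_real (yu w u)))" for w
  define K where "K w u = hv (\<gamma> w u) * of_real (t - arc_height u) * (1 + \<i> * of_real (yu w u)) - \<i> * h (\<gamma> w u) * of_real (arc_slope u)" for w u
  have cK: "continuous_on ({0..1} \<times> ?I) (\<lambda>(w, u). K w u)"
    unfolding K_def split_def yu_def by (intro continuous_intros comp[OF ch] comp[OF cv] ca cs)
  have cJ: "continuous_on ({0..1} \<times> ?I) (\<lambda>p. h (\<gamma> (fst p) (snd p)) * (1 + \<i> * of_real (yu (fst p) (snd p))))"
    unfolding yu_def by (intro continuous_intros comp[OF ch] cs)
  have slice: "continuous_on ?I (\<lambda>u. F w u)" if "continuous_on ({0..1} \<times> ?I) (\<lambda>p. F (fst p) (snd p))" "w \<in> {0..1}"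
    for F :: "real \<Rightarrow> real \<Rightarrow> complex" and w
  proof -
    have c: "continuous_on ?I (\<lambda>u. (w, u))" by (intro continuous_on_Pair continuous_on_const continuous_on_id)
    have "(\<lambda>u. (w, u)) ` ?I \<subseteq> {0..1} \<times> ?I" using that(2) by auto
    from continuous_on_compose2[OF that(1) c this] show ?thesis by simp
  qed
  have dw: "((\<lambda>w. h (\<gamma> w u) * (1 + \<i> * of_real (yu w u))) has_vector_derivative K w u) (at w within {0..1})"
    if "w \<in> {0..1}" "u \<in> ?I" for w u
  proof -
    have "((\<lambda>w. \<gamma> w u) has_vector_derivative \<i> * of_real (t - arc_height u)) (at w within {0..1})"
      unfolding \<gamma>_def y_def Complex_eq has_vector_derivative_def
      by (auto intro!: derivative_eq_intros simp: algebra_simps scaleR_conv_of_real)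
    then have "((\<lambda>w. \<gamma> w u) has_derivative (\<lambda>x. x *\<^sub>R (\<i> * of_real (t - arc_height u)))) (at w within {0..1})"
      by (simp add: has_vector_derivative_def)
    from has_derivative_compose[OF this dh[OF \<gamma>H[OF that]]]
    have "((\<lambda>w. h (\<gamma> w u)) has_vector_derivative hv (\<gamma> w u) * of_real (t - arc_height u)) (at w within {0..1})"
      by (simp add: has_vector_derivative_def scaleR_conv_of_real mult_ac)
    moreover have "((\<lambda>w. 1 + \<i> * of_real (yu w u)) has_vector_derivative - \<i> * of_real (arc_slope u)) (at w within {0..1})"
      unfolding yu_def has_vector_derivative_def
      by (auto intro!: derivative_eq_intros simp: algebra_simps scaleR_conv_of_real)
    ultimately have "((\<lambda>w. h (\<gamma> w u) * (1 + \<i> * of_real (yu w u))) has_vector_derivative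
        h (\<gamma> w u) * (- \<i> * of_real (arc_slope u)) + hv (\<gamma> w u) * of_real (t - arc_height u) * (1 + \<i> * of_real (yu w u))) (at w within {0..1})"
      by (rule has_vector_derivative_mult)
    then show ?thesis by (simp add: K_def mult_ac)
  qed
  have J': "(J has_vector_derivative integral ?I (K w)) (at w within {0..1})" if "w \<in> {0..1}" for w
    unfolding J_def[abs_def] cbox_interval[symmetric]
  proof (rule leibniz_rule_vector_derivative)
    show "(\<lambda>u. h (\<gamma> w u) * (1 + \<i> * of_real (yu w u))) integrable_on cbox (- (1 / 2)) (1 / 2)" if "w \<in> cbox 0 1" for w
      using slice[OF cJ] that by (intro integrable_continuous) simp
  qed (use that dw cK in simp_all)
  \<comment> \<open>\<open>K\<close> and the area integrand, with Jacobian
    \<open>t - arc_height u\<close>, differ by the \<open>u\<close>-derivative of \<open>e\<close>.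
    The boundary values of \<open>e\<close> are the contributions of the two vertical edges, which
    cancel by \<open>T\<close>.\<close>
  have IK: "integral ?I (K w) = integral ?I (\<lambda>u. X (\<gamma> w u) * of_real (t - arc_height u))" if w: "w \<in> {0..1}" for w
  proof -
    define e where "e u = \<i> * h (\<gamma> w u) * of_real (t - arc_height u)" for u
    define e' where "e' u = K w u - X (\<gamma> w u) * of_real (t - arc_height u)" for u
    have cX': "continuous_on ({0..1} \<times> ?I) (\<lambda>p. X (\<gamma> (fst p) (snd p)) * of_real (t - arc_height (snd p)))"
      by (intro continuous_intros comp[OF cX] ca)
    have "(e' has_integral (e (1 / 2) - e (- (1 / 2)))) ?I"
    proof (rule fundamental_theorem_of_calculus)
      fix u :: real assume u: "u \<in> ?I"
      have "((\<lambda>u. \<gamma> w u) has_vector_derivative (1 + \<i> * of_real (yu w u))) (at u within ?I)"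
        unfolding \<gamma>_def y_def yu_def Complex_eq has_vector_derivative_def
        using has_real_derivative_arc_height[OF u, THEN has_field_derivative_imp_has_derivative]
        by (auto intro!: derivative_eq_intros simp: algebra_simps scaleR_conv_of_real)
      then have "((\<lambda>u. \<gamma> w u) has_derivative (\<lambda>x. x *\<^sub>R (1 + \<i> * of_real (yu w u)))) (at u within ?I)"
        by (simp add: has_vector_derivative_def)
      from has_derivative_compose[OF this dh[OF \<gamma>H[OF w u]]]
      have "((\<lambda>u. h (\<gamma> w u)) has_vector_derivative hu (\<gamma> w u) + hv (\<gamma> w u) * of_real (yu w u)) (at u within ?I)"
        by (simp add: has_vector_derivative_def scaleR_conv_of_real algebra_simps)
      moreover have "((\<lambda>u. \<i> * of_real (t - arc_height u)) has_vector_derivative - \<i> * of_real (arc_slope u)) (at u within ?I)"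
        unfolding has_vector_derivative_def
        using has_real_derivative_arc_height[OF u, THEN has_field_derivative_imp_has_derivative]
        by (auto intro!: derivative_eq_intros simp: algebra_simps scaleR_conv_of_real)
      ultimately have "((\<lambda>u. h (\<gamma> w u) * (\<i> * of_real (t - arc_height u))) has_vector_derivative
          h (\<gamma> w u) * (- \<i> * of_real (arc_slope u)) + (hu (\<gamma> w u) + hv (\<gamma> w u) * of_real (yu w u)) * (\<i> * of_real (t - arc_height u))) (at u within ?I)"
        by (rule has_vector_derivative_mult)
      moreover have "h (\<gamma> w u) * (- \<i> * of_real (arc_slope u)) + (hu (\<gamma> w u) + hv (\<gamma> w u) * of_real (yu w u)) * (\<i> * of_real (t - arc_height u)) = e' u"
        unfolding e'_def K_def X_def by (simp add: algebra_simps)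
      ultimately show "(e has_vector_derivative e' u) (at u within ?I)"
        by (simp add: e_def[abs_def] mult_ac)
    qed simp
    moreover have "e (1 / 2) = e (- (1 / 2))"
    proof -
      have "arc_height (- (1 / 2)) = arc_height (1 / 2)" by (simp add: arc_height_def)
      moreover have "\<gamma> w (1 / 2) = \<gamma> w (- (1 / 2)) + 1"
        by (simp add: \<gamma>_def y_def arc_height_def complex_eq_iff)
      ultimately show ?thesis using T[OF \<gamma>H[OF w, of "- (1 / 2)"]] by (simp add: e_def)
    qed
    ultimately have "integral ?I e' = 0" by (simp add: integral_unique)
    moreover have "integral ?I e' = integral ?I (K w) - integral ?I (\<lambda>u. X (\<gamma> w u) * of_real (t - arc_height u))"
      unfolding e'_def using slice[OF cK[unfolded split_def] w] slice[OF cX' w]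
      by (intro Henstock_Kurzweil_Integration.integral_diff integrable_continuous_real)
    ultimately show ?thesis by simp
  qed
  have "((\<lambda>w. integral ?I (K w)) has_integral (J 1 - J 0)) {0..1}"
    by (intro fundamental_theorem_of_calculus J') auto
  then have "J 1 - J 0 = integral {0..1} (\<lambda>w. integral ?I (K w))" by (simp add: integral_unique)
  also have "\<dots> = integral {0..1} (\<lambda>w. integral ?I (\<lambda>u. X (\<gamma> w u) * of_real (t - arc_height u)))"
    by (intro Henstock_Kurzweil_Integration.integral_cong IK)
  also have "\<dots> = integral ?I (\<lambda>u. integral {0..1} (\<lambda>w. X (\<gamma> w u) * of_real (t - arc_height u)))"
  proof -
    have "continuous_on ({0..1} \<times> ?I) (\<lambda>(w, u). X (\<gamma> w u) * of_real (t - arc_height u))"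
      unfolding split_def by (intro continuous_intros comp[OF cX] ca)
    then have "continuous_on (cbox (0, - (1 / 2)) (1, 1 / 2)) (\<lambda>(w, u). X (\<gamma> w u) * of_real (t - arc_height u))"
      unfolding cbox_Pair_eq by (simp only: cbox_interval)
    from integral_swap_continuous[OF this] show ?thesis by (simp add: cbox_interval)
  qed
  also have "\<dots> = integral ?I (\<lambda>u. integral {arc_height u..t} (\<lambda>v. X (Complex u v)))"
  proof (rule Henstock_Kurzweil_Integration.integral_cong)
    fix u :: real assume u: "u \<in> ?I"
    have "((\<lambda>w. (t - arc_height u) *\<^sub>R X (Complex u (y w u))) has_integral
        integral {y 0 u..y 1 u} (\<lambda>v. X (Complex u v))) {0..1}"
    proof (rule has_integral_substitution[where c = "arc_height u" and d = t])
      show "continuous_on {arc_height u..t} (\<lambda>v. X (Complex u v))"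
        by (rule continuous_on_vertical[OF cX]) (use arc_height_bounds(1)[OF u] in auto)
      show "((\<lambda>w. y w u) has_real_derivative t - arc_height u) (at w within {0..1})" for w
        unfolding y_def by (auto intro!: derivative_eq_intros simp: algebra_simps)
      show "y 0 u \<le> y 1 u" using arc_height_bounds[OF u] t by (simp add: y_def)
    qed (use yb u in auto)
    then show "integral {0..1} (\<lambda>w. X (\<gamma> w u) * of_real (t - arc_height u)) = integral {arc_height u..t} (\<lambda>v. X (Complex u v))"
      by (intro integral_unique) (simp add: \<gamma>_def y_def scaleR_conv_of_real mult.commute)
  qed
  also have "\<dots> = integral (fund_dom t) X" by (rule fund_dom_iterated(1)[OF cX, symmetric])
  finally have main: "J 1 - J 0 = integral (fund_dom t) X" .
  \<comment> \<open>On the unit circle \<open>- 1 / z\<close> is \<open>- cnj z\<close>, so the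
    transformation law relates the integrands at \<open>u\<close> and \<open>- u\<close>; the factor
    \<open>z\<^sup>2\<close> and the two velocities combine to a sign.\<close>
  have "J 0 = 0"
    unfolding J_def
  proof (rule integral_odd)
    fix u :: real assume u: "u \<in> ?I"
    define s where "s = arc_height u"
    have s: "s > 0" "u\<^sup>2 + s\<^sup>2 = 1" using arc_height_bounds[OF u] by (auto simp: s_def)
    have s': "arc_height (- u) = s" by (simp add: s_def arc_height_def)
    define z where "z = Complex u s"
    have zz: "z * cnj z = 1"
      using s(2) by (simp add: z_def complex_eq_iff power2_eq_square)
    then have z0: "z \<noteq> 0" by auto
    have g: "\<gamma> 0 u = z" "\<gamma> 0 (- u) = - cnj z" by (simp_all add: \<gamma>_def y_def z_def s' s_def complex_eq_iff)
    have "- cnj z = - 1 / z" using zz z0 by (simp add: field_simps)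
    then have h: "h (\<gamma> 0 (- u)) = z\<^sup>2 * h z" using S[OF \<gamma>H[of 0 u]] u g by simp
    have a: "1 + \<i> * of_real (yu 0 u) = - \<i> * z / of_real s" "1 + \<i> * of_real (yu 0 (- u)) = \<i> * cnj z / of_real s"
      using s(1) by (simp_all add: yu_def arc_slope_def s' s_def[symmetric] z_def complex_eq_iff)
    have "h (\<gamma> 0 (- u)) * (1 + \<i> * of_real (yu 0 (- u))) = (z * cnj z) * (z * h z * \<i> / of_real s)"
      unfolding h a by (simp add: power2_eq_square)
    also have "\<dots> = - (h (\<gamma> 0 u) * (1 + \<i> * of_real (yu 0 u)))"
      unfolding zz a g by simp
    finally show "h (\<gamma> 0 (- u)) * (1 + \<i> * of_real (yu 0 (- u))) = - (h (\<gamma> 0 u) * (1 + \<i> * of_real (yu 0 u)))" .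
  qed
  moreover have "J 1 = integral ?I (\<lambda>u. h (Complex u t))" by (simp add: J_def \<gamma>_def y_def yu_def)
  ultimately show ?thesis using main by (simp add: X_def[abs_def])
qed

section \<open>Fourier expansion of harmonic Maass forms\<close>

lemma has_derivative_series_m_test:
  fixes f :: "nat \<Rightarrow> 'a::real_normed_vector \<Rightarrow> 'b::banach"
  assumes S: "convex S" "open S" "x \<in> S"
    and d: "\<And>n y. y \<in> S \<Longrightarrow> (f n has_derivative f' n y) (at y)"
    and bd: "\<And>n y h. y \<in> S \<Longrightarrow> norm (f' n y h) \<le> M n * norm h" and M: "summable M"
    and g: "\<And>y. y \<in> S \<Longrightarrow> (\<lambda>n. f n y) sums g y"
  shows "(g has_derivative (\<lambda>h. \<Sum>n. f' n x h)) (at x)" "summable (\<lambda>n. f' n x h)"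
proof -
  have sm: "summable (\<lambda>n. f' n y h)" if "y \<in> S" for y h
    by (rule summable_comparison_test'[of "\<lambda>n. M n * norm h"]) (use bd[OF that] M in \<open>auto intro: summable_mult2\<close>)
  then show "summable (\<lambda>n. f' n x h)" using S by blast
  have "\<exists>g. \<forall>y\<in>S. (\<lambda>n. f n y) sums (g y) \<and> (g has_derivative (\<lambda>h. \<Sum>n. f' n y h)) (at y within S)"
  proof (rule has_derivative_series[where f = f and f' = f' and g' = "\<lambda>y h. \<Sum>n. f' n y h", OF S(1) _ _ S(3) g[OF S(3)]])
    show "(f n has_derivative f' n y) (at y within S)" if "y \<in> S" for n y
      using d[OF that] by (rule has_derivative_at_withinI)
    fix e :: real assume e: "e > 0"
    have "(\<lambda>n. \<Sum>i. M (i + n)) \<longlonglongrightarrow> 0" by (rule suminf_exist_split2[OF M])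
    then have "\<forall>\<^sub>F n in sequentially. norm (\<Sum>i. M (i + n)) < e"
      using e by (auto simp: tendsto_iff dist_norm)
    then show "\<forall>\<^sub>F n in sequentially. \<forall>y\<in>S. \<forall>h. norm ((\<Sum>i<n. f' i y h) - (\<Sum>i. f' i y h)) \<le> e * norm h"
    proof eventually_elim
      case (elim n)
      show ?case
      proof (intro ballI allI)
        fix y h assume y: "y \<in> S"
        have "norm ((\<Sum>i<n. f' i y h) - (\<Sum>i. f' i y h)) = norm (\<Sum>i. f' (i + n) y h)"
          using suminf_split_initial_segment[OF sm[OF y], of h n] by (simp add: norm_minus_commute)
        also have "\<dots> \<le> (\<Sum>i. M (i + n) * norm h)"
          by (rule norm_suminf_le) (use bd[OF y] M in \<open>auto intro!: summable_mult2 summable_ignore_initial_segment\<close>)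
        also have "\<dots> = (\<Sum>i. M (i + n)) * norm h"
          using M by (intro suminf_mult2[symmetric] summable_ignore_initial_segment)
        also have "\<dots> \<le> e * norm h" using elim by (intro mult_right_mono) auto
        finally show "norm ((\<Sum>i<n. f' i y h) - (\<Sum>i. f' i y h)) \<le> e * norm h" .
      qed
    qed
  qed
  then obtain g2 where g2: "\<And>y. y \<in> S \<Longrightarrow> (\<lambda>n. f n y) sums (g2 y)"
    "(g2 has_derivative (\<lambda>h. \<Sum>n. f' n x h)) (at x within S)" using S(3) by blast
  have "(g2 has_derivative (\<lambda>h. \<Sum>n. f' n x h)) (at x)"
    using g2(2) unfolding at_within_open[OF S(3,2)] .
  then show "(g has_derivative (\<lambda>h. \<Sum>n. f' n x h)) (at x)"
    by (rule has_derivative_transform_within_open[OF _ S(2,3)]) (use g2(1) g in \<open>auto intro: sums_unique2\<close>)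
qed

text \<open>The radial factor of the \<open>n\<close>-th non-holomorphic Fourier term, normalized such that its
  derivative is given by one formula for all \<open>n\<close>.\<close>

definition radial :: "real \<Rightarrow> real \<Rightarrow> real \<Rightarrow> real" where
  "radial \<kappa> x v = (if x = 0 then (if \<kappa> = 1 then ln v else v powr (1 - \<kappa>) / (1 - \<kappa>))
     else - expint_tail \<kappa> (- 4 * pi * x) v)"

lemma has_real_derivative_radial:
  assumes v: "0 < v"
  shows "(radial \<kappa> x has_real_derivative v powr (- \<kappa>) * exp (4 * pi * x * v)) (at v)"
proof -
  consider "x \<noteq> 0" | "x = 0" "\<kappa> = 1" | "x = 0" "\<kappa> \<noteq> 1" by blast
  then show ?thesis
  proof cases
    case 1
    then have "((\<lambda>v. - expint_tail \<kappa> (- 4 * pi * x) v) has_real_derivative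
        - (- (v powr (- \<kappa>) * exp (- (- 4 * pi * x) * v)))) (at v)"
      by (intro DERIV_minus has_field_derivative_expint_tail v) simp
    with 1 show ?thesis by (simp add: radial_def[abs_def])
  next
    case 2
    then show ?thesis using v
      by (auto simp: radial_def[abs_def] powr_minus inverse_eq_divide intro!: derivative_eq_intros)
  next
    case 3
    have "((\<lambda>v. v powr (1 - \<kappa>) / (1 - \<kappa>)) has_real_derivative ((1 - \<kappa>) * v powr (1 - \<kappa> - 1)) / (1 - \<kappa>)) (at v)"
      by (intro DERIV_cdivide has_real_derivative_powr v)
    with 3 show ?thesis by (simp add: radial_def[abs_def])
  qed
qed

text \<open>The mean value theorem on \<open>{1..v}\<close>, with \<open>v - 1 \<le> exp v\<close>
  and \<open>ln z \<le> v\<close>, which accounts for the three summands in the exponent. This crude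
  bound serves the finitely many terms without decay.\<close>

lemma radial_growth:
  assumes v: "1 \<le> v"
  shows "\<bar>radial \<kappa> x v\<bar> \<le> \<bar>radial \<kappa> x 1\<bar> + exp ((1 + \<bar>\<kappa>\<bar> + 4 * pi * \<bar>x\<bar>) * v)"
proof (cases "v = 1")
  case False
  with v have v1: "1 < v" by simp
  obtain z where z: "1 < z" "z < v" "radial \<kappa> x v - radial \<kappa> x 1 = (v - 1) * (z powr (- \<kappa>) * exp (4 * pi * x * z))"
    using MVT2[OF v1, of "radial \<kappa> x" "\<lambda>z. z powr (- \<kappa>) * exp (4 * pi * x * z)"] has_real_derivative_radial by force
  have "z powr (- \<kappa>) \<le> exp (\<bar>\<kappa>\<bar> * v)"
  proof -
    have l: "0 \<le> ln z" "ln z \<le> v" using z ln_bound[of z] by auto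
    have "- \<kappa> * ln z \<le> \<bar>\<kappa>\<bar> * ln z" using l by (intro mult_right_mono) auto
    also have "\<dots> \<le> \<bar>\<kappa>\<bar> * v" using l by (intro mult_left_mono) auto
    finally show ?thesis using z by (simp add: powr_def)
  qed
  moreover have "4 * pi * x * z \<le> 4 * pi * \<bar>x\<bar> * v"
  proof -
    have "x * z \<le> \<bar>x\<bar> * z" using z by (intro mult_right_mono) auto
    also have "\<dots> \<le> \<bar>x\<bar> * v" using z by (intro mult_left_mono) auto
    finally have "4 * pi * (x * z) \<le> 4 * pi * (\<bar>x\<bar> * v)" by (intro mult_left_mono) auto
    then show ?thesis by (simp add: mult.assoc)
  qed
  then have "exp (4 * pi * x * z) \<le> exp (4 * pi * \<bar>x\<bar> * v)" by simp
  moreover have "v - 1 \<le> exp v" using exp_ge_add_one_self[of v] by linarith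
  ultimately have "(v - 1) * (z powr (- \<kappa>) * exp (4 * pi * x * z)) \<le> exp v * (exp (\<bar>\<kappa>\<bar> * v) * exp (4 * pi * \<bar>x\<bar> * v))"
    using v1 by (intro mult_mono) auto
  also have "\<dots> = exp ((1 + \<bar>\<kappa>\<bar> + 4 * pi * \<bar>x\<bar>) * v)" by (simp add: mult_exp_exp algebra_simps)
  finally have "(v - 1) * (z powr (- \<kappa>) * exp (4 * pi * x * z)) \<le> exp ((1 + \<bar>\<kappa>\<bar> + 4 * pi * \<bar>x\<bar>) * v)" .
  moreover have "0 \<le> (v - 1) * (z powr (- \<kappa>) * exp (4 * pi * x * z))" using v1 by simp
  ultimately show ?thesis using z(3) by linarith
qed simp

lemma has_derivative_qpow: "(qpow n has_derivative (\<lambda>h. 2 * of_real pi * \<i> * of_rat n * qpow n \<tau> * h)) (at \<tau>)"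
proof -
  have "(qpow n has_field_derivative 2 * of_real pi * \<i> * of_rat n * qpow n \<tau>) (at \<tau>)"
    unfolding qpow_def[abs_def] by (auto intro!: derivative_eq_intros)
  then show ?thesis by (simp add: has_field_derivative_def)
qed

lemma norm_qpow: "norm (qpow n \<tau>) = exp (- 2 * pi * of_rat n * Im \<tau>)"
  unfolding qpow_eq by (simp only: norm_mult norm_of_real norm_cis mult_1_right abs_exp_cancel)

lemma cnj_qpow: "cnj (qpow n \<tau>) = of_real (exp (- 4 * pi * of_rat n * Im \<tau>)) * qpow (- n) \<tau>"
proof -
  have "cnj (e2pi n (Re \<tau>)) = e2pi (- n) (Re \<tau>)" by (simp add: cis_cnj of_rat_minus)
  moreover have "exp (- 2 * pi * real_of_rat n * Im \<tau>) = exp (- 4 * pi * of_rat n * Im \<tau>) * exp (- 2 * pi * of_rat (- n) * Im \<tau>)"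
    by (simp add: mult_exp_exp of_rat_minus)
  ultimately show ?thesis unfolding qpow_eq by (simp only: complex_cnj_mult complex_cnj_complex_of_real of_real_mult mult.assoc)
qed

definition nonhol_term :: "real \<Rightarrow> rat \<Rightarrow> complex \<Rightarrow> complex" where
  "nonhol_term \<kappa> n \<tau> = of_real (radial \<kappa> (of_rat n) (Im \<tau>)) * qpow n \<tau>"

definition nonhol_term_deriv :: "real \<Rightarrow> rat \<Rightarrow> complex \<Rightarrow> complex \<Rightarrow> complex" where
  "nonhol_term_deriv \<kappa> n \<tau> h = 2 * of_real pi * \<i> * of_rat n * nonhol_term \<kappa> n \<tau> * h +
     of_real (Im h * (Im \<tau> powr (- \<kappa>) * exp (4 * pi * of_rat n * Im \<tau>))) * qpow n \<tau>"

lemma has_derivative_nonhol_term: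
  assumes "\<tau> \<in> \<H>"
  shows "(nonhol_term \<kappa> n has_derivative nonhol_term_deriv \<kappa> n \<tau>) (at \<tau>)"
proof -
  let ?d = "Im \<tau> powr (- \<kappa>) * exp (4 * pi * of_rat n * Im \<tau>)"
  have "(radial \<kappa> (of_rat n) has_derivative (\<lambda>x. ?d * x)) (at (Im \<tau>))"
    using has_real_derivative_radial[of "Im \<tau>" \<kappa> "of_rat n"] assms
    by (simp add: has_field_derivative_def upper_half_plane_def)
  from has_derivative_compose[OF bounded_linear_imp_has_derivative[OF bounded_linear_Im] this]
  have "((\<lambda>\<tau>. complex_of_real (radial \<kappa> (of_rat n) (Im \<tau>))) has_derivative (\<lambda>h. of_real (?d * Im h))) (at \<tau>)"
    by (rule has_derivative_of_real)
  from has_derivative_mult[OF this has_derivative_qpow[of n]]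
  show ?thesis
    unfolding nonhol_term_def[abs_def]
    by (rule has_derivative_eq_rhs) (auto simp: nonhol_term_deriv_def nonhol_term_def algebra_simps)
qed

text \<open>The derivative of the holomorphic factor is complex linear and drops out. What remains
  comes from the radial factor, and \<open>exp (4 * pi * n * v)\<close> turns \<open>qpow n\<close>
  into the conjugate of \<open>qpow (- n)\<close>; thus the \<open>n\<close>-th term answers to the
  coefficient of \<open>g\<close> at \<open>- n\<close>.\<close>

lemma nonhol_term_dbar:
  "(1 / 2) * (nonhol_term_deriv \<kappa> n \<tau> 1 + \<i> * nonhol_term_deriv \<kappa> n \<tau> \<i>) =
     (\<i> / 2 * of_real (Im \<tau> powr (- \<kappa>))) * cnj (qpow (- n) \<tau>)"
proof -
  define X where "X = 2 * of_real pi * \<i> * of_rat n * nonhol_term \<kappa> n \<tau>"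
  define p where "p = Im \<tau> powr (- \<kappa>)"
  define e where "e = exp (4 * pi * of_rat n * Im \<tau>)"
  have 1: "nonhol_term_deriv \<kappa> n \<tau> 1 = X" by (simp add: nonhol_term_deriv_def X_def)
  have 2: "nonhol_term_deriv \<kappa> n \<tau> \<i> = X * \<i> + of_real (p * e) * qpow n \<tau>"
    by (simp add: nonhol_term_deriv_def X_def p_def e_def)
  have 3: "cnj (qpow (- n) \<tau>) = of_real e * qpow n \<tau>"
    unfolding cnj_qpow e_def by (simp add: of_rat_minus)
  have 4: "\<i> * (X * \<i>) = - X" by (simp add: mult.left_commute[of \<i> X])
  show ?thesis unfolding 1 2 3 ring_distribs(1)[of \<i>] 4 p_def[symmetric] by simp
qed

lemma expint_tail_antimono:
  assumes c: "0 < c" and v: "0 < v" "v \<le> w"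
  shows "expint_tail \<kappa> c w \<le> expint_tail \<kappa> c v"
proof (rule DERIV_nonpos_imp_nonincreasing[OF v(2)])
  fix x assume "v \<le> x" "x \<le> w"
  then show "\<exists>y. (expint_tail \<kappa> c has_real_derivative y) (at x) \<and> y \<le> 0"
    using has_field_derivative_expint_tail[of c x \<kappa>] c v by force
qed

text \<open>The last factor is the norm of \<open>qpow (- n) \<tau>\<close>, so up to a factor
  independent of \<open>n\<close> the term is no larger than the corresponding exponential in the
  expansion of \<open>g\<close>. That factor comes from comparing the tail at
  \<open>- 4 * pi * n\<close> with the one at \<open>A\<close>.\<close>

lemma norm_nonhol_term_neg:
  assumes A: "0 < A" and n: "A \<le> - 4 * pi * of_rat n" and v: "0 < v" "v \<le> Im \<tau>"
  shows "norm (nonhol_term \<kappa> n \<tau>) \<le> expint_tail \<kappa> A v * exp (A * Im \<tau>) * exp (2 * pi * of_rat n * Im \<tau>)"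
proof -
  define m where "m = - 4 * pi * real_of_rat n"
  have m: "m \<ge> A" "m > 0" using n A by (auto simp: m_def)
  have "expint_tail \<kappa> m (Im \<tau>) \<le> exp (- (m - A) * Im \<tau>) * expint_tail \<kappa> A (Im \<tau>)"
    using expint_tail_decay[of A "Im \<tau>" "m - A" \<kappa>] A m v by simp
  also have "\<dots> \<le> exp (- (m - A) * Im \<tau>) * expint_tail \<kappa> A v"
    using A v by (intro mult_left_mono expint_tail_antimono) auto
  finally have t: "expint_tail \<kappa> m (Im \<tau>) \<le> exp (- (m - A) * Im \<tau>) * expint_tail \<kappa> A v" .
  have "norm (nonhol_term \<kappa> n \<tau>) = expint_tail \<kappa> m (Im \<tau>) * exp (- 2 * pi * of_rat n * Im \<tau>)"
    using m v A expint_tail_nonneg[of m "Im \<tau>" \<kappa>]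
    by (auto simp: nonhol_term_def norm_mult norm_qpow radial_def m_def[symmetric]) (auto simp: m_def)
  also have "\<dots> \<le> (exp (- (m - A) * Im \<tau>) * expint_tail \<kappa> A v) * exp (- 2 * pi * of_rat n * Im \<tau>)"
    by (intro mult_right_mono t) auto
  also have "\<dots> = expint_tail \<kappa> A v * (exp (- (m - A) * Im \<tau>) * exp (- 2 * pi * of_rat n * Im \<tau>))"
    by simp
  also have "exp (- (m - A) * Im \<tau>) * exp (- 2 * pi * of_rat n * Im \<tau>) = exp (A * Im \<tau>) * exp (2 * pi * of_rat n * Im \<tau>)"
    by (simp add: mult_exp_exp m_def algebra_simps)
  finally show ?thesis by (simp add: mult.assoc)
qed

text \<open>The factor \<open>n\<close> produced by differentiation is paid for with half of the
  decay, through \<open>x * exp (- x) \<le> 1\<close> for \<open>x = pi * \<bar>n\<bar> * v\<close>;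
  this leaves \<open>exp (pi * n * v)\<close>. The two powers in the sum cover both signs of
  \<open>\<kappa>\<close>.\<close>

lemma norm_nonhol_term_deriv_neg:
  assumes A: "0 < A" and n: "A \<le> - 4 * pi * of_rat n" and v: "0 < v" "v \<le> Im \<tau>" "Im \<tau> \<le> w"
  shows "norm (nonhol_term_deriv \<kappa> n \<tau> h) \<le>
    (2 * expint_tail \<kappa> A v * exp (A * w) / v + (v powr (- \<kappa>) + w powr (- \<kappa>))) * exp (pi * of_rat n * v) * norm h"
proof -
  let ?n = "real_of_rat n"
  have "0 < - 4 * pi * ?n" using A n by linarith
  then have n0: "?n < 0" by (simp add: mult_less_0_iff)
  have nv: "?n * Im \<tau> \<le> ?n * v" using n0 v by (intro mult_left_mono_neg) auto
  have "norm (2 * of_real pi * \<i> * of_rat n * nonhol_term \<kappa> n \<tau> * h) = 2 * pi * \<bar>?n\<bar> * norm (nonhol_term \<kappa> n \<tau>) * norm h"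
    by (simp add: norm_mult flip: of_real_of_rat)
  also have "\<dots> \<le> (2 * expint_tail \<kappa> A v * exp (A * w) / v) * exp (pi * ?n * v) * norm h"
  proof (rule mult_right_mono)
    have "norm (nonhol_term \<kappa> n \<tau>) \<le> expint_tail \<kappa> A v * exp (A * Im \<tau>) * exp (2 * pi * ?n * Im \<tau>)"
      by (rule norm_nonhol_term_neg) (use assms in auto)
    also have "\<dots> \<le> expint_tail \<kappa> A v * exp (A * w) * exp (2 * pi * (?n * v))"
      using v A nv expint_tail_nonneg[OF A v(1)] by (intro mult_mono) auto
    finally have "2 * pi * \<bar>?n\<bar> * norm (nonhol_term \<kappa> n \<tau>) \<le> 2 * pi * \<bar>?n\<bar> * (expint_tail \<kappa> A v * exp (A * w) * exp (2 * pi * (?n * v)))"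
      by (intro mult_left_mono) auto
    also have "\<dots> = 2 * expint_tail \<kappa> A v * exp (A * w) * exp (pi * ?n * v) * (pi * \<bar>?n\<bar> * exp (pi * ?n * v))"
    proof -
      have "exp (2 * pi * (?n * v)) = exp (pi * ?n * v) * exp (pi * ?n * v)" by (simp add: mult_exp_exp)
      then show ?thesis by (simp only:) (simp add: mult_ac)
    qed
    also have "\<dots> \<le> 2 * expint_tail \<kappa> A v * exp (A * w) * exp (pi * ?n * v) * (1 / v)"
    proof (rule mult_left_mono)
      define x where "x = - (pi * ?n * v)"
      have "x \<le> exp x" using exp_ge_add_one_self[of x] by linarith
      then have "x * exp (- x) \<le> 1" by (simp add: exp_minus field_simps)
      moreover have "pi * \<bar>?n\<bar> * exp (pi * ?n * v) = x * exp (- x) / v"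
        unfolding abs_of_neg[OF n0] x_def using v by (simp add: field_simps)
      ultimately show "pi * \<bar>?n\<bar> * exp (pi * ?n * v) \<le> 1 / v" using v by (simp only: divide_right_mono)
    qed (use expint_tail_nonneg[OF A v(1)] in auto)
    finally show "2 * pi * \<bar>?n\<bar> * norm (nonhol_term \<kappa> n \<tau>) \<le> (2 * expint_tail \<kappa> A v * exp (A * w) / v) * exp (pi * ?n * v)"
      by (simp add: mult_ac)
  qed simp
  finally have 1: "norm (2 * of_real pi * \<i> * of_rat n * nonhol_term \<kappa> n \<tau> * h) \<le> (2 * expint_tail \<kappa> A v * exp (A * w) / v) * exp (pi * ?n * v) * norm h" .
  have p: "Im \<tau> powr (- \<kappa>) \<le> v powr (- \<kappa>) + w powr (- \<kappa>)"
  proof (cases "0 \<le> - \<kappa>")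
    case True
    then have "Im \<tau> powr (- \<kappa>) \<le> w powr (- \<kappa>)" using v by (intro powr_mono2) auto
    then show ?thesis using powr_ge_zero[of v "- \<kappa>"] by linarith
  next
    case False
    then have "Im \<tau> powr (- \<kappa>) \<le> v powr (- \<kappa>)" using v by (intro powr_mono2') auto
    then show ?thesis using powr_ge_zero[of w "- \<kappa>"] by linarith
  qed
  have "norm (of_real (Im h * (Im \<tau> powr (- \<kappa>) * exp (4 * pi * ?n * Im \<tau>))) * qpow n \<tau>) =
      \<bar>Im h\<bar> * (Im \<tau> powr (- \<kappa>) * (exp (4 * pi * ?n * Im \<tau>) * exp (- 2 * pi * ?n * Im \<tau>)))"
    unfolding norm_mult norm_of_real norm_qpow abs_mult by (simp only: abs_exp_cancel abs_of_nonneg[OF powr_ge_zero] mult.assoc)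
  also have "exp (4 * pi * ?n * Im \<tau>) * exp (- 2 * pi * ?n * Im \<tau>) = exp (2 * pi * (?n * Im \<tau>))" by (simp add: mult_exp_exp)
  also have "\<bar>Im h\<bar> * (Im \<tau> powr (- \<kappa>) * exp (2 * pi * (?n * Im \<tau>))) \<le> norm h * ((v powr (- \<kappa>) + w powr (- \<kappa>)) * exp (pi * ?n * v))"
  proof (intro mult_mono abs_Im_le_cmod p)
    have "2 * (?n * Im \<tau>) \<le> ?n * v" using nv n0 v mult_neg_pos[of ?n v] by linarith
    from mult_left_mono[OF this, of pi]
    show "exp (2 * pi * (?n * Im \<tau>)) \<le> exp (pi * ?n * v)" by (simp add: mult_ac)
  qed auto
  finally have 2: "norm (of_real (Im h * (Im \<tau> powr (- \<kappa>) * exp (4 * pi * ?n * Im \<tau>))) * qpow n \<tau>) \<le> (v powr (- \<kappa>) + w powr (- \<kappa>)) * exp (pi * ?n * v) * norm h"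
    by (simp add: mult_ac)
  show ?thesis
    unfolding nonhol_term_deriv_def using norm_triangle_mono[OF 1 2] by (simp add: ring_distribs)
qed

section \<open>Functions of exponential growth\<close>

lemma exp_growthI:
  fixes f :: "complex \<Rightarrow> 'v::real_normed_vector"
  assumes "\<And>\<tau>. v\<^sub>0 \<le> Im \<tau> \<Longrightarrow> norm (f \<tau>) \<le> A * exp (C * Im \<tau>)"
  shows "exp_growth f"
  unfolding exp_growth_def using assms by blast

lemma exp_growth_add:
  fixes f g :: "complex \<Rightarrow> 'v::real_normed_vector"
  assumes "exp_growth f" "exp_growth g"
  shows "exp_growth (\<lambda>\<tau>. f \<tau> + g \<tau>)"
proof -
  from assms obtain C A v C' A' v' where
    1: "\<And>\<tau>. \<tau> \<in> \<H> \<Longrightarrow> v \<le> Im \<tau> \<Longrightarrow> norm (f \<tau>) \<le> A * exp (C * Im \<tau>)" and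
    2: "\<And>\<tau>. \<tau> \<in> \<H> \<Longrightarrow> v' \<le> Im \<tau> \<Longrightarrow> norm (g \<tau>) \<le> A' * exp (C' * Im \<tau>)"
    unfolding exp_growth_def by metis
  have "norm (f \<tau> + g \<tau>) \<le> (\<bar>A\<bar> + \<bar>A'\<bar>) * exp (max C C' * Im \<tau>)" if t: "\<tau> \<in> \<H>" "max v v' \<le> Im \<tau>" for \<tau>
  proof -
    have p: "0 < Im \<tau>" using t by (simp add: upper_half_plane_def)
    have e: "exp (C * Im \<tau>) \<le> exp (max C C' * Im \<tau>)" "exp (C' * Im \<tau>) \<le> exp (max C C' * Im \<tau>)"
      using p by (simp_all add: mult_right_mono)
    have "norm (f \<tau>) \<le> \<bar>A\<bar> * exp (max C C' * Im \<tau>)"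
      by (rule order_trans[OF 1]) (use t in \<open>auto intro!: mult_mono e\<close>)
    moreover have "norm (g \<tau>) \<le> \<bar>A'\<bar> * exp (max C C' * Im \<tau>)"
      by (rule order_trans[OF 2]) (use t in \<open>auto intro!: mult_mono e\<close>)
    ultimately show ?thesis using norm_triangle_ineq[of "f \<tau>" "g \<tau>"] by (simp add: distrib_right)
  qed
  then show ?thesis unfolding exp_growth_def by blast
qed

lemma exp_growth_minus:
  fixes f :: "complex \<Rightarrow> 'v::real_normed_vector"
  shows "exp_growth f \<Longrightarrow> exp_growth (\<lambda>\<tau>. - f \<tau>)"
  by (simp add: exp_growth_def)

lemma exp_growth_sum:
  fixes f :: "'i \<Rightarrow> complex \<Rightarrow> 'v::real_normed_vector"
  assumes "finite F" "\<And>n. n \<in> F \<Longrightarrow> exp_growth (f n)"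
  shows "exp_growth (\<lambda>\<tau>. \<Sum>n\<in>F. f n \<tau>)"
  using assms
proof (induction F rule: finite_induct)
  case empty
  show ?case by (rule exp_growthI[of 0 _ 0 0]) simp
qed (auto intro: exp_growth_add)

section \<open>Construction of the non-holomorphic part\<close>

context complex_space
begin

text \<open>The derivative in the conjugate variable, read off from a real-linear total derivative;
  it vanishes on complex-linear maps and commutes with convergent series of derivatives.\<close>

definition dbar_op :: "(complex \<Rightarrow> 'v) \<Rightarrow> 'v" where
  "dbar_op L = (1 / 2) *\<^sub>R (L 1 + sc \<i> (L \<i>))"

lemma dbar_op_sc: "dbar_op (\<lambda>h. sc (L h) x) = sc (1 / 2 * (L 1 + \<i> * L \<i>)) x"
  by (simp add: dbar_op_def scale_left_distrib[symmetric] scaleR_sc)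

lemma dbar_op_add: "dbar_op (\<lambda>h. L h + L' h) = dbar_op L + dbar_op L'"
  by (simp add: dbar_op_def scale_right_distrib scaleR_add_right)

lemma dbar_op_diff: "dbar_op (\<lambda>h. L h - L' h) = dbar_op L - dbar_op L'"
  by (simp add: dbar_op_def scale_right_diff_distrib scaleR_diff_right scaleR_add_right)

lemma dbar_op_sum: "finite F \<Longrightarrow> dbar_op (\<lambda>h. \<Sum>n\<in>F. L n h) = (\<Sum>n\<in>F. dbar_op (L n))"
proof (induction F rule: finite_induct)
  case empty
  show ?case by (simp add: dbar_op_def)
next
  case (insert x F)
  then show ?case by (simp add: dbar_op_add)
qed

lemma dbar_op_suminf:
  assumes "\<And>h. summable (\<lambda>n. L n h)"
  shows "(\<lambda>n. dbar_op (L n)) sums dbar_op (\<lambda>h. \<Sum>n. L n h)"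
proof -
  have s: "(\<lambda>n. L n h) sums (\<Sum>n. L n h)" for h using assms by (rule summable_sums)
  show ?thesis unfolding dbar_op_def
    by (intro bounded_linear.sums[OF bounded_linear_scaleR_right] sums_add s bounded_linear.sums[OF bsc.bounded_linear_right])
qed

text \<open>A function with the conjugate-variable derivative prescribed by \<open>g\<close>, built
  term by term. The frequencies \<open>n < 0\<close> form an infinite series to which the tail
  estimates apply; the frequencies \<open>n \<ge> 0\<close> come from the finitely many indices
  \<open>- n \<le> 0\<close> at which \<open>c\<close> does not vanish.\<close>

lemma nonhol_series:
  fixes c :: "rat \<Rightarrow> 'v" and g :: "complex \<Rightarrow> 'v"
  assumes N: "0 < N" and supp: "\<And>n. c n \<noteq> 0 \<Longrightarrow> n * of_nat N \<in> \<int>" and fin: "finite {n. n < 0 \<and> c n \<noteq> 0}"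
    and g: "\<And>\<tau>. \<tau> \<in> \<H> \<Longrightarrow> ((\<lambda>n. sc (cnj (qpow n \<tau>)) (c n)) has_sum g \<tau>) UNIV"
  obtains Gm where
    "\<And>\<tau>. \<tau> \<in> \<H> \<Longrightarrow> ((\<lambda>n. sc (nonhol_term \<kappa> n \<tau>) (c (- n))) has_sum Gm \<tau>) UNIV"
    "\<And>\<tau>. \<tau> \<in> \<H> \<Longrightarrow> \<exists>D. (Gm has_derivative D) (at \<tau>) \<and> dbar_op D = sc (\<i> / 2 * of_real (Im \<tau> powr (- \<kappa>))) (g \<tau>)"
    "exp_growth Gm"
proof -
  from bsc.bounded obtain K0 where K0: "\<And>z x. norm (sc z x) \<le> norm z * norm x * K0" by blast
  define K where "K = \<bar>K0\<bar>"
  have K: "norm (sc z x) \<le> norm z * (norm x * K)" "K \<ge> 0" for z x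
  proof -
    show "norm (sc z x) \<le> norm z * (norm x * K)"
      by (rule order_trans[OF K0]) (auto simp: K_def mult.assoc intro!: mult_left_mono)
  qed (simp add: K_def)
  define F where "F = {n. 0 \<le> n \<and> c (- n) \<noteq> 0}"
  have fF: "finite F"
  proof -
    have "F \<subseteq> insert 0 (uminus ` {n. n < 0 \<and> c n \<noteq> 0})"
    proof
      fix n assume "n \<in> F"
      then show "n \<in> insert 0 (uminus ` {n. n < 0 \<and> c n \<noteq> 0})"
        by (cases "n = 0") (auto simp: F_def intro!: image_eqI[of n uminus "- n"])
    qed
    then show ?thesis by (rule finite_subset) (use fin in auto)
  qed
  \<comment> \<open>Enumerates the negative elements of \<open>(1/N) Z\<close>; \<open>Suc j\<close>
    excludes the frequency \<open>0\<close>.\<close>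
  define \<iota> where "\<iota> j = - (of_nat (Suc j) / of_nat N :: rat)" for j
  have inj: "inj \<iota>" using N by (auto simp: inj_def \<iota>_def)
  have \<iota>neg: "\<iota> j < 0" for j using N by (simp add: \<iota>_def)
  have disj: "F \<inter> range \<iota> = {}" using \<iota>neg by (auto simp: F_def not_le[symmetric])
  have cover: "n \<in> F \<union> range \<iota>" if "c (- n) \<noteq> 0" for n
  proof (cases "0 \<le> n")
    case False
    have "- n * of_nat N \<in> \<int>" by (rule supp[OF that])
    then obtain i where i: "- n * of_nat N = of_int i" by (rule Ints_cases)
    have "0 < - n * of_nat N" using False N by (simp add: mult_neg_pos)
    then have "0 < i" using i by simp
    then obtain j where "i = int (Suc j)" using zero_less_imp_eq_int gr0_implies_Suc by blast
    then have "n = \<iota> j" using i N by (simp add: \<iota>_def field_simps)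
    then show ?thesis by simp
  qed (use that in \<open>simp add: F_def\<close>)
  \<comment> \<open>The least value of \<open>- 4 * pi * n\<close> over these frequencies, so that
    one tail dominates all of them.\<close>
  define A where "A = 4 * pi / real N"
  have A: "A > 0" using N by (simp add: A_def)
  have An: "A \<le> - 4 * pi * of_rat (\<iota> j)" for j
    using N by (simp add: A_def \<iota>_def of_rat_minus of_rat_divide of_rat_add field_simps)
  \<comment> \<open>The series of \<open>g\<close> converges absolutely at the point
    \<open>\<i> * w\<close>. Every \<open>w > 0\<close> is available, which later permits evaluation
    at a reduced height.\<close>
  have S: "summable (\<lambda>j. norm (c (- \<iota> j)) * exp (2 * pi * of_rat (\<iota> j) * w))" if "w > 0" for w
  proof -
    have "\<i> * of_real w \<in> \<H>" using that by (simp add: upper_half_plane_def)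
    from g[OF this] have "(\<lambda>n. norm (sc (cnj (qpow n (\<i> * of_real w))) (c n))) summable_on UNIV"
      by (intro summable_on_imp_abs_summable_on) (auto simp: summable_on_def)
    moreover have "norm (sc (cnj (qpow n (\<i> * of_real w))) (c n)) = norm (c n) * exp (- 2 * pi * of_rat n * w)" for n
    proof -
      have "cnj (qpow n (\<i> * of_real w)) = of_real (exp (- 2 * pi * of_rat n * w))"
        unfolding qpow_eq by simp
      then show ?thesis by (simp only: sc_of_real norm_scaleR abs_exp_cancel mult.commute)
    qed
    ultimately have "(\<lambda>n. norm (c n) * exp (- 2 * pi * of_rat n * w)) summable_on UNIV" by simp
    then have "(\<lambda>n. norm (c n) * exp (- 2 * pi * of_rat n * w)) summable_on (range (\<lambda>j. - \<iota> j))"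
      by (rule summable_on_subset_banach) simp
    moreover have "inj (\<lambda>j. - \<iota> j)" using inj by (auto simp: inj_def)
    ultimately have "((\<lambda>n. norm (c n) * exp (- 2 * pi * of_rat n * w)) \<circ> (\<lambda>j. - \<iota> j)) summable_on UNIV"
      by (simp add: summable_on_reindex)
    then have "(\<lambda>j. norm (c (- \<iota> j)) * exp (2 * pi * of_rat (\<iota> j) * w)) summable_on UNIV"
      by (simp add: o_def of_rat_minus)
    then show ?thesis by (rule summable_on_imp_summable)
  qed
  define t where "t j \<tau> = sc (nonhol_term \<kappa> (\<iota> j) \<tau>) (c (- \<iota> j))" for j \<tau>
  have tb: "norm (t j \<tau>) \<le> expint_tail \<kappa> A v * exp (A * Im \<tau>) * K * (norm (c (- \<iota> j)) * exp (2 * pi * of_rat (\<iota> j) * v))"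
    if "0 < v" "v \<le> Im \<tau>" for j \<tau> v
  proof -
    have "norm (nonhol_term \<kappa> (\<iota> j) \<tau>) \<le> expint_tail \<kappa> A v * exp (A * Im \<tau>) * exp (2 * pi * of_rat (\<iota> j) * Im \<tau>)"
      by (rule norm_nonhol_term_neg[OF A An that])
    also have "\<dots> \<le> expint_tail \<kappa> A v * exp (A * Im \<tau>) * exp (2 * pi * of_rat (\<iota> j) * v)"
    proof -
      have "2 * pi * of_rat (\<iota> j) * Im \<tau> \<le> 2 * pi * of_rat (\<iota> j) * v"
        using that \<iota>neg[of j] by (intro mult_left_mono_neg) (auto simp: mult_nonneg_nonpos)
      then show ?thesis using expint_tail_nonneg[OF A that(1)] by (intro mult_left_mono) auto
    qed
    finally have "norm (nonhol_term \<kappa> (\<iota> j) \<tau>) * (norm (c (- \<iota> j)) * K) \<le>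
        expint_tail \<kappa> A v * exp (A * Im \<tau>) * exp (2 * pi * of_rat (\<iota> j) * v) * (norm (c (- \<iota> j)) * K)"
      using K(2) by (intro mult_right_mono) auto
    with K(1)[of "nonhol_term \<kappa> (\<iota> j) \<tau>" "c (- \<iota> j)"] show ?thesis unfolding t_def by (simp add: mult_ac)
  qed
  have ts: "summable (\<lambda>j. norm (t j \<tau>))" if "\<tau> \<in> \<H>" for \<tau>
  proof (rule summable_comparison_test')
    have p: "Im \<tau> > 0" using that by (simp add: upper_half_plane_def)
    show "summable (\<lambda>j. expint_tail \<kappa> A (Im \<tau>) * exp (A * Im \<tau>) * K * (norm (c (- \<iota> j)) * exp (2 * pi * of_rat (\<iota> j) * Im \<tau>)))"
      by (intro summable_mult S p)
    show "norm (norm (t j \<tau>)) \<le> expint_tail \<kappa> A (Im \<tau>) * exp (A * Im \<tau>) * K * (norm (c (- \<iota> j)) * exp (2 * pi * of_rat (\<iota> j) * Im \<tau>))" for j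
      using tb[OF p order_refl, of j] by simp
  qed
  define Gf where "Gf \<tau> = (\<Sum>n\<in>F. sc (nonhol_term \<kappa> n \<tau>) (c (- n)))" for \<tau>
  define Gc where "Gc \<tau> = (\<Sum>j. t j \<tau>)" for \<tau>
  have split: "(x has_sum (\<Sum>n\<in>F. x n) + s) UNIV"
    if "\<And>n. n \<notin> F \<union> range \<iota> \<Longrightarrow> x n = 0" "((x \<circ> \<iota>) has_sum s) UNIV" for x :: "rat \<Rightarrow> 'v" and s
  proof -
    have "(x has_sum s) (range \<iota>)" using that(2) has_sum_reindex[OF inj] by blast
    then have "(x has_sum (\<Sum>n\<in>F. x n) + s) (F \<union> range \<iota>)"
      using has_sum_Un_disjoint[OF has_sum_finite[OF fF] _ disj] by blast
    then show ?thesis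
      by (rule has_sum_cong_neutral[THEN iffD1, rotated 3]) (use that(1) in auto)
  qed
  have 1: "((\<lambda>n. sc (nonhol_term \<kappa> n \<tau>) (c (- n))) has_sum (Gf \<tau> + Gc \<tau>)) UNIV" if "\<tau> \<in> \<H>" for \<tau>
    unfolding Gf_def
  proof (rule split)
    show "sc (nonhol_term \<kappa> n \<tau>) (c (- n)) = 0" if "n \<notin> F \<union> range \<iota>" for n
    proof -
      have "c (- n) = 0" using cover[of n] that by blast
      then show ?thesis by simp
    qed
    have "((\<lambda>j. t j \<tau>) has_sum Gc \<tau>) UNIV"
      unfolding Gc_def by (rule norm_summable_imp_has_sum[OF ts[OF that] summable_sums[OF summable_norm_cancel[OF ts[OF that]]]])
    then show "(((\<lambda>n. sc (nonhol_term \<kappa> n \<tau>) (c (- n))) \<circ> \<iota>) has_sum Gc \<tau>) UNIV"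
      by (simp add: t_def o_def)
  qed
  have 2: "\<exists>D. ((\<lambda>\<tau>. Gf \<tau> + Gc \<tau>) has_derivative D) (at \<tau>) \<and> dbar_op D = sc (\<i> / 2 * of_real (Im \<tau> powr (- \<kappa>))) (g \<tau>)"
    if \<tau>: "\<tau> \<in> \<H>" for \<tau>
  proof -
    define d where "d n h = sc (nonhol_term_deriv \<kappa> n \<tau> h) (c (- n))" for n h
    have dn: "((\<lambda>\<tau>. sc (nonhol_term \<kappa> n \<tau>) (c (- n))) has_derivative (\<lambda>h. sc (nonhol_term_deriv \<kappa> n y h) (c (- n)))) (at y)"
      if "y \<in> \<H>" for n y
      by (rule bounded_linear.has_derivative[OF bsc.bounded_linear_left has_derivative_nonhol_term[OF that]])
    have Gf': "(Gf has_derivative (\<lambda>h. \<Sum>n\<in>F. d n h)) (at \<tau>)"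
      unfolding Gf_def[abs_def] d_def by (intro has_derivative_sum dn \<tau>)
    \<comment> \<open>\<open>v\<close> and \<open>w\<close> bound a convex strip around
      \<open>\<tau>\<close> on which the derivative estimates are uniform. Since half of the decay
      is spent there, the majorant is summed at height \<open>v / 2\<close>.\<close>
    define v where "v = Im \<tau> / 2"
    define w where "w = 2 * Im \<tau>"
    have p: "Im \<tau> > 0" using \<tau> by (simp add: upper_half_plane_def)
    define U where "U = {z. v < Im z} \<inter> {z. Im z < w}"
    have v: "0 < v" using p by (simp add: v_def)
    define B where "B = 2 * expint_tail \<kappa> A v * exp (A * w) / v + (v powr (- \<kappa>) + w powr (- \<kappa>))"
    have UH: "U \<subseteq> \<H>" using v by (auto simp: U_def upper_half_plane_def)
    have Gc': "(Gc has_derivative (\<lambda>h. \<Sum>j. d (\<iota> j) h)) (at \<tau>)" "summable (\<lambda>j. d (\<iota> j) h)" for h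
    proof -
      have U: "convex U" "open U" "\<tau> \<in> U"
        unfolding U_def by (intro convex_Int convex_halfspace_Im_gt convex_halfspace_Im_lt
            open_Int open_halfspace_Im_gt open_halfspace_Im_lt)+ (use p in \<open>simp add: v_def w_def\<close>)
      have td: "(t j has_derivative (\<lambda>h. sc (nonhol_term_deriv \<kappa> (\<iota> j) y h) (c (- \<iota> j)))) (at y)" if "y \<in> U" for j y
        unfolding t_def[abs_def] using that UH by (intro dn) auto
      have bd: "norm (sc (nonhol_term_deriv \<kappa> (\<iota> j) y h) (c (- \<iota> j))) \<le> B * K * (norm (c (- \<iota> j)) * exp (2 * pi * of_rat (\<iota> j) * (v / 2))) * norm h"
        if "y \<in> U" for j y h
      proof -
        have "norm (nonhol_term_deriv \<kappa> (\<iota> j) y h) \<le> B * exp (pi * of_rat (\<iota> j) * v) * norm h"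
          unfolding B_def by (rule norm_nonhol_term_deriv_neg[OF A An v]) (use that in \<open>auto simp: U_def\<close>)
        then have "norm (nonhol_term_deriv \<kappa> (\<iota> j) y h) * (norm (c (- \<iota> j)) * K) \<le> B * exp (pi * of_rat (\<iota> j) * v) * norm h * (norm (c (- \<iota> j)) * K)"
          using K(2) by (intro mult_right_mono) auto
        with K(1)[of "nonhol_term_deriv \<kappa> (\<iota> j) y h" "c (- \<iota> j)"] show ?thesis by (simp add: mult_ac)
      qed
      have sm: "summable (\<lambda>j. B * K * (norm (c (- \<iota> j)) * exp (2 * pi * of_rat (\<iota> j) * (v / 2))))"
        using v by (intro summable_mult S) simp
      have sums: "(\<lambda>j. t j y) sums Gc y" if "y \<in> U" for y
        unfolding Gc_def using that UH by (intro summable_sums summable_norm_cancel[OF ts]) auto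
      show "(Gc has_derivative (\<lambda>h. \<Sum>j. d (\<iota> j) h)) (at \<tau>)"
        unfolding d_def by (rule has_derivative_series_m_test(1)[OF U td bd sm sums])
      show "summable (\<lambda>j. d (\<iota> j) h)"
        unfolding d_def by (rule has_derivative_series_m_test(2)[OF U td bd sm sums])
    qed
    have dd: "dbar_op (d n) = sc (\<i> / 2 * of_real (Im \<tau> powr (- \<kappa>))) (sc (cnj (qpow (- n) \<tau>)) (c (- n)))" for n
      unfolding d_def dbar_op_sc nonhol_term_dbar by simp
    let ?a = "\<i> / 2 * of_real (Im \<tau> powr (- \<kappa>))"
    have zero: "dbar_op (d n) = 0" if "n \<notin> F \<union> range \<iota>" for n
    proof -
      have "c (- n) = 0" using cover[of n] that by blast
      then show ?thesis by (simp add: dd)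
    qed
    have "((\<lambda>n. sc ?a (sc (cnj (qpow n \<tau>)) (c n))) has_sum sc ?a (g \<tau>)) UNIV"
      by (rule has_sum_bounded_linear[OF bsc.bounded_linear_right g[OF \<tau>]])
    then have "((\<lambda>n. sc ?a (sc (cnj (qpow n \<tau>)) (c n))) has_sum sc ?a (g \<tau>)) (range uminus)" by simp
    moreover have "inj (uminus :: rat \<Rightarrow> rat)" by simp
    ultimately have "(((\<lambda>n. sc ?a (sc (cnj (qpow n \<tau>)) (c n))) \<circ> uminus) has_sum sc ?a (g \<tau>)) UNIV"
      using has_sum_reindex by blast
    also have "(\<lambda>n. sc ?a (sc (cnj (qpow n \<tau>)) (c n))) \<circ> uminus = (\<lambda>n. dbar_op (d n))" unfolding dd o_def ..
    finally have tot: "((\<lambda>n. dbar_op (d n)) has_sum sc ?a (g \<tau>)) UNIV" .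
    then have "((\<lambda>n. dbar_op (d n)) \<circ> \<iota>) summable_on UNIV"
      using summable_on_subset_banach[of "\<lambda>n. dbar_op (d n)" UNIV "range \<iota>"] summable_on_reindex[OF inj] by (auto simp: summable_on_def)
    then obtain s where s: "(((\<lambda>n. dbar_op (d n)) \<circ> \<iota>) has_sum s) UNIV" by (auto simp: summable_on_def)
    have "s = dbar_op (\<lambda>h. \<Sum>j. d (\<iota> j) h)"
      using sums_unique2[OF has_sum_imp_sums[OF s]] dbar_op_suminf[OF Gc'(2)] by (simp add: o_def)
    moreover have "sc ?a (g \<tau>) = (\<Sum>n\<in>F. dbar_op (d n)) + s"
      by (rule has_sum_unique[OF tot split[OF zero s]])
    ultimately have "dbar_op (\<lambda>h. (\<Sum>n\<in>F. d n h) + (\<Sum>j. d (\<iota> j) h)) = sc ?a (g \<tau>)"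
      by (simp add: dbar_op_add dbar_op_sum[OF fF])
    with has_derivative_add[OF Gf' Gc'(1)] show ?thesis by blast
  qed
  have 3: "exp_growth (\<lambda>\<tau>. Gf \<tau> + Gc \<tau>)"
  proof (rule exp_growth_add)
    show "exp_growth Gf"
      unfolding Gf_def[abs_def]
    proof (rule exp_growth_sum[OF fF])
      fix n
      define R where "R = \<bar>radial \<kappa> (of_rat n) 1\<bar>"
      define C where "C = 1 + \<bar>\<kappa>\<bar> + 4 * pi * \<bar>real_of_rat n\<bar>"
      define C' where "C' = C + 2 * pi * \<bar>real_of_rat n\<bar>"
      show "exp_growth (\<lambda>\<tau>. sc (nonhol_term \<kappa> n \<tau>) (c (- n)))"
      proof (rule exp_growthI[of 1])
        fix \<tau> assume t: "1 \<le> Im \<tau>"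
        have Cpos: "C \<ge> 0" by (simp add: C_def)
        have "norm (nonhol_term \<kappa> n \<tau>) = \<bar>radial \<kappa> (of_rat n) (Im \<tau>)\<bar> * exp (- 2 * pi * of_rat n * Im \<tau>)"
          unfolding nonhol_term_def norm_mult norm_qpow norm_of_real ..
        also have "\<dots> \<le> ((R + 1) * exp (C * Im \<tau>)) * exp (2 * pi * \<bar>real_of_rat n\<bar> * Im \<tau>)"
        proof (rule mult_mono)
          have "R \<le> R * exp (C * Im \<tau>)"
            using Cpos t mult_left_mono[of 1 "exp (C * Im \<tau>)" R] by (simp add: R_def)
          then show "\<bar>radial \<kappa> (of_rat n) (Im \<tau>)\<bar> \<le> (R + 1) * exp (C * Im \<tau>)"
            using radial_growth[OF t, of \<kappa> "of_rat n"] by (simp add: R_def C_def distrib_right)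
          have "- real_of_rat n * Im \<tau> \<le> \<bar>real_of_rat n\<bar> * Im \<tau>" using t by (intro mult_right_mono) linarith+
          then have "2 * pi * (- real_of_rat n * Im \<tau>) \<le> 2 * pi * (\<bar>real_of_rat n\<bar> * Im \<tau>)" by (intro mult_left_mono) auto
          then show "exp (- 2 * pi * of_rat n * Im \<tau>) \<le> exp (2 * pi * \<bar>real_of_rat n\<bar> * Im \<tau>)"
            by (simp add: mult.assoc del: abs_of_rat)
        qed (auto simp: R_def)
        also have "\<dots> = (R + 1) * exp (C' * Im \<tau>)"
          by (simp add: C'_def distrib_right exp_add)
        finally have "norm (nonhol_term \<kappa> n \<tau>) * (norm (c (- n)) * K) \<le> (R + 1) * exp (C' * Im \<tau>) * (norm (c (- n)) * K)"
          using K(2) by (intro mult_right_mono) auto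
        with K(1)[of "nonhol_term \<kappa> n \<tau>" "c (- n)"]
        show "norm (sc (nonhol_term \<kappa> n \<tau>) (c (- n))) \<le> ((R + 1) * (norm (c (- n)) * K)) * exp (C' * Im \<tau>)"
          by (simp add: mult_ac)
      qed
    qed
    show "exp_growth Gc"
    proof (rule exp_growthI[of 1])
      fix \<tau> assume t: "1 \<le> Im \<tau>"
      define D where "D = (\<Sum>j. norm (c (- \<iota> j)) * exp (2 * pi * of_rat (\<iota> j) * 1))"
      have "norm (Gc \<tau>) \<le> (\<Sum>j. expint_tail \<kappa> A 1 * exp (A * Im \<tau>) * K * (norm (c (- \<iota> j)) * exp (2 * pi * of_rat (\<iota> j) * 1)))"
        unfolding Gc_def by (rule norm_suminf_le[OF tb]) (use t S[of 1] in \<open>auto intro!: summable_mult\<close>)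
      also have "\<dots> = expint_tail \<kappa> A 1 * exp (A * Im \<tau>) * K * D"
        unfolding D_def by (rule suminf_mult) (use S[of 1] in simp)
      finally show "norm (Gc \<tau>) \<le> (expint_tail \<kappa> A 1 * K * D) * exp (A * Im \<tau>)" by (simp add: mult_ac)
    qed
  qed
  show thesis by (rule that[OF 1 2 3])
qed

end

text \<open>\<open>C1_on_H\<close> provides partial derivatives and their continuity; the total
  derivative is needed for the chain rule in Stokes' theorem and for \<open>dbar_op\<close>.\<close>

lemma C1_on_H_has_derivative:
  fixes G :: "complex \<Rightarrow> 'v::real_normed_vector"
  assumes C1: "C1_on_H G" and \<tau>: "\<tau> \<in> \<H>"
  shows "(G has_derivative (\<lambda>h. Re h *\<^sub>R d_u G \<tau> + Im h *\<^sub>R d_v G \<tau>)) (at \<tau>)"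
proof -
  have mem: "Complex x y \<in> \<H> \<longleftrightarrow> y \<in> {0<..}" for x y by (simp add: upper_half_plane_def)
  have du: "((\<lambda>x. G (Complex x y)) has_derivative (\<lambda>h. h *\<^sub>R d_u G (Complex x0 y))) (at x0)" if "y \<in> {0<..}" for x0 y
  proof -
    have "((\<lambda>t::real. G (Complex x0 y + of_real t)) has_derivative (\<lambda>h. h *\<^sub>R d_u G (Complex x0 y))) (at (x0 - x0))"
      using C1 that mem unfolding C1_on_H_def d_u_def
      by (auto simp: vector_derivative_works has_vector_derivative_def)
    moreover have "((\<lambda>x. x - x0) has_derivative (\<lambda>h. h)) (at x0)" by (auto intro!: derivative_eq_intros)
    ultimately have "((\<lambda>x. G (Complex x0 y + of_real (x - x0))) has_derivative (\<lambda>h. h *\<^sub>R d_u G (Complex x0 y))) (at x0)"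
      by (rule has_derivative_compose[rotated])
    moreover have "Complex x0 y + of_real (x - x0) = Complex x y" for x by (simp add: complex_eq_iff)
    ultimately show ?thesis by simp
  qed
  have dv: "((\<lambda>y. G (Complex x y)) has_derivative (\<lambda>h. h *\<^sub>R d_v G (Complex x y0))) (at y0)" if "y0 \<in> {0<..}" for x y0
  proof -
    have "((\<lambda>t::real. G (Complex x y0 + \<i> * of_real t)) has_derivative (\<lambda>h. h *\<^sub>R d_v G (Complex x y0))) (at (y0 - y0))"
      using C1 that mem unfolding C1_on_H_def d_v_def
      by (auto simp: vector_derivative_works has_vector_derivative_def)
    moreover have "((\<lambda>y. y - y0) has_derivative (\<lambda>h. h)) (at y0)" by (auto intro!: derivative_eq_intros)
    ultimately have "((\<lambda>y. G (Complex x y0 + \<i> * of_real (y - y0))) has_derivative (\<lambda>h. h *\<^sub>R d_v G (Complex x y0))) (at y0)"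
      by (rule has_derivative_compose[rotated])
    moreover have "Complex x y0 + \<i> * of_real (y - y0) = Complex x y" for y by (simp add: complex_eq_iff)
    ultimately show ?thesis by simp
  qed
  define x0 y0 where "x0 = Re \<tau>" and "y0 = Im \<tau>"
  have y0: "y0 \<in> {0<..}" using \<tau> by (simp add: y0_def upper_half_plane_def)
  have \<tau>eq: "Complex x0 y0 = \<tau>" by (simp add: x0_def y0_def)
  have op: "open (UNIV \<times> {0::real<..} :: (real \<times> real) set)" by (intro open_Times open_UNIV open_greaterThan)
  have "((\<lambda>(x, y). G (Complex x y)) has_derivative
      (\<lambda>(tx, ty). tx *\<^sub>R d_u G (Complex x0 y0) + blinfun_apply (blinfun_scaleR_left (d_v G (Complex x0 y0))) ty)) (at (x0, y0) within UNIV \<times> {0<..})"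
  proof (rule has_derivative_partialsI[where f = "\<lambda>x y. G (Complex x y)" and fx = "\<lambda>h. h *\<^sub>R d_u G (Complex x0 y0)"
        and fy = "\<lambda>x y. blinfun_scaleR_left (d_v G (Complex x y))"])
    show "((\<lambda>x. G (Complex x y0)) has_derivative (\<lambda>h. h *\<^sub>R d_u G (Complex x0 y0))) (at x0 within UNIV)"
      using du[OF y0] by simp
    show "((\<lambda>y. G (Complex x y)) has_derivative blinfun_apply (blinfun_scaleR_left (d_v G (Complex x y)))) (at y within {0<..})"
      if "y \<in> {0<..}" for x y
      using has_derivative_at_withinI[OF dv[OF that]] by simp
    have "continuous_on (UNIV \<times> {0<..}) (\<lambda>p. d_v G (Complex (fst p) (snd p)))"
    proof (rule continuous_on_compose2[of \<H> "d_v G"])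
      show "continuous_on \<H> (d_v G)" using C1 by (simp add: C1_on_H_def)
      show "continuous_on (UNIV \<times> {0<..}) (\<lambda>p. Complex (fst p) (snd p))" by (intro continuous_intros)
    qed (auto simp: upper_half_plane_def)
    then have "continuous_on (UNIV \<times> {0<..}) (\<lambda>(x, y). blinfun_scaleR_left (d_v G (Complex x y)))"
      unfolding split_def by (rule bounded_linear.continuous_on[OF bounded_linear_blinfun_scaleR_left])
    then show "continuous (at (x0, y0) within UNIV \<times> {0<..}) (\<lambda>(x, y). blinfun_scaleR_left (d_v G (Complex x y)))"
      using y0 by (auto simp: continuous_on_eq_continuous_within)
  qed (use y0 in auto)
  then have "((\<lambda>(x, y). G (Complex x y)) has_derivative
      (\<lambda>(tx, ty). tx *\<^sub>R d_u G \<tau> + ty *\<^sub>R d_v G \<tau>)) (at (Re \<tau>, Im \<tau>))"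
    using at_within_open[OF _ op, of "(x0, y0)"] y0 by (simp add: \<tau>eq x0_def y0_def)
  moreover have "((\<lambda>\<tau>. (Re \<tau>, Im \<tau>)) has_derivative (\<lambda>h. (Re h, Im h))) (at \<tau>)"
    by (intro has_derivative_Pair bounded_linear_imp_has_derivative bounded_linear_Re bounded_linear_Im)
  ultimately have "((\<lambda>\<tau>. (\<lambda>(x, y). G (Complex x y)) (Re \<tau>, Im \<tau>)) has_derivative
      (\<lambda>h. (\<lambda>(tx, ty). tx *\<^sub>R d_u G \<tau> + ty *\<^sub>R d_v G \<tau>) (Re h, Im h))) (at \<tau>)"
    by (rule has_derivative_compose[rotated])
  then show ?thesis by simp
qed

section \<open>Uniqueness and existence of the decomposition\<close>

lemma qpow_0: "qpow 0 \<tau> = 1"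
  by (simp add: qpow_def)

lemma qpow_periodic:
  assumes "n * of_nat N \<in> \<int>"
  shows "qpow n (\<tau> + of_nat N) = qpow n \<tau>"
proof -
  from assms obtain j where j: "n * of_nat N = of_int j" by (rule Ints_cases)
  have "(of_rat n * of_nat N :: complex) = of_rat (n * of_nat N)" by (simp add: of_rat_mult)
  also have "\<dots> = of_int j" by (simp add: j)
  finally have e: "of_rat n * of_nat N = (of_int j :: complex)" .
  have "2 * of_real pi * \<i> * of_rat n * (\<tau> + of_nat N) = 2 * of_real pi * \<i> * of_rat n * \<tau> + of_int (2 * j) * of_real pi * \<i>"
    using e by (simp add: algebra_simps)
  moreover have "exp (z + of_int (2 * j) * of_real pi * \<i>) = exp z" for z
    by (subst exp_eq) (rule exI[of _ j], simp)
  ultimately show ?thesis unfolding qpow_def by simp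
qed

lemma nonhol_term_periodic:
  "n * of_nat N \<in> \<int> \<Longrightarrow> nonhol_term \<kappa> n (\<tau> + of_nat N) = nonhol_term \<kappa> n \<tau>"
  by (simp add: nonhol_term_def qpow_periodic)

text \<open>The factor of \<open>qpow n \<tau>\<close> in \<open>has_nonhol_expansion\<close>; as
  \<open>qpow 0 \<tau> = 1\<close>, the exponential can be split off for \<open>n = 0\<close>
  too.\<close>

definition nonhol_factor :: "real \<Rightarrow> rat \<Rightarrow> real \<Rightarrow> complex" where
  "nonhol_factor \<kappa> n v = (if n = 0 then of_real (if \<kappa> = 1 then ln v else v powr (1 - \<kappa>))
     else W_fun \<kappa> (2 * pi * of_rat n * v))"

text \<open>At one fixed height a non-holomorphic term cannot be told from a multiple of
  \<open>qpow n\<close>; two heights with different factors separate them. For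
  \<open>n \<noteq> 0\<close> the factor is a nonzero constant times a strictly decreasing
  tail.\<close>

lemma nonhol_factor_nonconst: "nonhol_factor \<kappa> n 1 \<noteq> nonhol_factor \<kappa> n 2"
proof (cases "n = 0")
  case True
  have "2 powr (1 - \<kappa>) \<noteq> 1" if "\<kappa> \<noteq> 1" using that by (simp add: powr_def)
  with True show ?thesis by (auto simp: nonhol_factor_def)
next
  case False
  define c where "c = - 4 * pi * real_of_rat n"
  have c: "c \<noteq> 0" using False by (simp add: c_def)
  have "expint_tail \<kappa> c 2 < expint_tail \<kappa> c 1"
  proof (rule DERIV_neg_imp_decreasing[where f = "expint_tail \<kappa> c"])
    fix x :: real assume "1 \<le> x" "x \<le> 2"
    then show "\<exists>y. (expint_tail \<kappa> c has_real_derivative y) (at x) \<and> y < 0"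
      using has_field_derivative_expint_tail[OF c, of x \<kappa>] by force
  qed simp
  moreover have "complex_of_real c powr (1 - of_real \<kappa>) \<noteq> 0" using c by (simp add: powr_def)
  moreover have "nonhol_factor \<kappa> n v = complex_of_real c powr (1 - of_real \<kappa>) * of_real (expint_tail \<kappa> c v)" if "0 < v" for v
    using W_fun_eq[of "of_rat n" v \<kappa>] False that by (simp add: nonhol_factor_def c_def)
  ultimately show ?thesis by simp
qed

context complex_space
begin

lemma has_nonhol_expansion_iff:
  "has_nonhol_expansion sc \<kappa> G c \<longleftrightarrow>
    (\<forall>\<tau>\<in>\<H>. ((\<lambda>n. sc (nonhol_factor \<kappa> n (Im \<tau>) * qpow n \<tau>) (c n)) has_sum G \<tau>) UNIV)"
proof -
  have "(if n = 0 then of_real (if \<kappa> = 1 then ln (Im \<tau>) else Im \<tau> powr (1 - \<kappa>)) else W_fun \<kappa> (2 * pi * of_rat n * Im \<tau>) * qpow n \<tau>)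
      = nonhol_factor \<kappa> n (Im \<tau>) * qpow n \<tau>" for n \<tau>
    by (simp add: nonhol_factor_def qpow_0)
  then show ?thesis by (simp add: has_nonhol_expansion_def)
qed

text \<open>At each height \<open>v\<close> uniqueness of Fourier coefficients makes
  \<open>a n\<close> plus \<open>nonhol_factor \<kappa> n v\<close> times \<open>b n\<close> vanish.
  Comparing the heights \<open>1\<close> and \<open>2\<close> yields \<open>b n = 0\<close>, and
  then \<open>a n = 0\<close>; hence the description in \<open>q_coeff_plus\<close> is
  unique.\<close>

lemma decomposition_unique:
  assumes "\<forall>\<tau>\<in>\<H>. G \<tau> = Gp \<tau> + Gm \<tau>" "has_q_expansion sc Gp cp" "has_nonhol_expansion sc \<kappa> Gm cm"
    and "\<forall>\<tau>\<in>\<H>. G \<tau> = Gp' \<tau> + Gm' \<tau>" "has_q_expansion sc Gp' cp'" "has_nonhol_expansion sc \<kappa> Gm' cm'"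
  shows "cp = cp'"
proof
  fix n
  define a where "a n = cp n - cp' n" for n
  define b where "b n = cm n - cm' n" for n
  have z: "a n + sc (nonhol_factor \<kappa> n v) (b n) = 0" if v: "0 < v" for n v
  proof -
    have "((\<lambda>n. sc (e2pi n u) (sc (of_real (exp (- 2 * pi * of_rat n * v))) (a n + sc (nonhol_factor \<kappa> n v) (b n)))) has_sum 0) UNIV" for u
    proof -
      define \<tau> where "\<tau> = Complex u v"
      have t: "\<tau> \<in> \<H>" using v by (simp add: \<tau>_def upper_half_plane_def)
      have h: "((\<lambda>n. sc (qpow n \<tau>) (cp n)) has_sum Gp \<tau>) UNIV" "((\<lambda>n. sc (qpow n \<tau>) (cp' n)) has_sum Gp' \<tau>) UNIV"
        "((\<lambda>n. sc (nonhol_factor \<kappa> n v * qpow n \<tau>) (cm n)) has_sum Gm \<tau>) UNIV"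
        "((\<lambda>n. sc (nonhol_factor \<kappa> n v * qpow n \<tau>) (cm' n)) has_sum Gm' \<tau>) UNIV"
        using assms t unfolding has_q_expansion_def has_nonhol_expansion_iff by (auto simp: \<tau>_def)
      have "((\<lambda>n. (sc (qpow n \<tau>) (cp n) + sc (nonhol_factor \<kappa> n v * qpow n \<tau>) (cm n)) +
          - (sc (qpow n \<tau>) (cp' n) + sc (nonhol_factor \<kappa> n v * qpow n \<tau>) (cm' n))) has_sum (Gp \<tau> + Gm \<tau>) + - (Gp' \<tau> + Gm' \<tau>)) UNIV"
        by (intro has_sum_add h has_sum_uminus[THEN iffD2]) (use has_sum_add[OF h(2) h(4)] in \<open>simp only: minus_minus\<close>)
      moreover have "(sc (qpow n \<tau>) (cp n) + sc (nonhol_factor \<kappa> n v * qpow n \<tau>) (cm n)) +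
          - (sc (qpow n \<tau>) (cp' n) + sc (nonhol_factor \<kappa> n v * qpow n \<tau>) (cm' n)) =
          sc (qpow n \<tau>) (a n + sc (nonhol_factor \<kappa> n v) (b n))" for n
        by (simp add: a_def b_def scale_right_distrib scale_right_diff_distrib mult.commute)
      moreover have "qpow n \<tau> = e2pi n u * of_real (exp (- 2 * pi * of_rat n * v))" for n
        by (simp add: qpow_eq \<tau>_def mult.commute)
      moreover have "(Gp \<tau> + Gm \<tau>) + - (Gp' \<tau> + Gm' \<tau>) = 0" using assms(1,4) t by simp
      ultimately show ?thesis by (simp only: scale_scale)
    qed
    then have "sc (of_real (exp (- 2 * pi * of_rat n * v))) (a n + sc (nonhol_factor \<kappa> n v) (b n)) = 0"
      by (rule fourier_unique_0)
    then show ?thesis unfolding scale_eq_0_iff of_real_eq_0_iff by simp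
  qed
  have "sc (nonhol_factor \<kappa> n 1 - nonhol_factor \<kappa> n 2) (b n) = 0"
    using z[of 1 n] z[of 2 n] by (simp add: scale_left_diff_distrib add_eq_0_iff)
  then have "b n = 0" using nonhol_factor_nonconst[of \<kappa> n] by simp
  then have "a n = 0" using z[of 1 n] by simp
  then show "cp n = cp' n" by (simp add: a_def)
qed

lemma dbar_zero_imp_holomorphic:
  assumes d: "(F has_derivative D) (at \<tau>)" and z: "dbar_op D = 0"
  shows "(F has_derivative (\<lambda>h. sc h (D 1))) (at \<tau>)"
proof -
  interpret D: bounded_linear D using d by (rule has_derivative_bounded_linear)
  have "D 1 + sc \<i> (D \<i>) = 0" using z by (simp add: dbar_op_def)
  then have "sc \<i> (D 1 + sc \<i> (D \<i>)) = 0" by simp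
  then have Di: "D \<i> = sc \<i> (D 1)" by (simp add: scale_right_distrib)
  have "D h = sc h (D 1)" for h
  proof -
    have "h = Re h *\<^sub>R 1 + Im h *\<^sub>R \<i>" by (simp add: complex_eq_iff)
    then have "D h = D (Re h *\<^sub>R 1 + Im h *\<^sub>R \<i>)" by simp
    also have "\<dots> = Re h *\<^sub>R D 1 + Im h *\<^sub>R sc \<i> (D 1)" by (simp only: D.add D.scaleR Di)
    also have "\<dots> = sc (of_real (Re h) + of_real (Im h) * \<i>) (D 1)"
      by (simp only: sc_of_real[symmetric] scale_left_distrib scale_scale)
    also have "of_real (Re h) + of_real (Im h) * \<i> = h" by (simp add: complex_eq_iff)
    finally show ?thesis .
  qed
  then have "D = (\<lambda>h. sc h (D 1))" by (rule ext)
  with d show ?thesis by (rule has_derivative_eq_rhs)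
qed

text \<open>\<open>Gm\<close> and \<open>G\<close> have the same conjugate-variable derivative, so
  \<open>Gp\<close> satisfies the Cauchy-Riemann equations. Periodicity and growth pass to
  \<open>Gp\<close> and give it a q-expansion, and uniqueness identifies its coefficients with
  \<open>q_coeff_plus\<close>.\<close>

lemma harmonic_decomposition:
  fixes c :: "rat \<Rightarrow> 'v" and g G :: "complex \<Rightarrow> 'v"
  assumes N: "0 < N" and supp: "\<And>n. c n \<noteq> 0 \<Longrightarrow> n * of_nat N \<in> \<int>" and fin: "finite {n. n < 0 \<and> c n \<noteq> 0}"
    and g: "\<And>\<tau>. \<tau> \<in> \<H> \<Longrightarrow> ((\<lambda>n. sc (cnj (qpow n \<tau>)) (c n)) has_sum g \<tau>) UNIV"
    and G: "C1_on_H G" "exp_growth G" "\<And>\<tau>. \<tau> \<in> \<H> \<Longrightarrow> G (\<tau> + of_nat N) = G \<tau>"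
    and dG: "\<And>\<tau>. \<tau> \<in> \<H> \<Longrightarrow> d_taubar sc G \<tau> = sc (\<i> / 2 * of_real (Im \<tau> powr (- \<kappa>))) (g \<tau>)"
  shows "finite {n. n < 0 \<and> q_coeff_plus sc \<kappa> G n \<noteq> 0}"
    and "q_coeff_plus sc \<kappa> G n \<noteq> 0 \<Longrightarrow> n * of_nat N \<in> \<int>"
    and "\<tau> \<in> \<H> \<Longrightarrow> ((\<lambda>n. sc (qpow n \<tau>) (q_coeff_plus sc \<kappa> G n) + sc (nonhol_term \<kappa> n \<tau>) (c (- n))) has_sum G \<tau>) UNIV"
proof -
  obtain Gm where Gm: "\<And>\<tau>. \<tau> \<in> \<H> \<Longrightarrow> ((\<lambda>n. sc (nonhol_term \<kappa> n \<tau>) (c (- n))) has_sum Gm \<tau>) UNIV"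
    "\<And>\<tau>. \<tau> \<in> \<H> \<Longrightarrow> \<exists>D. (Gm has_derivative D) (at \<tau>) \<and> dbar_op D = sc (\<i> / 2 * of_real (Im \<tau> powr (- \<kappa>))) (g \<tau>)"
    "exp_growth Gm"
    by (rule nonhol_series[OF N supp fin g, of \<kappa>]) blast+
  define Gp where "Gp \<tau> = G \<tau> + - Gm \<tau>" for \<tau>
  have "holomorphic_into sc Gp"
    unfolding holomorphic_into_def
  proof
    fix \<tau> assume t: "\<tau> \<in> \<H>"
    from Gm(2)[OF t] obtain D where D: "(Gm has_derivative D) (at \<tau>)" "dbar_op D = sc (\<i> / 2 * of_real (Im \<tau> powr (- \<kappa>))) (g \<tau>)" by blast
    let ?L = "\<lambda>h. Re h *\<^sub>R d_u G \<tau> + Im h *\<^sub>R d_v G \<tau>"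
    have "(Gp has_derivative (\<lambda>h. ?L h - D h)) (at \<tau>)"
      unfolding Gp_def[abs_def] using has_derivative_diff[OF C1_on_H_has_derivative[OF G(1) t] D(1)] by simp
    moreover have "dbar_op (\<lambda>h. ?L h - D h) = 0"
      using dG[OF t] D(2) by (simp add: dbar_op_diff) (simp add: dbar_op_def d_taubar_def)
    ultimately show "\<exists>d. (Gp has_derivative (\<lambda>h. sc h d)) (at \<tau>)"
      using dbar_zero_imp_holomorphic by blast
  qed
  moreover have "exp_growth Gp"
    unfolding Gp_def[abs_def] by (intro exp_growth_add exp_growth_minus G Gm)
  moreover have "Gp (\<tau> + of_nat N) = Gp \<tau>" if t: "\<tau> \<in> \<H>" for \<tau>
  proof -
    have t': "\<tau> + of_nat N \<in> \<H>" using t by (simp add: upper_half_plane_def)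
    have "sc (nonhol_term \<kappa> n (\<tau> + of_nat N)) (c (- n)) = sc (nonhol_term \<kappa> n \<tau>) (c (- n))" for n
    proof (cases "c (- n) = 0")
      case False
      from supp[OF this] have "n * of_nat N \<in> \<int>" by simp
      then show ?thesis by (simp add: nonhol_term_periodic)
    qed simp
    with Gm(1)[OF t'] have "((\<lambda>n. sc (nonhol_term \<kappa> n \<tau>) (c (- n))) has_sum Gm (\<tau> + of_nat N)) UNIV"
      by simp
    then have "Gm (\<tau> + of_nat N) = Gm \<tau>"
      by (rule has_sum_unique[OF _ Gm(1)[OF t]])
    then show ?thesis using G(3)[OF t] by (simp add: Gp_def)
  qed
  ultimately obtain cp where cp: "has_q_expansion sc Gp cp" "\<And>n. cp n \<noteq> 0 \<Longrightarrow> n * of_nat N \<in> \<int>"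
    using q_expansion_exists[of Gp N] N by blast
  \<comment> \<open>Converts the normalization of \<open>radial\<close> to that of the definition:
    the factor \<open>1 / (1 - \<kappa>)\<close> at \<open>n = 0\<close> for
    \<open>\<kappa> \<noteq> 1\<close>, and minus the inverse of the constant in
    \<open>W_fun_eq\<close> for \<open>n \<noteq> 0\<close>.\<close>
  define cm where "cm n = (if n = 0 then (if \<kappa> = 1 then c 0 else sc (1 / (1 - of_real \<kappa>)) (c 0))
    else sc (- inverse (of_real (- 4 * pi * of_rat n) powr (1 - of_real \<kappa>))) (c (- n)))" for n
  have "sc (nonhol_factor \<kappa> n (Im \<tau>) * qpow n \<tau>) (cm n) = sc (nonhol_term \<kappa> n \<tau>) (c (- n))" if "\<tau> \<in> \<H>" for n \<tau>
  proof -
    have p: "0 < Im \<tau>" using that by (simp add: upper_half_plane_def)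
    consider "n = 0" "\<kappa> = 1" | "n = 0" "\<kappa> \<noteq> 1" | "n \<noteq> 0" by blast
    then show ?thesis
    proof cases
      case 3
      have P: "complex_of_real (- 4 * pi * of_rat n) powr (1 - of_real \<kappa>) \<noteq> 0" using 3 by (simp add: powr_def)
      have "nonhol_factor \<kappa> n (Im \<tau>) = of_real (- 4 * pi * of_rat n) powr (1 - of_real \<kappa>) * of_real (expint_tail \<kappa> (- 4 * pi * of_rat n) (Im \<tau>))"
        using W_fun_eq[of "of_rat n" "Im \<tau>" \<kappa>] 3 p by (simp add: nonhol_factor_def)
      then have "nonhol_factor \<kappa> n (Im \<tau>) * qpow n \<tau> * (- inverse (of_real (- 4 * pi * of_rat n) powr (1 - of_real \<kappa>))) = nonhol_term \<kappa> n \<tau>"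
        using 3 P by (simp add: nonhol_term_def radial_def)
      then show ?thesis using 3 unfolding cm_def by (simp only: if_False scale_scale)
    qed (auto simp: cm_def nonhol_factor_def nonhol_term_def radial_def qpow_0 of_real_divide)
  qed
  then have cm: "has_nonhol_expansion sc \<kappa> Gm cm"
    unfolding has_nonhol_expansion_iff using Gm(1) by simp
  have dec: "\<forall>\<tau>\<in>\<H>. G \<tau> = Gp \<tau> + Gm \<tau>" by (simp add: Gp_def)
  have eq: "q_coeff_plus sc \<kappa> G = cp"
    unfolding q_coeff_plus_def
  proof (rule the_equality)
    show "\<exists>cm Gp Gm. (\<forall>\<tau>\<in>\<H>. G \<tau> = Gp \<tau> + Gm \<tau>) \<and> has_q_expansion sc Gp cp \<and> has_nonhol_expansion sc \<kappa> Gm cm"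
      using dec cp(1) cm by blast
    fix cp' assume "\<exists>cm Gp Gm. (\<forall>\<tau>\<in>\<H>. G \<tau> = Gp \<tau> + Gm \<tau>) \<and> has_q_expansion sc Gp cp' \<and> has_nonhol_expansion sc \<kappa> Gm cm"
    then show "cp' = cp" using decomposition_unique[OF dec cp(1) cm] by blast
  qed
  show "finite {n. n < 0 \<and> q_coeff_plus sc \<kappa> G n \<noteq> 0}" using cp(1) unfolding eq has_q_expansion_def by simp
  show "q_coeff_plus sc \<kappa> G n \<noteq> 0 \<Longrightarrow> n * of_nat N \<in> \<int>" unfolding eq by (rule cp(2))
  show "((\<lambda>n. sc (qpow n \<tau>) (q_coeff_plus sc \<kappa> G n) + sc (nonhol_term \<kappa> n \<tau>) (c (- n))) has_sum G \<tau>) UNIV" if t: "\<tau> \<in> \<H>"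
  proof -
    have "((\<lambda>n. sc (qpow n \<tau>) (cp n) + sc (nonhol_term \<kappa> n \<tau>) (c (- n))) has_sum (Gp \<tau> + Gm \<tau>)) UNIV"
      using cp(1) t unfolding has_q_expansion_def by (intro has_sum_add Gm(1)) auto
    then show ?thesis unfolding eq by (simp add: Gp_def)
  qed
qed

end

section \<open>Invariance under the metaplectic group\<close>

definition translation_mp :: "int \<Rightarrow> mp2" where
  "translation_mp m = ((\<chi> i j. if i = j then 1 else if i = 1 then m else 0), \<lambda>\<tau>\<in>\<H>. 1)"

definition inversion_mp :: mp2 where
  "inversion_mp = ((\<chi> i j. if i = j then 0 else if i = 1 then - 1 else 1), \<lambda>\<tau>\<in>\<H>. csqrt \<tau>)"

lemma moebius_translation: "moebius (fst (translation_mp m)) \<tau> = \<tau> + of_int m"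
  by (simp add: translation_mp_def moebius_def)

lemma moebius_inversion: "moebius (fst inversion_mp) \<tau> = - 1 / \<tau>"
  by (simp add: inversion_mp_def moebius_def)

lemma snd_translation: "\<tau> \<in> \<H> \<Longrightarrow> snd (translation_mp m) \<tau> = 1"
  by (simp add: translation_mp_def)

lemma snd_inversion: "\<tau> \<in> \<H> \<Longrightarrow> snd inversion_mp \<tau> = csqrt \<tau>"
  by (simp add: inversion_mp_def)

lemma translation_mp_carrier: "translation_mp m \<in> carrier Mp2Z"
proof -
  have "(\<lambda>\<tau>\<in>\<H>. 1 :: complex) holomorphic_on \<H>"
    by (rule holomorphic_transform[of "\<lambda>_. 1"]) auto
  then show ?thesis by (simp add: translation_mp_def Mp2Z_def det_2)
qed

lemma inversion_mp_carrier: "inversion_mp \<in> carrier Mp2Z"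
proof -
  have "csqrt holomorphic_on \<H>"
    by (intro holomorphic_intros) (auto simp: upper_half_plane_def complex_nonpos_Reals_iff)
  then have "(\<lambda>\<tau>\<in>\<H>. csqrt \<tau>) holomorphic_on \<H>"
    by (rule holomorphic_transform) simp
  then show ?thesis by (simp add: inversion_mp_def Mp2Z_def det_2)
qed

lemma translation_mp_mult: "translation_mp m \<otimes>\<^bsub>Mp2Z\<^esub> translation_mp n = translation_mp (m + n)"
proof -
  have "moebius (fst (translation_mp n)) \<tau> \<in> \<H>" if "\<tau> \<in> \<H>" for \<tau>
    using that by (simp add: moebius_translation upper_half_plane_def)
  then show ?thesis
    by (auto simp: Mp2Z_def translation_mp_def vec_eq_iff matrix_matrix_mult_def sum_2 forall_2 restrict_def fun_eq_iff)
qed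

text \<open>There are only finitely many cosets, so two different translations lie in the same one
  and their quotient lies in the normal subgroup on which \<open>\<rho>\<close> is trivial. The
  resulting \<open>N\<close> is a common denominator for all frequencies.\<close>

lemma exists_trivial_translation:
  assumes "factors_through_finite_quotient \<rho>"
  obtains N :: nat where "0 < N" "\<rho> (translation_mp (int N)) = id"
proof -
  interpret Mp: group Mp2Z by (rule group_Mp2Z)
  from assms obtain K where K: "K \<lhd> Mp2Z" "finite (carrier (Mp2Z Mod K))" "\<And>\<gamma>. \<gamma> \<in> K \<Longrightarrow> \<rho> \<gamma> = id"
    unfolding factors_through_finite_quotient_def by blast
  interpret K: normal K Mp2Z by (rule K(1))
  let ?c = "\<lambda>i::nat. K #>\<^bsub>Mp2Z\<^esub> translation_mp (int i)"
  have "range ?c \<subseteq> carrier (Mp2Z Mod K)"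
    using translation_mp_carrier by (auto simp: FactGroup_def RCOSETS_def)
  then have "finite (range ?c)" using K(2) by (rule finite_subset)
  then have "\<not> inj ?c" using finite_imageD infinite_UNIV_nat by blast
  then obtain i j where ij: "i < j" "?c i = ?c j" by (metis (no_types, lifting) linorder_injI)
  have "translation_mp (int j) \<in> ?c j"
    using Mp.rcos_self[OF translation_mp_carrier K.is_subgroup] by blast
  then have "translation_mp (int j) \<in> ?c i" using ij(2) by simp
  then obtain n where n: "n \<in> K" "translation_mp (int j) = n \<otimes>\<^bsub>Mp2Z\<^esub> translation_mp (int i)"
    unfolding r_coset_def by blast
  have "translation_mp (int (j - i)) \<otimes>\<^bsub>Mp2Z\<^esub> translation_mp (int i) = n \<otimes>\<^bsub>Mp2Z\<^esub> translation_mp (int i)"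
    unfolding translation_mp_mult using ij n(2) by (simp add: of_nat_diff)
  then have "translation_mp (int (j - i)) = n"
    using Mp.right_cancel translation_mp_carrier K.mem_carrier[OF n(1)] by blast
  then have "\<rho> (translation_mp (int (j - i))) = id" using K(3) n(1) by simp
  with ij show thesis by (intro that[of "j - i"]) auto
qed

lemma slash_invariant_periodic:
  assumes vs: "vector_space sc" and inv: "slash_invariant sc \<kappa> \<rho> f"
    and \<rho>: "\<rho> (translation_mp (int N)) = id" and t: "\<tau> \<in> \<H>"
  shows "f (\<tau> + of_nat N) = f \<tau>"
proof -
  interpret vector_space sc by (rule vs)
  have "slash sc \<kappa> \<rho> f (translation_mp (int N)) \<tau> = f \<tau>"
    using inv translation_mp_carrier t unfolding slash_invariant_def by blast
  then show ?thesis
    by (simp add: slash_def snd_translation[OF t] moebius_translation \<rho>)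
qed

context complex_space
begin

text \<open>Stokes' theorem asks for continuous partial derivatives; each complex coordinate of
  \<open>f\<close> is a holomorphic function, whose derivative is again holomorphic.\<close>

lemma holomorphic_into_derivative:
  assumes f: "holomorphic_into sc f"
  obtains f' where "continuous_on \<H> f'" "\<And>\<tau>. \<tau> \<in> \<H> \<Longrightarrow> (f has_derivative (\<lambda>h. sc h (f' \<tau>))) (at \<tau>)"
proof -
  obtain B r where fB: "finite B" and r: "\<And>b x y. r b (x + y) = r b x + r b y"
    "\<And>b a x. r b (sc a x) = a * r b x" "\<And>b. bounded_linear (r b)" "\<And>x. x = (\<Sum>b\<in>B. sc (r b x) b)"
    by (rule complex_coordinates) blast
  from f obtain f' where f': "\<And>\<tau>. \<tau> \<in> \<H> \<Longrightarrow> (f has_derivative (\<lambda>h. sc h (f' \<tau>))) (at \<tau>)"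
    unfolding holomorphic_into_def by metis
  have op: "open \<H>" unfolding upper_half_plane_def by (rule open_halfspace_Im_gt)
  have d: "((\<lambda>\<tau>. r b (f \<tau>)) has_field_derivative r b (f' \<tau>)) (at \<tau>)" if "\<tau> \<in> \<H>" for b \<tau>
    using bounded_linear.has_derivative[OF r(3) f'[OF that], of b]
    by (simp add: has_field_derivative_def r(2) mult_commute_abs)
  have "continuous_on \<H> (\<lambda>\<tau>. r b (f' \<tau>))" for b
  proof -
    have "(\<lambda>\<tau>. r b (f \<tau>)) holomorphic_on \<H>"
      using d op by (auto simp: holomorphic_on_open)
    from holomorphic_deriv[OF this op]
    have "continuous_on \<H> (deriv (\<lambda>\<tau>. r b (f \<tau>)))" by (rule holomorphic_on_imp_continuous_on)
    then show ?thesis by (rule continuous_on_eq) (simp add: DERIV_imp_deriv[OF d])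
  qed
  then have "continuous_on \<H> (\<lambda>\<tau>. \<Sum>b\<in>B. sc (r b (f' \<tau>)) b)"
    by (intro continuous_on_sum bsc.continuous_on continuous_on_const)
  then have "continuous_on \<H> f'" unfolding r(4)[symmetric] .
  with f' show thesis using that by blast
qed

end

context hermitian_space
begin

text \<open>The weights \<open>k\<close> and \<open>2 - k\<close> add up to \<open>2\<close>. As
  \<open>conj_sc\<close> undoes the antilinearity of \<open>herm\<close> in its second argument, the
  two automorphy factors multiply to a fourth power, in which the choice of the square root
  disappears; unitarity removes the representation.\<close>

lemma slash_invariant_pairing:
  assumes k: "2 * k \<in> \<int>" and \<rho>: "\<rho> \<in> hom Mp2Z (unitary_group sc herm)"
    and f: "slash_invariant sc k \<rho> f" and G: "slash_invariant (conj_sc sc) (2 - k) \<rho> G"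
    and \<gamma>: "\<gamma> \<in> carrier Mp2Z" and t: "\<tau> \<in> \<H>" and nz: "snd \<gamma> \<tau> \<noteq> 0"
  shows "herm (f (moebius (fst \<gamma>) \<tau>)) (G (moebius (fst \<gamma>) \<tau>)) = (snd \<gamma> \<tau>) ^ 4 * herm (f \<tau>) (G \<tau>)"
proof -
  let ?x = "inv_into UNIV (\<rho> \<gamma>) (f (moebius (fst \<gamma>) \<tau>))" and ?y = "inv_into UNIV (\<rho> \<gamma>) (G (moebius (fst \<gamma>) \<tau>))"
  from \<rho> \<gamma> have "\<rho> \<gamma> \<in> carrier (unitary_group sc herm)" by (auto simp: hom_def)
  then have bij: "bij (\<rho> \<gamma>)" and un: "\<And>x y. herm (\<rho> \<gamma> x) (\<rho> \<gamma> y) = herm x y"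
    by (auto simp: unitary_group_def)
  have xy: "herm ?x ?y = herm (f (moebius (fst \<gamma>) \<tau>)) (G (moebius (fst \<gamma>) \<tau>))"
    using un[of ?x ?y] by (simp add: bij_is_surj[OF bij] surj_f_inv_f)
  have "f \<tau> = sc (snd \<gamma> \<tau> powi (- \<lfloor>2 * k\<rfloor>)) ?x"
    using f \<gamma> t unfolding slash_invariant_def slash_def by metis
  moreover have "G \<tau> = conj_sc sc (snd \<gamma> \<tau> powi (- \<lfloor>2 * (2 - k)\<rfloor>)) ?y"
    using G \<gamma> t unfolding slash_invariant_def slash_def by metis
  ultimately have "herm (f \<tau>) (G \<tau>) = snd \<gamma> \<tau> powi (- \<lfloor>2 * k\<rfloor>) * snd \<gamma> \<tau> powi (- \<lfloor>2 * (2 - k)\<rfloor>) * herm ?x ?y"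
    by (simp add: herm_scale_left herm_conj_sc_right)
  also have "snd \<gamma> \<tau> powi (- \<lfloor>2 * k\<rfloor>) * snd \<gamma> \<tau> powi (- \<lfloor>2 * (2 - k)\<rfloor>) = inverse (snd \<gamma> \<tau> ^ 4)"
  proof -
    from k obtain j where j: "2 * k = of_int j" by (rule Ints_cases)
    then have "2 * (2 - k) = of_int (4 - j)" by simp
    then have "\<lfloor>2 * (2 - k)\<rfloor> = 4 - j" by (simp only: floor_of_int)
    moreover have "\<lfloor>2 * k\<rfloor> = j" using j by simp
    ultimately have "- \<lfloor>2 * k\<rfloor> + - \<lfloor>2 * (2 - k)\<rfloor> = - 4" by simp
    then have "snd \<gamma> \<tau> powi (- \<lfloor>2 * k\<rfloor>) * snd \<gamma> \<tau> powi (- \<lfloor>2 * (2 - k)\<rfloor>) = snd \<gamma> \<tau> powi (- 4)"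
      using power_int_add[OF disjI1[OF nz], of "- \<lfloor>2 * k\<rfloor>" "- \<lfloor>2 * (2 - k)\<rfloor>"] by simp
    then show ?thesis by (simp add: power_int_minus)
  qed
  finally show ?thesis using nz unfolding xy by simp
qed

lemma pairing_translation:
  assumes "2 * k \<in> \<int>" "\<rho> \<in> hom Mp2Z (unitary_group sc herm)"
    "slash_invariant sc k \<rho> f" "slash_invariant (conj_sc sc) (2 - k) \<rho> G" "\<tau> \<in> \<H>"
  shows "herm (f (\<tau> + 1)) (G (\<tau> + 1)) = herm (f \<tau>) (G \<tau>)"
  using slash_invariant_pairing[OF assms(1-4) translation_mp_carrier[of 1] assms(5)] assms(5)
  by (simp add: snd_translation moebius_translation)

lemma pairing_inversion:
  assumes "2 * k \<in> \<int>" "\<rho> \<in> hom Mp2Z (unitary_group sc herm)"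
    "slash_invariant sc k \<rho> f" "slash_invariant (conj_sc sc) (2 - k) \<rho> G" "\<tau> \<in> \<H>"
  shows "herm (f (- 1 / \<tau>)) (G (- 1 / \<tau>)) = \<tau>\<^sup>2 * herm (f \<tau>) (G \<tau>)"
proof -
  have "\<tau> \<noteq> 0" using assms(5) by (auto simp: upper_half_plane_def)
  moreover have "csqrt \<tau> ^ 4 = \<tau>\<^sup>2"
    using power_mult[of "csqrt \<tau>" 2 2] by simp
  ultimately show ?thesis
    using slash_invariant_pairing[OF assms(1-4) inversion_mp_carrier assms(5)] assms(5)
    by (simp add: snd_inversion moebius_inversion)
qed

lemma pairing_same_weight_translation:
  assumes \<rho>: "\<rho> \<in> hom Mp2Z (unitary_group sc herm)"
    and f: "slash_invariant sc k \<rho> f" and g: "slash_invariant sc k \<rho> g" and t: "\<tau> \<in> \<H>"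
  shows "herm (f (\<tau> + 1)) (g (\<tau> + 1)) = herm (f \<tau>) (g \<tau>)"
proof -
  let ?\<gamma> = "translation_mp 1"
  from \<rho> have "\<rho> ?\<gamma> \<in> carrier (unitary_group sc herm)" using translation_mp_carrier by (auto simp: hom_def)
  then have bij: "bij (\<rho> ?\<gamma>)" and un: "\<And>x y. herm (\<rho> ?\<gamma> x) (\<rho> ?\<gamma> y) = herm x y"
    by (auto simp: unitary_group_def)
  have s: "inv_into UNIV (\<rho> ?\<gamma>) (F (\<tau> + 1)) = F \<tau>" if "slash_invariant sc k \<rho> F" for F
  proof -
    have "slash sc k \<rho> F ?\<gamma> \<tau> = F \<tau>" using that translation_mp_carrier t unfolding slash_invariant_def by blast
    then show ?thesis by (simp add: slash_def snd_translation[OF t] moebius_translation)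
  qed
  show ?thesis
    using un[of "f \<tau>" "g \<tau>"] unfolding s[OF f, symmetric] s[OF g, symmetric]
    by (simp add: bij_is_surj[OF bij] surj_f_inv_f)
qed

end

section \<open>The regularized pairing\<close>

text \<open>Applied with \<open>b = 1 - k\<close>: the last summand of the regularized integral is
  either regular at \<open>0\<close> or, for \<open>b = 0\<close>, equal to \<open>c / s\<close>,
  which contributes nothing to the constant term.\<close>

lemma constant_term_at_0_pole:
  fixes H h :: "complex \<Rightarrow> complex"
  assumes H: "H holomorphic_on UNIV" and h: "\<And>s. h s = H s + c / (b + s)"
  shows "constant_term_at_0 h = H 0 + (if b = 0 then 0 else c / b)"
proof -
  have Ha: "H analytic_on {0}" using H analytic_at by blast
  have E: "constant_term_at_0 F = F 0" if "F analytic_on {0}" for F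
  proof -
    have e: "F has_fps_expansion fps_expansion F 0" by (rule analytic_at_imp_has_fps_expansion_0[OF that])
    have "laurent_expansion F 0 = fps_to_fls (fps_expansion F 0)"
      by (rule laurent_expansion_0_eqI[OF has_laurent_expansion_fps[OF e]])
    then show ?thesis
      using has_fps_expansion_imp_0_eq_fps_nth_0[OF e] by (simp add: constant_term_at_0_def)
  qed
  show ?thesis
  proof (cases "b = 0")
    case False
    have "(\<lambda>s. H s + c / (b + s)) analytic_on {0}"
      by (intro analytic_intros Ha) (use False in auto)
    from E[OF this] False show ?thesis unfolding h[abs_def] by simp
  next
    case True
    have e: "H has_fps_expansion fps_expansion H 0" by (rule analytic_at_imp_has_fps_expansion_0[OF Ha])
    have "(\<lambda>s. H s + c * s powi (- 1)) has_laurent_expansion (fps_to_fls (fps_expansion H 0) + fls_const c * fls_X_intpow (- 1))"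
      by (intro laurent_expansion_intros has_laurent_expansion_fps[OF e])
    also have "(\<lambda>s. H s + c * s powi (- 1)) = h"
      using True by (auto simp: h power_int_minus divide_inverse)
    finally have "laurent_expansion h 0 = fps_to_fls (fps_expansion H 0) + fls_const c * fls_X_intpow (- 1)"
      by (rule laurent_expansion_0_eqI)
    then show ?thesis
      using has_fps_expansion_imp_0_eq_fps_nth_0[OF e] True
      by (simp add: constant_term_at_0_def fls_X_intpow_times_conv_shift)
  qed
qed

lemma rat_support_lower:
  assumes N: "0 < N" and n: "0 < n" "n * of_nat N \<in> \<int>"
  shows "1 / real N \<le> of_rat n"
proof -
  from n(2) obtain j where j: "n * of_nat N = of_int j" by (rule Ints_cases)
  have "0 < n * of_nat N" using n N by simp
  then have "1 \<le> j" using j by simp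
  then have "(1::rat) \<le> n * of_nat N" using j by simp
  then have "real_of_rat 1 \<le> real_of_rat (n * of_nat N)" by (simp only: of_rat_less_eq)
  then have "1 \<le> of_rat n * real N" by (simp add: of_rat_mult)
  then show ?thesis using N by (simp add: field_simps)
qed

lemma expint_tail_tendsto_0:
  assumes "0 < c"
  shows "(expint_tail \<kappa> c \<longlongrightarrow> 0) at_top"
proof (rule tendsto_sandwich)
  \<comment> \<open>Half of \<open>c\<close> provides the exponential decay, the other half a tail
    bounded by its value at \<open>1\<close>.\<close>
  let ?d = "c / 2"
  have d: "0 < ?d" using assms by simp
  show "\<forall>\<^sub>F t in at_top. 0 \<le> expint_tail \<kappa> c t"
    using eventually_ge_at_top[of 1] by eventually_elim (rule expint_tail_nonneg, use assms in auto)
  show "\<forall>\<^sub>F t in at_top. expint_tail \<kappa> c t \<le> exp (- ?d * t) * expint_tail \<kappa> ?d 1"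
    using eventually_ge_at_top[of 1]
  proof eventually_elim
    case (elim t)
    have "expint_tail \<kappa> (?d + ?d) t \<le> exp (- ?d * t) * expint_tail \<kappa> ?d t"
      by (rule expint_tail_decay) (use d elim in auto)
    also have "\<dots> \<le> exp (- ?d * t) * expint_tail \<kappa> ?d 1"
      using d elim by (intro mult_left_mono expint_tail_antimono) auto
    finally show ?case by simp
  qed
  have "((\<lambda>t. exp (- ?d * t)) \<longlongrightarrow> 0) at_top" using d by real_asymp
  then show "((\<lambda>t. exp (- ?d * t) * expint_tail \<kappa> ?d 1) \<longlongrightarrow> 0) at_top" by (rule tendsto_mult_left_zero)
qed simp

lemma infsum_uminus:
  fixes \<phi> :: "rat \<Rightarrow> complex"
  assumes "finite S" "S \<subseteq> B" "\<And>n. n \<in> B - S \<Longrightarrow> \<phi> n = 0"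
  shows "(\<Sum>\<^sub>\<infinity>n\<in>uminus ` B. \<phi> (- n)) = (\<Sum>n\<in>S. \<phi> n)"
proof -
  have "(\<Sum>\<^sub>\<infinity>n\<in>uminus ` B. \<phi> (- n)) = infsum ((\<lambda>n. \<phi> (- n)) \<circ> uminus) B"
    by (rule infsum_reindex) simp
  also have "\<dots> = infsum \<phi> B" by (simp add: o_def)
  also have "\<dots> = (\<Sum>n\<in>S. \<phi> n)"
    by (rule infsumI, rule has_sum_finite_neutralI[OF assms]) auto
  finally show ?thesis .
qed

text \<open>Below height 1 the domain is compact and contributes the entire function
  \<open>L1\<close>. Above it, subtracting the terms with \<open>n \<le> 0\<close> leaves the
  exponentially decaying mean \<open>B\<close>, whose integral \<open>L2\<close> converges for every
  \<open>s\<close>. Powers of \<open>v\<close> are written as exponentials of \<open>ln v\<close>,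
  so that differentiation under the integral applies to both.\<close>

lemma regularized_limit:
  fixes a :: "rat \<Rightarrow> complex" and X :: "complex \<Rightarrow> complex" and w :: complex
  assumes X: "continuous_on \<H> X" and N: "0 < N"
    and fin: "finite {n. n \<le> 0 \<and> a n \<noteq> 0}" and supp: "\<And>n. a n \<noteq> 0 \<Longrightarrow> n * of_nat N \<in> \<int>"
    and mean: "\<And>v. 0 < v \<Longrightarrow> ((\<lambda>n. of_real (exp (- 4 * pi * of_rat n * v)) * a n) has_sum
      integral {- (1 / 2)..1 / 2} (\<lambda>u. X (Complex u v))) UNIV"
  obtains L where "L holomorphic_on UNIV"
    "\<And>s. ((\<lambda>t. integral (fund_dom t) (\<lambda>\<tau>. X \<tau> * exp ((w - s) * of_real (ln (Im \<tau>)))) -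
        (\<Sum>n | n \<le> 0 \<and> a n \<noteq> 0. a n * integral {1..t} (\<lambda>v. exp ((w - s) * of_real (ln v)) * of_real (exp (- 4 * pi * of_rat n * v)))))
      \<longlongrightarrow> L s) at_top"
proof -
  let ?I = "{- (1 / 2)..1 / 2} :: real set"
  define S where "S = {n. n \<le> 0 \<and> a n \<noteq> 0}"
  have fS: "finite S" using fin by (simp add: S_def)
  define A where "A v = integral ?I (\<lambda>u. X (Complex u v))" for v
  define B where "B v = A v - (\<Sum>n\<in>S. of_real (exp (- 4 * pi * of_rat n * v)) * a n)" for v
  have cA: "continuous_on {1..} A"
    unfolding A_def[abs_def] cbox_interval[symmetric]
    by (rule integral_continuous_on_param, unfold split_def, rule continuous_on_compose2[OF X])
      (auto intro!: continuous_intros simp: upper_half_plane_def)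
  have cB: "continuous_on {1..} B"
    unfolding B_def[abs_def] by (intro continuous_intros cA)
  have B: "((\<lambda>n. of_real (exp (- 4 * pi * of_rat n * v)) * a n) has_sum B v) {0<..}" if "0 < v" for v
  proof -
    have "((\<lambda>n. of_real (exp (- 4 * pi * of_rat n * v)) * a n) has_sum (\<Sum>n\<in>S. of_real (exp (- 4 * pi * of_rat n * v)) * a n)) {..0}"
      by (rule has_sum_finite_neutralI[OF fS]) (auto simp: S_def)
    from has_sum_Diff[OF mean[OF that] this]
    have "((\<lambda>n. of_real (exp (- 4 * pi * of_rat n * v)) * a n) has_sum B v) (UNIV - {..0})"
      by (simp add: B_def A_def)
    also have "UNIV - {..0} = {0::rat<..}" by auto
    finally show ?thesis .
  qed
  \<comment> \<open>Positive frequencies in the support of \<open>a\<close> are at least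
    \<open>1 / N\<close>, whence a uniform rate of decay.\<close>
  define \<delta> where "\<delta> = 4 * pi / real N"
  have \<delta>: "\<delta> > 0" using N by (simp add: \<delta>_def)
  have \<delta>n: "\<delta> \<le> 4 * pi * of_rat n" if "0 < n" "a n \<noteq> 0" for n
    using mult_left_mono[OF rat_support_lower[OF N that(1) supp[OF that(2)]], of "4 * pi"] by (simp add: \<delta>_def)
  define M where "M = (\<Sum>\<^sub>\<infinity>n\<in>{0<..}. norm (of_real (exp (- 4 * pi * of_rat n * 1)) * a n))"
  have M: "((\<lambda>n. norm (of_real (exp (- 4 * pi * of_rat n * 1)) * a n)) has_sum M) {0<..}"
    unfolding M_def using B[of 1] by (intro has_sum_infsum summable_on_imp_abs_summable_on) (auto simp: summable_on_def)
  have Bb: "norm (B v) \<le> exp (- \<delta> * (v - 1)) * M" if v: "1 \<le> v" for v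
  proof (rule norm_infsum_le[OF B has_sum_cmult_right[OF M]])
    show "0 < v" using v by simp
    fix n :: rat assume "n \<in> {0<..}"
    then have n: "0 < n" by simp
    show "norm (of_real (exp (- 4 * pi * of_rat n * v)) * a n) \<le> exp (- \<delta> * (v - 1)) * norm (of_real (exp (- 4 * pi * of_rat n * 1)) * a n)"
    proof (cases "a n = 0")
      case False
      have "\<delta> * (v - 1) \<le> 4 * pi * of_rat n * (v - 1)" using \<delta>n[OF n False] v by (intro mult_right_mono) auto
      then have "exp (- 4 * pi * of_rat n * v) \<le> exp (- \<delta> * (v - 1)) * exp (- 4 * pi * of_rat n * 1)"
        by (simp add: mult_exp_exp algebra_simps)
      from mult_right_mono[OF this, of "norm (a n)"] show ?thesis
        unfolding norm_mult norm_of_real abs_exp_cancel by (simp only: norm_ge_zero mult.assoc)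
    qed simp
  qed
  define \<psi> where "\<psi> v = indicator {1..} v *\<^sub>R (exp (w * of_real (ln v)) * B v)" for v :: real
  have [measurable]: "\<psi> \<in> borel_measurable borel"
    unfolding \<psi>_def by (rule borel_measurable_continuous_on_indicator) (auto intro!: continuous_intros cB)
  have \<psi>b: "norm (\<psi> v) * exp (r * \<bar>ln v\<bar>) \<le> \<bar>M\<bar> * exp \<delta> * (indicator {1..} v * (exp (- \<delta> * v) * v powr (Re w + r)))" for v r
  proof (cases "1 \<le> v")
    case True
    have "norm (B v) \<le> exp (- \<delta> * (v - 1)) * \<bar>M\<bar>"
      using order_trans[OF Bb[OF True], of "exp (- \<delta> * (v - 1)) * \<bar>M\<bar>"] by simp
    also have "\<dots> = \<bar>M\<bar> * exp \<delta> * exp (- \<delta> * v)" by (simp add: algebra_simps mult_exp_exp)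
    finally have "v powr Re w * norm (B v) * v powr r \<le> v powr Re w * (\<bar>M\<bar> * exp \<delta> * exp (- \<delta> * v)) * v powr r"
      by (intro mult_right_mono mult_left_mono) auto
    moreover have "norm (exp (w * of_real (ln v))) = v powr Re w" "exp (r * \<bar>ln v\<bar>) = v powr r"
      using True by (simp_all add: powr_def)
    ultimately show ?thesis using True by (simp add: \<psi>_def norm_mult powr_add mult_ac)
  qed (simp add: \<psi>_def)
  have \<psi>i: "integrable lborel (\<lambda>v. norm (\<psi> v) * exp (r * norm (- complex_of_real (ln v))))" for r
  proof (rule Bochner_Integration.integrable_bound)
    show "integrable lborel (\<lambda>v. \<bar>M\<bar> * exp \<delta> * (indicator {1..} v * (exp (- \<delta> * v) * v powr (Re w + r))))"
      using set_integrable_exp_powr[OF \<delta>, of "Re w + r"] by (simp add: set_integrable_def)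
    show "AE v in lborel. norm (norm (\<psi> v) * exp (r * norm (- complex_of_real (ln v)))) \<le>
        norm (\<bar>M\<bar> * exp \<delta> * (indicator {1..} v * (exp (- \<delta> * v) * v powr (Re w + r))))"
      using \<psi>b[of _ r] by (intro AE_I2) (auto simp: abs_mult)
  qed measurable
  define L1 where "L1 s = integral (fund_dom 1) (\<lambda>\<tau>. (X \<tau> * exp (w * of_real (ln (Im \<tau>)))) * exp (s * (- of_real (ln (Im \<tau>)))))" for s
  define L2 where "L2 s = (\<integral>v. \<psi> v * exp (s * (- of_real (ln v))) \<partial>lborel)" for s
  have "L1 holomorphic_on UNIV"
    unfolding L1_def[abs_def]
    by (rule integral_exp_holomorphic[OF compact_fund_dom])
      (auto intro!: continuous_intros continuous_on_subset[OF X fund_dom_subset] dest: Im_fund_dom)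
  moreover have "L2 holomorphic_on UNIV"
    unfolding holomorphic_on_def
  proof
    fix s :: complex
    have "norm s < norm s + 1" by simp
    from has_field_derivative_integral_exp[OF _ _ \<psi>i this]
    show "L2 field_differentiable (at s within UNIV)"
      unfolding L2_def[abs_def] by (auto simp: field_differentiable_def)
  qed
  ultimately have hol: "(\<lambda>s. L1 s + L2 s) holomorphic_on UNIV" by (intro holomorphic_intros)
  have lim: "((\<lambda>t. integral (fund_dom t) (\<lambda>\<tau>. X \<tau> * exp ((w - s) * of_real (ln (Im \<tau>)))) -
        (\<Sum>n\<in>S. a n * integral {1..t} (\<lambda>v. exp ((w - s) * of_real (ln v)) * of_real (exp (- 4 * pi * of_rat n * v)))))
      \<longlongrightarrow> L1 s + L2 s) at_top" for s
  proof -
    let ?p = "\<lambda>v::real. exp ((w - s) * of_real (ln v))"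
    have pe: "exp (w * of_real (ln v)) * exp (s * (- of_real (ln v))) = ?p v" for v
      by (simp add: mult_exp_exp algebra_simps)
    have si: "set_integrable lborel {1..} (\<lambda>v. ?p v * B v)"
    proof -
      have "integrable lborel (\<lambda>v. \<psi> v * exp (s * (- of_real (ln v))))"
      proof (rule Bochner_Integration.integrable_bound[OF \<psi>i[of "norm s"]])
        have "Re (s * (- of_real (ln v))) \<le> norm s * norm (- complex_of_real (ln v))" for v :: real
          by (metis complex_Re_le_cmod norm_mult)
        then show "AE v in lborel. norm (\<psi> v * exp (s * (- of_real (ln v)))) \<le> norm (norm (\<psi> v) * exp (norm s * norm (- complex_of_real (ln v))))"
          by (intro AE_I2) (simp add: norm_mult mult_left_mono)
      qed measurable
      also have "(\<lambda>v. \<psi> v * exp (s * (- of_real (ln v)))) = (\<lambda>v. indicator {1..} v *\<^sub>R (?p v * B v))"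
        unfolding \<psi>_def pe[symmetric] by (auto simp: mult_ac)
      finally show ?thesis by (simp add: set_integrable_def)
    qed
    have L2': "L2 s = set_lebesgue_integral lborel {1..} (\<lambda>v. ?p v * B v)"
      unfolding L2_def set_lebesgue_integral_def \<psi>_def pe[symmetric] by (simp add: mult_ac)
    have "((\<lambda>t. L1 s + set_lebesgue_integral lborel {1..t} (\<lambda>v. ?p v * B v)) \<longlongrightarrow> L1 s + L2 s) at_top"
      unfolding L2' by (intro tendsto_intros tendsto_set_lebesgue_integral_at_top[OF _ si]) auto
    then show ?thesis
    proof (rule Lim_transform_eventually)
      show "\<forall>\<^sub>F t in at_top. L1 s + set_lebesgue_integral lborel {1..t} (\<lambda>v. ?p v * B v) =
          integral (fund_dom t) (\<lambda>\<tau>. X \<tau> * ?p (Im \<tau>)) - (\<Sum>n\<in>S. a n * integral {1..t} (\<lambda>v. ?p v * of_real (exp (- 4 * pi * of_rat n * v))))"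
        using eventually_ge_at_top[of 1]
      proof eventually_elim
        case (elim t)
        have Beq: "(\<lambda>v. ?p v * B v) = (\<lambda>v. ?p v * A v - (\<Sum>n\<in>S. a n * (?p v * of_real (exp (- 4 * pi * of_rat n * v)))))"
          by (auto simp: B_def algebra_simps sum_distrib_left)
        have "set_integrable lborel {1..t} (\<lambda>v. ?p v * B v)"
          by (rule set_integrable_subset[OF si]) auto
        from set_borel_integral_eq_integral(2)[OF this]
        have "set_lebesgue_integral lborel {1..t} (\<lambda>v. ?p v * B v) = integral {1..t} (\<lambda>v. ?p v * B v)" .
        also have "\<dots> = integral {1..t} (\<lambda>v. ?p v * A v) - integral {1..t} (\<lambda>v. \<Sum>n\<in>S. a n * (?p v * of_real (exp (- 4 * pi * of_rat n * v))))"
          unfolding Beq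
          by (intro Henstock_Kurzweil_Integration.integral_diff integrable_continuous_real continuous_intros continuous_on_subset[OF cA]) auto
        also have "integral {1..t} (\<lambda>v. \<Sum>n\<in>S. a n * (?p v * of_real (exp (- 4 * pi * of_rat n * v)))) =
            (\<Sum>n\<in>S. integral {1..t} (\<lambda>v. a n * (?p v * of_real (exp (- 4 * pi * of_rat n * v)))))"
          by (intro Henstock_Kurzweil_Integration.integral_sum fS integrable_continuous_real continuous_intros) auto
        also have "\<dots> = (\<Sum>n\<in>S. a n * integral {1..t} (\<lambda>v. ?p v * of_real (exp (- 4 * pi * of_rat n * v))))"
          by simp
        also have "integral {1..t} (\<lambda>v. ?p v * A v) = integral {1..t} (\<lambda>v. integral ?I (\<lambda>u. X (Complex u v) * ?p v))"
          unfolding A_def by (simp add: mult.commute)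
        finally have eq: "set_lebesgue_integral lborel {1..t} (\<lambda>v. ?p v * B v) =
            integral {1..t} (\<lambda>v. integral ?I (\<lambda>u. X (Complex u v) * ?p v)) -
            (\<Sum>n\<in>S. a n * integral {1..t} (\<lambda>v. ?p v * of_real (exp (- 4 * pi * of_rat n * v))))" .
        have "continuous_on \<H> (\<lambda>\<tau>. X \<tau> * ?p (Im \<tau>))"
          by (intro continuous_intros X) (auto simp: upper_half_plane_def)
        from fund_dom_split[OF this elim]
        have "integral (fund_dom t) (\<lambda>\<tau>. X \<tau> * ?p (Im \<tau>)) = L1 s + integral {1..t} (\<lambda>v. integral ?I (\<lambda>u. X (Complex u v) * ?p v))"
          by (simp only: L1_def mult.assoc pe complex.sel)
        with eq show ?case by simp
      qed
    qed
  qed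
  show thesis by (rule that[OF hol lim[unfolded S_def]])
qed

section \<open>Evaluation of the pairing for fixed forms\<close>

context hermitian_space
begin

context
  fixes \<rho> :: "mp2 \<Rightarrow> 'v \<Rightarrow> 'v" and k :: real and f g G :: "complex \<Rightarrow> 'v" and N :: nat
  assumes k: "2 * k \<in> \<int>" and hom: "\<rho> \<in> hom Mp2Z (unitary_group sc herm)"
    and N: "0 < N" "\<rho> (translation_mp (int N)) = id"
    and f: "f \<in> weakly_holomorphic_forms sc k \<rho>" and g: "g \<in> weakly_holomorphic_forms sc k \<rho>"
    and G: "G \<in> harmonic_maass_forms (conj_sc sc) (2 - k) \<rho>"
    and xi: "\<forall>\<tau>\<in>\<H>. xi sc (2 - k) G \<tau> = g \<tau>"
begin

abbreviation "coeff_f \<equiv> q_coeff sc f"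
abbreviation "coeff_g \<equiv> q_coeff sc g"
abbreviation "coeff_G \<equiv> q_coeff_plus (conj_sc sc) (2 - k) G"

lemma form_expansion:
  assumes "F \<in> weakly_holomorphic_forms sc k \<rho>"
  shows "has_q_expansion sc F (q_coeff sc F)" "q_coeff sc F n \<noteq> 0 \<Longrightarrow> n * of_nat N \<in> \<int>"
proof -
  have F: "holomorphic_into sc F" "slash_invariant sc k \<rho> F" "exp_growth F"
    using assms by (simp_all add: weakly_holomorphic_forms_def)
  obtain c where c: "has_q_expansion sc F c" "\<And>n. c n \<noteq> 0 \<Longrightarrow> n * of_nat N \<in> \<int>"
    using cs.q_expansion_exists[OF F(1,3) N(1) slash_invariant_periodic[OF vector_space_axioms F(2) N(2)]] by blast
  with cs.q_coeff_eqI[OF c(1)]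
  show "has_q_expansion sc F (q_coeff sc F)" "q_coeff sc F n \<noteq> 0 \<Longrightarrow> n * of_nat N \<in> \<int>" by auto
qed

text \<open>Solves \<open>\<xi>(G) = g\<close> for the derivative. The scalar acts through
  \<open>conj_sc\<close>, so \<open>\<i> / 2\<close> enters as \<open>- \<i> / 2\<close> and inverts
  \<open>2 * \<i>\<close>.\<close>

lemma d_taubar_G:
  assumes t: "\<tau> \<in> \<H>"
  shows "d_taubar (conj_sc sc) G \<tau> = conj_sc sc (\<i> / 2 * of_real (Im \<tau> powr (- (2 - k)))) (g \<tau>)"
proof -
  define p where "p = Im \<tau> powr (2 - k)"
  have p: "p \<noteq> 0" using t by (auto simp: p_def upper_half_plane_def)
  have "g \<tau> = sc (2 * \<i> * of_real p) (d_taubar (conj_sc sc) G \<tau>)"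
    using xi t by (simp add: xi_def p_def)
  then have "conj_sc sc (\<i> / 2 * of_real (inverse p)) (g \<tau>) = sc (- \<i> / 2 * of_real (inverse p) * (2 * \<i> * of_real p)) (d_taubar (conj_sc sc) G \<tau>)"
    by (simp add: conj_sc_def)
  also have "- \<i> / 2 * of_real (inverse p) * (2 * \<i> * of_real p) = 1"
    using p by (simp add: field_simps)
  finally show ?thesis by (simp only: scale_one p_def powr_minus)
qed

lemma G_expansion:
  shows "finite {n. n < 0 \<and> coeff_G n \<noteq> 0}"
    and "coeff_G n \<noteq> 0 \<Longrightarrow> n * of_nat N \<in> \<int>"
    and "\<tau> \<in> \<H> \<Longrightarrow> ((\<lambda>n. conj_sc sc (qpow n \<tau>) (coeff_G n) + conj_sc sc (nonhol_term (2 - k) n \<tau>) (coeff_g (- n))) has_sum G \<tau>) UNIV"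
proof -
  have G': "C1_on_H G" "slash_invariant (conj_sc sc) (2 - k) \<rho> G" "exp_growth G"
    using G by (auto simp: harmonic_maass_forms_def C2_on_H_def)
  note e = form_expansion[OF g]
  have fin: "finite {n. n < 0 \<and> coeff_g n \<noteq> 0}" using e(1) by (simp add: has_q_expansion_def)
  have s: "((\<lambda>n. conj_sc sc (cnj (qpow n \<tau>)) (coeff_g n)) has_sum g \<tau>) UNIV" if "\<tau> \<in> \<H>" for \<tau>
    using e(1) that by (simp add: has_q_expansion_def conj_sc_def)
  have per: "G (\<tau> + of_nat N) = G \<tau>" if "\<tau> \<in> \<H>" for \<tau>
    by (rule slash_invariant_periodic[OF vector_space_conj_sc G'(2) N(2) that])
  note hd = cc.harmonic_decomposition[OF N(1) e(2) fin s G'(1,3) per d_taubar_G]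
  show "finite {n. n < 0 \<and> coeff_G n \<noteq> 0}" by (rule hd(1))
  show "coeff_G n \<noteq> 0 \<Longrightarrow> n * of_nat N \<in> \<int>" by (rule hd(2))
  show "\<tau> \<in> \<H> \<Longrightarrow> ((\<lambda>n. conj_sc sc (qpow n \<tau>) (coeff_G n) + conj_sc sc (nonhol_term (2 - k) n \<tau>) (coeff_g (- n))) has_sum G \<tau>) UNIV"
    by (rule hd(3))
qed

lemma f_fourier:
  assumes "0 < v"
  shows "((\<lambda>n. sc (e2pi n u) (sc (of_real (exp (- 2 * pi * of_rat n * v))) (coeff_f n))) has_sum f (Complex u v)) UNIV"
proof -
  have "((\<lambda>n. sc (qpow n (Complex u v)) (coeff_f n)) has_sum f (Complex u v)) UNIV"
    using form_expansion(1)[OF f] assms by (simp add: has_q_expansion_def upper_half_plane_def)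
  then show ?thesis by (simp only: qpow_eq complex.sel scale_scale mult.commute)
qed

lemma exp_rat_cancel: "of_real (exp (- 2 * pi * of_rat n * v)) * (of_real (exp (- 2 * pi * of_rat (- n) * v)) * z) = (z :: complex)"
proof -
  have "exp (- 2 * pi * real_of_rat n * v) * exp (- 2 * pi * of_rat (- n) * v) = 1"
    by (simp add: mult_exp_exp of_rat_minus)
  then show ?thesis unfolding mult.assoc[symmetric] of_real_mult[symmetric] by simp
qed

text \<open>On the line at height \<open>v\<close> the Fourier coefficients carry the factors
  \<open>exp (- 2 * pi * n * v)\<close>. In the pairing the index \<open>n\<close> meets
  \<open>- n\<close>, so these factors cancel, and the holomorphic part of \<open>G\<close>
  contributes a constant independent of \<open>v\<close>.\<close>

lemma mean_f_G:
  assumes v: "0 < v"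
  shows "((\<lambda>n. herm (coeff_f n) (coeff_G (- n)) + of_real (radial (2 - k) (of_rat (- n)) v) * herm (coeff_f n) (coeff_g n))
    has_sum integral {- (1 / 2)..1 / 2} (\<lambda>u. herm (f (Complex u v)) (G (Complex u v)))) UNIV"
proof -
  define E where "E n = complex_of_real (exp (- 2 * pi * of_rat n * v))" for n
  define \<beta> where "\<beta> n = conj_sc sc (E n) (coeff_G n) + conj_sc sc (of_real (radial (2 - k) (of_rat n) v) * E n) (coeff_g (- n))" for n
  have H: "Complex u v \<in> \<H>" for u using v by (simp add: upper_half_plane_def)
  have "((\<lambda>n. herm (sc (E n) (coeff_f n)) (\<beta> (- n))) has_sum
      integral {- (1 / 2)..1 / 2} (\<lambda>u. herm (f (Complex u v)) (G (Complex u v)))) UNIV"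
  proof (rule fourier_pairing[OF _ _ N(1)])
    show "((\<lambda>n. sc (e2pi n u) (sc (E n) (coeff_f n))) has_sum f (Complex u v)) UNIV" for u
      unfolding E_def by (rule f_fourier[OF v])
    have eq: "conj_sc sc (e2pi n u) (\<beta> n) = conj_sc sc (qpow n (Complex u v)) (coeff_G n) + conj_sc sc (nonhol_term (2 - k) n (Complex u v)) (coeff_g (- n))" for n u
      by (simp only: \<beta>_def cc.scale_right_distrib cc.scale_scale nonhol_term_def qpow_eq complex.sel E_def mult.commute mult.left_commute)
    show "((\<lambda>n. conj_sc sc (e2pi n u) (\<beta> n)) has_sum G (Complex u v)) UNIV" for u
      unfolding eq by (rule G_expansion(3)[OF H])
    show "n * of_nat N \<in> \<int>" if "sc (E n) (coeff_f n) \<noteq> 0" for n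
      using that form_expansion(2)[OF f] by auto
    show "n * of_nat N \<in> \<int>" if "\<beta> n \<noteq> 0" for n
    proof -
      from that have "coeff_G n \<noteq> 0 \<or> coeff_g (- n) \<noteq> 0" by (auto simp: \<beta>_def)
      then show ?thesis using G_expansion(2)[of n] form_expansion(2)[OF g, of "- n"] by auto
    qed
    have "slash_invariant sc k \<rho> f" "slash_invariant (conj_sc sc) (2 - k) \<rho> G"
      using f G by (simp_all add: weakly_holomorphic_forms_def harmonic_maass_forms_def)
    from pairing_translation[OF k hom this H]
    show "herm (f (Complex (u + 1) v)) (G (Complex (u + 1) v)) = herm (f (Complex u v)) (G (Complex u v))" for u
      by (simp add: plus_complex.ctr one_complex.ctr)
  qed
  moreover have "herm (sc (E n) (coeff_f n)) (\<beta> (- n)) =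
      herm (coeff_f n) (coeff_G (- n)) + of_real (radial (2 - k) (of_rat (- n)) v) * herm (coeff_f n) (coeff_g n)" for n
  proof -
    have c: "E n * (E (- n) * z) = z" for z unfolding E_def by (rule exp_rat_cancel)
    have "herm (sc (E n) (coeff_f n)) (\<beta> (- n)) =
        E n * (E (- n) * herm (coeff_f n) (coeff_G (- n))) + E n * (E (- n) * (of_real (radial (2 - k) (of_rat (- n)) v) * herm (coeff_f n) (coeff_g n)))"
      by (simp add: \<beta>_def herm_scale_left herm_add_right herm_conj_sc_right ring_distribs mult_ac)
    then show ?thesis unfolding c .
  qed
  ultimately show ?thesis by simp
qed

text \<open>As a function into the conjugate space \<open>g\<close> has its frequencies negated,
  which explains the coefficients at \<open>- n\<close>; here the exponential factors do not cancel
  but square.\<close>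

lemma mean_f_g:
  assumes v: "0 < v"
  shows "((\<lambda>n. of_real (exp (- 4 * pi * of_rat n * v)) * herm (coeff_f n) (coeff_g n))
    has_sum integral {- (1 / 2)..1 / 2} (\<lambda>u. herm (f (Complex u v)) (g (Complex u v)))) UNIV"
proof -
  define E where "E n = complex_of_real (exp (- 2 * pi * of_rat n * v))" for n
  have H: "Complex u v \<in> \<H>" for u using v by (simp add: upper_half_plane_def)
  have "((\<lambda>n. herm (sc (E n) (coeff_f n)) (sc (E (- (- n))) (coeff_g (- (- n))))) has_sum
      integral {- (1 / 2)..1 / 2} (\<lambda>u. herm (f (Complex u v)) (g (Complex u v)))) UNIV"
  proof (rule fourier_pairing[OF _ _ N(1), where \<beta> = "\<lambda>n. sc (E (- n)) (coeff_g (- n))"])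
    show "((\<lambda>n. sc (e2pi n u) (sc (E n) (coeff_f n))) has_sum f (Complex u v)) UNIV" for u
      unfolding E_def by (rule f_fourier[OF v])
    show "((\<lambda>n. conj_sc sc (e2pi n u) (sc (E (- n)) (coeff_g (- n)))) has_sum g (Complex u v)) UNIV" for u
    proof -
      have "((\<lambda>n. sc (qpow n (Complex u v)) (coeff_g n)) has_sum g (Complex u v)) (range uminus)"
        using form_expansion(1)[OF g] H by (simp add: has_q_expansion_def)
      moreover have "inj (uminus :: rat \<Rightarrow> rat)" by simp
      ultimately have "(((\<lambda>n. sc (qpow n (Complex u v)) (coeff_g n)) \<circ> uminus) has_sum g (Complex u v)) UNIV"
        using has_sum_reindex by blast
      moreover have "sc (qpow (- n) (Complex u v)) (coeff_g (- n)) = conj_sc sc (e2pi n u) (sc (E (- n)) (coeff_g (- n)))" for n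
        by (simp add: qpow_eq E_def conj_sc_def cis_cnj of_rat_minus mult.commute)
      ultimately show ?thesis by (simp add: o_def)
    qed
    show "n * of_nat N \<in> \<int>" if "sc (E n) (coeff_f n) \<noteq> 0" for n
      using that form_expansion(2)[OF f] by auto
    show "n * of_nat N \<in> \<int>" if "sc (E (- n)) (coeff_g (- n)) \<noteq> 0" for n
      using that form_expansion(2)[OF g, of "- n"] by auto
    have "slash_invariant sc k \<rho> f" "slash_invariant sc k \<rho> g"
      using f g by (simp_all add: weakly_holomorphic_forms_def)
    from pairing_same_weight_translation[OF hom this H]
    show "herm (f (Complex (u + 1) v)) (g (Complex (u + 1) v)) = herm (f (Complex u v)) (g (Complex u v))" for u
      by (simp add: plus_complex.ctr one_complex.ctr)
  qed
  moreover have "herm (sc (E n) (coeff_f n)) (sc (E n) (coeff_g n)) = of_real (exp (- 4 * pi * of_rat n * v)) * herm (coeff_f n) (coeff_g n)" for n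
  proof -
    have "E n * E n = of_real (exp (- 4 * pi * of_rat n * v))"
      unfolding E_def of_real_mult[symmetric] by (simp add: mult_exp_exp)
    moreover have "cnj (E n) = E n" unfolding E_def by simp
    ultimately show ?thesis by (simp add: herm_scale_left herm_scale_right mult.assoc[symmetric])
  qed
  ultimately show ?thesis by simp
qed

lemma form_continuous:
  assumes "F \<in> weakly_holomorphic_forms sc k \<rho>"
  shows "continuous_on \<H> F"
proof (rule continuous_at_imp_continuous_on, rule ballI)
  fix \<tau> assume "\<tau> \<in> \<H>"
  then obtain d where "(F has_derivative (\<lambda>h. sc h d)) (at \<tau>)"
    using assms by (auto simp: weakly_holomorphic_forms_def holomorphic_into_def)
  then show "isCont F \<tau>" by (rule has_derivative_continuous)
qed

lemma stokes_f_G: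
  assumes t: "1 \<le> t"
  shows "integral (fund_dom t) (\<lambda>\<tau>. herm (f \<tau>) (g \<tau>) * of_real (Im \<tau> powr (- (2 - k)))) =
    integral {- (1 / 2)..1 / 2} (\<lambda>u. herm (f (Complex u t)) (G (Complex u t)))"
proof -
  have hol: "holomorphic_into sc f" "slash_invariant sc k \<rho> f" using f by (simp_all add: weakly_holomorphic_forms_def)
  have G': "C1_on_H G" "slash_invariant (conj_sc sc) (2 - k) \<rho> G"
    using G by (auto simp: harmonic_maass_forms_def C2_on_H_def)
  obtain f' where f': "continuous_on \<H> f'" "\<And>\<tau>. \<tau> \<in> \<H> \<Longrightarrow> (f has_derivative (\<lambda>h. sc h (f' \<tau>))) (at \<tau>)"
    using cs.holomorphic_into_derivative[OF hol(1)] by blast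
  \<comment> \<open>The partial derivatives of the pairing of \<open>f\<close> and \<open>G\<close>.
    The factor \<open>\<i>\<close> in \<open>hv\<close> expresses that \<open>f\<close> is
    holomorphic, and it makes \<open>f'\<close> drop out of \<open>hv - \<i> * hu\<close>.\<close>
  define hu where "hu \<tau> = herm (f' \<tau>) (G \<tau>) + herm (f \<tau>) (d_u G \<tau>)" for \<tau>
  define hv where "hv \<tau> = \<i> * herm (f' \<tau>) (G \<tau>) + herm (f \<tau>) (d_v G \<tau>)" for \<tau>
  have cG: "continuous_on \<H> G"
    by (meson C1_on_H_has_derivative[OF G'(1)] continuous_at_imp_continuous_on has_derivative_continuous)
  have cd: "continuous_on \<H> (d_u G)" "continuous_on \<H> (d_v G)" using G'(1) by (simp_all add: C1_on_H_def)
  have "integral (fund_dom t) (\<lambda>\<tau>. hv \<tau> - \<i> * hu \<tau>) = integral {- (1 / 2)..1 / 2} (\<lambda>u. herm (f (Complex u t)) (G (Complex u t)))"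
  proof (rule fund_dom_stokes[OF _ _ _ _ _ t, where h = "\<lambda>\<tau>. herm (f \<tau>) (G \<tau>)"])
    fix \<tau> assume H: "\<tau> \<in> \<H>"
    from bh.FDERIV[OF f'(2)[OF H] C1_on_H_has_derivative[OF G'(1) H]]
    show "((\<lambda>\<tau>. herm (f \<tau>) (G \<tau>)) has_derivative (\<lambda>z. Re z *\<^sub>R hu \<tau> + Im z *\<^sub>R hv \<tau>)) (at \<tau>)"
    proof (rule has_derivative_eq_rhs, intro ext)
      fix z
      have "herm (f \<tau>) (Re z *\<^sub>R d_u G \<tau> + Im z *\<^sub>R d_v G \<tau>) + herm (sc z (f' \<tau>)) (G \<tau>) =
          Re z *\<^sub>R herm (f \<tau>) (d_u G \<tau>) + Im z *\<^sub>R herm (f \<tau>) (d_v G \<tau>) + (of_real (Re z) + \<i> * of_real (Im z)) * herm (f' \<tau>) (G \<tau>)"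
        by (simp add: bh.add_right bh.scaleR_right herm_scale_left complex_eq[symmetric])
      then show "herm (f \<tau>) (Re z *\<^sub>R d_u G \<tau> + Im z *\<^sub>R d_v G \<tau>) + herm (sc z (f' \<tau>)) (G \<tau>) = Re z *\<^sub>R hu \<tau> + Im z *\<^sub>R hv \<tau>"
        by (simp add: hu_def hv_def scaleR_conv_of_real algebra_simps)
    qed
    show "herm (f (\<tau> + 1)) (G (\<tau> + 1)) = herm (f \<tau>) (G \<tau>)"
      by (rule pairing_translation[OF k hom hol(2) G'(2) H])
    show "herm (f (- 1 / \<tau>)) (G (- 1 / \<tau>)) = \<tau>\<^sup>2 * herm (f \<tau>) (G \<tau>)"
      by (rule pairing_inversion[OF k hom hol(2) G'(2) H])
  next
    show "continuous_on \<H> hu" "continuous_on \<H> hv"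
      unfolding hu_def hv_def by (intro continuous_intros bh.continuous_on form_continuous[OF f] f'(1) cG cd)+
  qed
  moreover have "hv \<tau> - \<i> * hu \<tau> = herm (f \<tau>) (g \<tau>) * of_real (Im \<tau> powr (- (2 - k)))" if "\<tau> \<in> fund_dom t" for \<tau>
  proof -
    have H: "\<tau> \<in> \<H>" using that fund_dom_subset by blast
    have "hv \<tau> - \<i> * hu \<tau> = herm (f \<tau>) (d_v G \<tau>) - \<i> * herm (f \<tau>) (d_u G \<tau>)"
      by (simp add: hu_def hv_def algebra_simps)
    also have "\<dots> = - 2 * \<i> * herm (f \<tau>) (d_taubar (conj_sc sc) G \<tau>)"
      by (simp add: d_taubar_def bh.add_right bh.scaleR_right herm_conj_sc_right scaleR_conv_of_real algebra_simps)
    also have "\<dots> = herm (f \<tau>) (g \<tau>) * of_real (Im \<tau> powr (- (2 - k)))"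
      unfolding d_taubar_G[OF H] herm_conj_sc_right by (simp add: algebra_simps)
    finally show ?thesis .
  qed
  then have "integral (fund_dom t) (\<lambda>\<tau>. hv \<tau> - \<i> * hu \<tau>) = integral (fund_dom t) (\<lambda>\<tau>. herm (f \<tau>) (g \<tau>) * of_real (Im \<tau> powr (- (2 - k))))"
    by (rule Henstock_Kurzweil_Integration.integral_cong)
  ultimately show ?thesis by simp
qed

text \<open>A nonzero term with \<open>n < 0\<close> needs a polar coefficient of \<open>f\<close>,
  one with \<open>n > 0\<close> a polar coefficient of \<open>G\<close>; both sets are
  finite.\<close>

lemma finite_coeff_pairing:
  "finite {n. herm (coeff_f n) (coeff_G (- n)) \<noteq> 0}" "finite {n. n \<le> 0 \<and> herm (coeff_f n) (coeff_g n) \<noteq> 0}"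
proof -
  have f0: "finite {n. n < 0 \<and> coeff_f n \<noteq> 0}"
    using form_expansion(1)[OF f] by (simp add: has_q_expansion_def)
  have "{n. herm (coeff_f n) (coeff_G (- n)) \<noteq> 0} \<subseteq>
      {n. n < 0 \<and> coeff_f n \<noteq> 0} \<union> {0} \<union> uminus ` {n. n < 0 \<and> coeff_G n \<noteq> 0}"
  proof
    fix n assume "n \<in> {n. herm (coeff_f n) (coeff_G (- n)) \<noteq> 0}"
    then have nz: "coeff_f n \<noteq> 0" "coeff_G (- n) \<noteq> 0" by (auto simp: bh.zero_left bh.zero_right)
    consider "n < 0" | "n = 0" | "- n < 0" by linarith
    then show "n \<in> {n. n < 0 \<and> coeff_f n \<noteq> 0} \<union> {0} \<union> uminus ` {n. n < 0 \<and> coeff_G n \<noteq> 0}"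
    proof cases
      case 3
      with nz have "- (- n) \<in> uminus ` {n. n < 0 \<and> coeff_G n \<noteq> 0}" by (intro imageI) simp
      then show ?thesis by simp
    qed (use nz in auto)
  qed
  then show "finite {n. herm (coeff_f n) (coeff_G (- n)) \<noteq> 0}"
    by (rule finite_subset) (use f0 G_expansion(1) in auto)
  have "{n. n \<le> 0 \<and> herm (coeff_f n) (coeff_g n) \<noteq> 0} \<subseteq> insert 0 {n. n < 0 \<and> coeff_f n \<noteq> 0}"
    by (auto simp: bh.zero_left)
  then show "finite {n. n \<le> 0 \<and> herm (coeff_f n) (coeff_g n) \<noteq> 0}"
    by (rule finite_subset) (use f0 in auto)
qed

text \<open>For \<open>n > 0\<close> in the support, the radial factor at height \<open>t\<close> is
  at most the tail at \<open>\<delta>\<close> times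
  \<open>exp \<delta> * exp (- 4 * pi * n)\<close>. Absolute convergence of the mean of
  \<open>f\<close> and \<open>g\<close> at height 1 then bounds the sum of these terms by a multiple
  of a function tending to \<open>0\<close>.\<close>

lemma mean_f_G_limit:
  defines "a \<equiv> \<lambda>n. herm (coeff_f n) (coeff_g n)" and "S \<equiv> {n. n \<le> 0 \<and> herm (coeff_f n) (coeff_g n) \<noteq> 0}"
  shows "((\<lambda>t. integral {- (1 / 2)..1 / 2} (\<lambda>u. herm (f (Complex u t)) (G (Complex u t))) -
      (\<Sum>n\<in>S. a n * of_real (radial (2 - k) (of_rat (- n)) t))) \<longlongrightarrow>
    (\<Sum>n | herm (coeff_f n) (coeff_G (- n)) \<noteq> 0. herm (coeff_f n) (coeff_G (- n)))) at_top"
proof -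
  define p where "p n = herm (coeff_f n) (coeff_G (- n))" for n
  define P where "P = (\<Sum>n | p n \<noteq> 0. p n)"
  define I where "I t = integral {- (1 / 2)..1 / 2} (\<lambda>u. herm (f (Complex u t)) (G (Complex u t)))" for t
  define R where "R t = I t - (\<Sum>n\<in>S. a n * of_real (radial (2 - k) (of_rat (- n)) t))" for t
  have fS: "finite S" using finite_coeff_pairing(2) by (simp add: S_def)
  have fP: "finite {n. p n \<noteq> 0}" using finite_coeff_pairing(1) by (simp add: p_def)
  have supp: "n * of_nat N \<in> \<int>" if "a n \<noteq> 0" for n
  proof (rule form_expansion(2)[OF f])
    show "coeff_f n \<noteq> 0" using that by (auto simp: a_def bh.zero_left)
  qed
  define \<delta> where "\<delta> = 4 * pi / real N"
  have \<delta>: "\<delta> > 0" using N by (simp add: \<delta>_def)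
  have \<delta>n: "\<delta> \<le> 4 * pi * of_rat n" if "0 < n" "a n \<noteq> 0" for n
    using mult_left_mono[OF rat_support_lower[OF N(1) that(1) supp[OF that(2)]], of "4 * pi"] by (simp add: \<delta>_def)
  have hp: "(p has_sum P) UNIV"
    unfolding P_def by (rule has_sum_finite_neutralI[OF fP]) auto
  have hR: "((\<lambda>n. of_real (radial (2 - k) (of_rat (- n)) t) * a n) has_sum (R t - P)) {0<..}" if t: "0 < t" for t
  proof -
    have "((\<lambda>n. (p n + of_real (radial (2 - k) (of_rat (- n)) t) * a n) + - p n) has_sum I t + - P) UNIV"
      unfolding p_def a_def I_def
      by (intro has_sum_add mean_f_G[OF t]) (use hp in \<open>simp add: has_sum_uminus p_def[abs_def]\<close>)
    then have 1: "((\<lambda>n. of_real (radial (2 - k) (of_rat (- n)) t) * a n) has_sum I t - P) UNIV" by simp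
    have "((\<lambda>n. of_real (radial (2 - k) (of_rat (- n)) t) * a n) has_sum (\<Sum>n\<in>S. of_real (radial (2 - k) (of_rat (- n)) t) * a n)) {..0}"
      by (rule has_sum_finite_neutralI[OF fS]) (auto simp: S_def a_def)
    from has_sum_Diff[OF 1 this]
    have "((\<lambda>n. of_real (radial (2 - k) (of_rat (- n)) t) * a n) has_sum (R t - P)) (UNIV - {..0})"
      by (simp add: R_def mult.commute algebra_simps)
    also have "UNIV - {..0} = {0::rat<..}" by auto
    finally show ?thesis .
  qed
  define M where "M = (\<Sum>\<^sub>\<infinity>n\<in>{0<..}. norm (of_real (exp (- 4 * pi * of_rat n * 1)) * a n))"
  have M: "((\<lambda>n. norm (of_real (exp (- 4 * pi * of_rat n * 1)) * a n)) has_sum M) {0<..}"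
    unfolding M_def
  proof (rule has_sum_infsum, rule summable_on_imp_abs_summable_on)
    have "(\<lambda>n. of_real (exp (- 4 * pi * of_rat n * 1)) * a n) summable_on UNIV"
      using mean_f_g[of 1] unfolding a_def summable_on_def by auto
    then show "(\<lambda>n. of_real (exp (- 4 * pi * of_rat n * 1)) * a n) summable_on {0<..}"
      by (rule summable_on_subset_banach) simp
  qed
  have Rb: "norm (R t - P) \<le> expint_tail (2 - k) \<delta> t * exp \<delta> * M" if t: "1 \<le> t" for t
  proof (rule norm_infsum_le[OF hR has_sum_cmult_right[OF M]])
    show "0 < t" using t by simp
    fix n :: rat assume "n \<in> {0<..}"
    then have n: "0 < n" by simp
    let ?c = "4 * pi * real_of_rat n"
    show "norm (of_real (radial (2 - k) (of_rat (- n)) t) * a n) \<le>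
        expint_tail (2 - k) \<delta> t * exp \<delta> * norm (of_real (exp (- 4 * pi * of_rat n * 1)) * a n)"
    proof (cases "a n = 0")
      case False
      have c: "\<delta> \<le> ?c" by (rule \<delta>n[OF n False])
      have t0: "0 \<le> expint_tail (2 - k) \<delta> t" "0 \<le> expint_tail (2 - k) ?c t"
        using \<delta> t c by (auto intro!: expint_tail_nonneg)
      have "\<bar>radial (2 - k) (of_rat (- n)) t\<bar> = expint_tail (2 - k) ?c t"
        using n t0 by (simp add: radial_def of_rat_minus)
      also have "\<dots> \<le> exp (- (?c - \<delta>) * t) * expint_tail (2 - k) \<delta> t"
        using expint_tail_decay[of \<delta> t "?c - \<delta>" "2 - k"] \<delta> t c by simp
      also have "\<dots> \<le> exp (- (?c - \<delta>) * 1) * expint_tail (2 - k) \<delta> t"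
      proof -
        have "(?c - \<delta>) * 1 \<le> (?c - \<delta>) * t" using c t by (intro mult_left_mono) auto
        then have "- (?c - \<delta>) * t \<le> - (?c - \<delta>) * 1"
          by (simp only: minus_mult_left[symmetric] neg_le_iff_le)
        then have "exp (- (?c - \<delta>) * t) \<le> exp (- (?c - \<delta>) * 1)" by (simp only: exp_le_cancel_iff)
        then show ?thesis using t0(1) by (rule mult_right_mono)
      qed
      also have "\<dots> = expint_tail (2 - k) \<delta> t * exp \<delta> * exp (- 4 * pi * of_rat n * 1)"
      proof -
        have "- (?c - \<delta>) * 1 = \<delta> + (- 4 * pi * of_rat n * 1)" by simp
        then have "exp (- (?c - \<delta>) * 1) = exp \<delta> * exp (- 4 * pi * of_rat n * 1)" by (simp only: exp_add)
        then show ?thesis by (simp only: mult_ac)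
      qed
      finally have "\<bar>radial (2 - k) (of_rat (- n)) t\<bar> * norm (a n) \<le>
          expint_tail (2 - k) \<delta> t * exp \<delta> * exp (- 4 * pi * of_rat n * 1) * norm (a n)"
        by (intro mult_right_mono) auto
      then show ?thesis
        unfolding norm_mult norm_of_real abs_exp_cancel by (simp only: mult.assoc)
    qed simp
  qed
  have "((\<lambda>t. R t - P) \<longlongrightarrow> 0) at_top"
  proof (rule Lim_null_comparison)
    show "\<forall>\<^sub>F t in at_top. norm (R t - P) \<le> expint_tail (2 - k) \<delta> t * exp \<delta> * M"
      using eventually_ge_at_top[of 1] by eventually_elim (rule Rb)
    show "((\<lambda>t. expint_tail (2 - k) \<delta> t * exp \<delta> * M) \<longlongrightarrow> 0) at_top"
      by (intro tendsto_mult_left_zero expint_tail_tendsto_0 \<delta>)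
  qed
  then have "(R \<longlongrightarrow> P) at_top" by (simp add: LIM_zero_iff)
  then show ?thesis by (simp add: R_def[abs_def] I_def P_def p_def)
qed

lemma pairing_formula:
  assumes \<phi>: "\<phi> \<in> {pi / 2 <..< 3 * pi / 2} - {pi}"
  shows "reg_pairing sc herm k \<phi> f g = (\<Sum>n | herm (coeff_f n) (coeff_G (- n)) \<noteq> 0. herm (coeff_f n) (coeff_G (- n)))"
proof -
  define a where "a n = herm (coeff_f n) (coeff_g n)" for n
  define S where "S = {n. n \<le> 0 \<and> a n \<noteq> 0}"
  define S1 where "S1 = {n. n < 0 \<and> a n \<noteq> 0}"
  define P where "P = (\<Sum>n | herm (coeff_f n) (coeff_G (- n)) \<noteq> 0. herm (coeff_f n) (coeff_G (- n)))"
  define X where "X \<tau> = herm (f \<tau>) (g \<tau>)" for \<tau>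
  define w where "w = complex_of_real k - 2"
  have w: "w = of_real (- (2 - k))" by (simp add: w_def)
  have fS: "finite S" using finite_coeff_pairing(2) by (simp add: S_def a_def)
  have fS1: "finite S1" by (rule finite_subset[OF _ fS]) (auto simp: S_def S1_def)
  have sumS: "(\<Sum>n\<in>S. a n * Y n) = a 0 * Y 0 + (\<Sum>n\<in>S1. a n * Y n)" for Y :: "rat \<Rightarrow> complex"
  proof -
    have "(\<Sum>n\<in>S. a n * Y n) = (\<Sum>n\<in>insert 0 S1. a n * Y n)"
      by (rule sum.mono_neutral_left) (use fS1 in \<open>auto simp: S_def S1_def\<close>)
    also have "\<dots> = a 0 * Y 0 + (\<Sum>n\<in>S1. a n * Y n)"
      by (rule sum.insert[OF fS1]) (simp add: S1_def)
    finally show ?thesis .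
  qed
  have cX: "continuous_on \<H> X"
    unfolding X_def by (intro bh.continuous_on form_continuous f g)
  have supp: "n * of_nat N \<in> \<int>" if "a n \<noteq> 0" for n
  proof (rule form_expansion(2)[OF f])
    show "coeff_f n \<noteq> 0" using that by (auto simp: a_def bh.zero_left)
  qed
  obtain L where L: "L holomorphic_on UNIV"
    "\<And>s. ((\<lambda>t. integral (fund_dom t) (\<lambda>\<tau>. X \<tau> * exp ((w - s) * of_real (ln (Im \<tau>)))) -
        (\<Sum>n\<in>S. a n * integral {1..t} (\<lambda>v. exp ((w - s) * of_real (ln v)) * of_real (exp (- 4 * pi * of_rat n * v)))))
      \<longlongrightarrow> L s) at_top"
  proof (rule regularized_limit[of X N a w])
    show "continuous_on \<H> X" by (rule cX)
    show "0 < N" by (rule N)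
    show "finite {n. n \<le> 0 \<and> a n \<noteq> 0}" using fS by (simp add: S_def)
    show "((\<lambda>n. of_real (exp (- 4 * pi * of_rat n * v)) * a n) has_sum integral {- (1 / 2)..1 / 2} (\<lambda>u. X (Complex u v))) UNIV"
      if "0 < v" for v
      unfolding a_def X_def by (rule mean_f_g[OF that])
  qed (use supp in \<open>auto simp: S_def\<close>)
  have lnexp: "exp (complex_of_real (ln v)) = of_real v" if "0 < v" for v
    using that by (subst exp_of_real) simp
  have pw: "complex_of_real v powr z = exp (z * of_real (ln v))" if "0 < v" for v z
    using that by (simp add: powr_def Ln_of_real)

  \<comment> \<open>At \<open>s = 0\<close> the integrand is the one of Stokes' theorem, and the
    subtracted integrals are differences of \<open>radial\<close> between \<open>1\<close> and
    \<open>t\<close>; uniqueness of limits identifies \<open>L 0\<close>.\<close>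
  have L0: "L 0 = P + (\<Sum>n\<in>S. a n * of_real (radial (2 - k) (of_rat (- n)) 1))"
  proof -
    let ?r = "\<lambda>n t. complex_of_real (radial (2 - k) (of_rat (- n)) t)"
    have "((\<lambda>t. (integral {- (1 / 2)..1 / 2} (\<lambda>u. herm (f (Complex u t)) (G (Complex u t))) - (\<Sum>n\<in>S. a n * ?r n t)) +
        (\<Sum>n\<in>S. a n * ?r n 1)) \<longlongrightarrow> P + (\<Sum>n\<in>S. a n * ?r n 1)) at_top"
      unfolding P_def S_def a_def by (intro tendsto_add tendsto_const mean_f_G_limit)
    moreover have "\<forall>\<^sub>F t in at_top. (integral {- (1 / 2)..1 / 2} (\<lambda>u. herm (f (Complex u t)) (G (Complex u t))) - (\<Sum>n\<in>S. a n * ?r n t)) +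
        (\<Sum>n\<in>S. a n * ?r n 1) = integral (fund_dom t) (\<lambda>\<tau>. X \<tau> * exp ((w - 0) * of_real (ln (Im \<tau>)))) -
        (\<Sum>n\<in>S. a n * integral {1..t} (\<lambda>v. exp ((w - 0) * of_real (ln v)) * of_real (exp (- 4 * pi * of_rat n * v))))"
      using eventually_ge_at_top[of 1]
    proof eventually_elim
      case (elim t)
      have e: "exp ((w - 0) * of_real (ln v)) = of_real (v powr (- (2 - k)))" if "0 < v" for v
        using that by (simp add: w powr_def flip: exp_of_real)
      have "integral (fund_dom t) (\<lambda>\<tau>. X \<tau> * exp ((w - 0) * of_real (ln (Im \<tau>)))) =
          integral (fund_dom t) (\<lambda>\<tau>. herm (f \<tau>) (g \<tau>) * of_real (Im \<tau> powr (- (2 - k))))"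
      proof (rule Henstock_Kurzweil_Integration.integral_cong)
        fix \<tau> assume "\<tau> \<in> fund_dom t"
        then have "0 < Im \<tau>" using Im_fund_dom[of \<tau> t] by simp
        from e[OF this] show "X \<tau> * exp ((w - 0) * of_real (ln (Im \<tau>))) = herm (f \<tau>) (g \<tau>) * of_real (Im \<tau> powr (- (2 - k)))"
          by (simp only: X_def)
      qed
      also have "\<dots> = integral {- (1 / 2)..1 / 2} (\<lambda>u. herm (f (Complex u t)) (G (Complex u t)))"
        by (rule stokes_f_G[OF elim])
      finally have 1: "integral (fund_dom t) (\<lambda>\<tau>. X \<tau> * exp ((w - 0) * of_real (ln (Im \<tau>)))) =
        integral {- (1 / 2)..1 / 2} (\<lambda>u. herm (f (Complex u t)) (G (Complex u t)))" .
      have 2: "integral {1..t} (\<lambda>v. exp ((w - 0) * of_real (ln v)) * of_real (exp (- 4 * pi * of_rat n * v))) = ?r n t - ?r n 1" for n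
      proof (rule integral_unique)
        have "((\<lambda>v. complex_of_real (v powr (- (2 - k)) * exp (4 * pi * of_rat (- n) * v))) has_integral ?r n t - ?r n 1) {1..t}"
        proof (rule fundamental_theorem_of_calculus[OF elim])
          fix v assume v: "v \<in> {1..t}"
          then have "(radial (2 - k) (of_rat (- n)) has_real_derivative v powr (- (2 - k)) * exp (4 * pi * of_rat (- n) * v)) (at v)"
            by (intro has_real_derivative_radial) auto
          then have "(radial (2 - k) (of_rat (- n)) has_vector_derivative v powr (- (2 - k)) * exp (4 * pi * of_rat (- n) * v)) (at v within {1..t})"
            unfolding has_real_derivative_iff_has_vector_derivative by (rule has_vector_derivative_at_within)
          from bounded_linear.has_vector_derivative[OF bounded_linear_of_real this]
          show "((\<lambda>v. ?r n v) has_vector_derivative complex_of_real (v powr (- (2 - k)) * exp (4 * pi * of_rat (- n) * v))) (at v within {1..t})" .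
        qed
        then show "((\<lambda>v. exp ((w - 0) * of_real (ln v)) * of_real (exp (- 4 * pi * of_rat n * v))) has_integral ?r n t - ?r n 1) {1..t}"
        proof (rule has_integral_eq[rotated])
          fix v assume "v \<in> {1..t}"
          then have "0 < v" by simp
          from e[OF this] show "complex_of_real (v powr (- (2 - k)) * exp (4 * pi * of_rat (- n) * v)) = exp ((w - 0) * of_real (ln v)) * of_real (exp (- 4 * pi * of_rat n * v))"
            by (simp add: of_rat_minus)
        qed
      qed
      show ?case unfolding 1 2 by (simp add: right_diff_distrib sum_subtractf)
    qed
    ultimately have "((\<lambda>t. integral (fund_dom t) (\<lambda>\<tau>. X \<tau> * exp ((w - 0) * of_real (ln (Im \<tau>)))) -
        (\<Sum>n\<in>S. a n * integral {1..t} (\<lambda>v. exp ((w - 0) * of_real (ln v)) * of_real (exp (- 4 * pi * of_rat n * v))))) \<longlongrightarrow>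
        P + (\<Sum>n\<in>S. a n * ?r n 1)) at_top"
      by (rule Lim_transform_eventually)
    from tendsto_unique[OF _ L(2)[of 0] this] show ?thesis by simp
  qed

  \<comment> \<open>Here \<open>n\<close> is the index of the coefficient, the negative of the
    summation index in \<open>reg_integral\<close>, so \<open>c n\<close> is negative on
    \<open>S1\<close>; the double minus matches the form in \<open>radial\<close>.\<close>
  define c where "c n = - 4 * pi * real_of_rat (- n)" for n
  define E where "E s n = expint_ext (2 - of_real k + s) \<phi> (of_real (c n))" for s n
  have c: "c n \<noteq> 0" if "n \<in> S1" for n using that by (simp add: c_def S1_def of_rat_minus)
  have cut: "complex_of_real (c n) \<in> cut_plane \<phi>" if "n \<in> S1" for n
    by (rule real_in_cut_plane[OF \<phi> c[OF that]])
  have \<phi>': "\<phi> \<in> {pi / 2 <..< 3 * pi / 2}" using \<phi> by blast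
  have cont: "expint_cont r \<phi> (of_real (c n)) = expint_ext r \<phi> (of_real (c n))" if "n \<in> S1" for r n
    by (rule expint_cont_eq_ext[OF \<phi>' cut[OF that]])
  have neg: "{0..} = uminus ` {..0::rat}" "{0<..} = uminus ` {..<0::rat}"
    by (auto simp: image_iff intro: bexI[of _ "- _"])

  have reg: "reg_integral sc herm k \<phi> f g s = (L s + (\<Sum>n\<in>S1. a n * E s n)) + a 0 / ((1 - of_real k) + s)" for s
  proof -
    have "(\<Sum>\<^sub>\<infinity>n\<in>{0..}. a (- n) * integral {1..t} (\<lambda>v. of_real v powr (of_real k - 2 - s) * of_real (exp (4 * pi * of_rat n * v)))) =
        (\<Sum>n\<in>S. a n * integral {1..t} (\<lambda>v. exp ((w - s) * of_real (ln v)) * of_real (exp (- 4 * pi * of_rat n * v))))" for t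
    proof -
      let ?J = "\<lambda>n. integral {1..t} (\<lambda>v. complex_of_real v powr (of_real k - 2 - s) * of_real (exp (4 * pi * of_rat (- n) * v)))"
      have "(\<Sum>\<^sub>\<infinity>n\<in>uminus ` {..0}. a (- n) * ?J (- n)) = (\<Sum>n\<in>S. a n * ?J n)"
        by (rule infsum_uminus[OF fS]) (auto simp: S_def)
      moreover have "?J n = integral {1..t} (\<lambda>v. exp ((w - s) * of_real (ln v)) * of_real (exp (- 4 * pi * of_rat n * v)))" for n
        by (rule Henstock_Kurzweil_Integration.integral_cong) (simp add: pw w_def of_rat_minus)
      ultimately show ?thesis unfolding neg by simp
    qed
    moreover have "integral (fund_dom t) (\<lambda>\<tau>. herm (f \<tau>) (g \<tau>) * of_real (Im \<tau>) powr (of_real k - s) / of_real ((Im \<tau>)\<^sup>2)) =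
        integral (fund_dom t) (\<lambda>\<tau>. X \<tau> * exp ((w - s) * of_real (ln (Im \<tau>))))" for t
    proof (rule Henstock_Kurzweil_Integration.integral_cong)
      fix \<tau> assume "\<tau> \<in> fund_dom t"
      then have v: "0 < Im \<tau>" using Im_fund_dom[of \<tau> t] by simp
      let ?l = "complex_of_real (ln (Im \<tau>))"
      have "exp ((w - s) * ?l) = exp ((of_real k - s) * ?l - (?l + ?l))" by (simp add: w_def algebra_simps)
      also have "\<dots> = exp ((of_real k - s) * ?l) / (exp ?l * exp ?l)" by (simp only: exp_diff exp_add)
      also have "\<dots> = of_real (Im \<tau>) powr (of_real k - s) / of_real ((Im \<tau>)\<^sup>2)"
        unfolding lnexp[OF v] pw[OF v] by (simp add: power2_eq_square)
      finally show "herm (f \<tau>) (g \<tau>) * of_real (Im \<tau>) powr (of_real k - s) / of_real ((Im \<tau>)\<^sup>2) = X \<tau> * exp ((w - s) * ?l)"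
        by (simp add: X_def)
    qed
    moreover have "(\<Sum>\<^sub>\<infinity>n\<in>{0<..}. a (- n) * expint_cont (2 - of_real k + s) \<phi> (of_real (- 4 * pi * of_rat n))) = (\<Sum>n\<in>S1. a n * E s n)"
    proof -
      have "(\<Sum>\<^sub>\<infinity>n\<in>uminus ` {..<0}. a (- n) * expint_cont (2 - of_real k + s) \<phi> (of_real (c (- n)))) =
          (\<Sum>n\<in>S1. a n * expint_cont (2 - of_real k + s) \<phi> (of_real (c n)))"
        by (rule infsum_uminus[OF fS1]) (auto simp: S1_def)
      also have "\<dots> = (\<Sum>n\<in>S1. a n * E s n)" by (intro sum.cong refl) (simp add: cont E_def)
      finally show ?thesis unfolding neg by (simp add: c_def)
    qed
    moreover have "Lim at_top (\<lambda>t. integral (fund_dom t) (\<lambda>\<tau>. X \<tau> * exp ((w - s) * of_real (ln (Im \<tau>)))) -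
        (\<Sum>n\<in>S. a n * integral {1..t} (\<lambda>v. exp ((w - s) * of_real (ln v)) * of_real (exp (- 4 * pi * of_rat n * v))))) = L s"
      by (rule tendsto_Lim[OF _ L(2)]) simp
    ultimately show ?thesis
      unfolding reg_integral_def Let_def a_def[symmetric] by simp
  qed
  have holE: "(\<lambda>s. \<Sum>n\<in>S1. a n * E s n) holomorphic_on UNIV"
  proof -
    have "(\<lambda>s. E s n) holomorphic_on UNIV" if "n \<in> S1" for n
    proof -
      have "((\<lambda>r. expint_ext r \<phi> (of_real (c n))) \<circ> (\<lambda>s. 2 - of_real k + s)) holomorphic_on UNIV"
        by (rule holomorphic_on_compose_gen[OF _ expint_ext_holomorphic_in_order[OF \<phi>' cut[OF that]]])
          (auto intro!: holomorphic_intros)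
      then show ?thesis by (simp add: E_def o_def)
    qed
    then show ?thesis by (intro holomorphic_intros)
  qed
  have CT: "constant_term_at_0 (reg_integral sc herm k \<phi> f g) = (L 0 + (\<Sum>n\<in>S1. a n * E 0 n)) + (if 1 - complex_of_real k = 0 then 0 else a 0 / (1 - of_real k))"
    by (rule constant_term_at_0_pole[OF holomorphic_on_add[OF L(1) holE] reg])
  have im: "(\<Sum>\<^sub>\<infinity>n\<in>{0<..}. herm (coeff_f (- n)) (coeff_g (- n)) * of_real (Im (expint_cont (2 - of_real k) \<phi> (of_real (- 4 * pi * of_rat n))))) =
      (\<Sum>n\<in>S1. a n * of_real (Im (E 0 n)))"
  proof -
    have "(\<Sum>\<^sub>\<infinity>n\<in>uminus ` {..<0}. a (- n) * of_real (Im (expint_cont (2 - of_real k) \<phi> (of_real (c (- n)))))) =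
        (\<Sum>n\<in>S1. a n * of_real (Im (expint_cont (2 - of_real k) \<phi> (of_real (c n)))))"
      by (rule infsum_uminus[OF fS1]) (auto simp: S1_def)
    also have "\<dots> = (\<Sum>n\<in>S1. a n * of_real (Im (E 0 n)))" by (intro sum.cong refl) (simp add: cont E_def)
    finally show ?thesis unfolding neg by (simp add: c_def a_def)
  qed
  \<comment> \<open>At \<open>v = 1\<close> the power of \<open>v\<close> in
    \<open>expint_tail\<close> is \<open>1\<close>, and the real part is the same for every
    admissible \<open>\<phi>\<close>.\<close>
  have rad: "radial (2 - k) (of_rat (- n)) 1 = - Re (E 0 n)" if "n \<in> S1" for n
  proof -
    have "radial (2 - k) (of_rat (- n)) 1 = - expint_tail (2 - k) (c n) 1"
      using that by (simp add: radial_def c_def S1_def)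
    also have "\<dots> = - Re (expint_real (2 - k) (c n))" by (simp add: expint_tail_def)
    also have "\<dots> = - Re (E 0 n)"
      using Re_expint_real[OF \<phi> c[OF that], of "2 - k"] by (simp add: E_def)
    finally show ?thesis .
  qed
  have rad0: "complex_of_real (radial (2 - k) (of_rat (- 0)) 1) + (if 1 - complex_of_real k = 0 then 0 else 1 / (1 - of_real k)) = 0"
  proof (cases "k = 1")
    case False
    then have 1: "1 - complex_of_real k \<noteq> 0" by (metis eq_iff_diff_eq_0 of_real_1 of_real_eq_iff)
    have 2: "complex_of_real (radial (2 - k) (of_rat (- 0)) 1) = 1 / (of_real k - 1)"
      using False by (simp add: radial_def)
    have 3: "1 / (complex_of_real k - 1) = - (1 / (1 - of_real k))"
      using minus_divide_right[of 1 "1 - complex_of_real k"] by simp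
    show ?thesis unfolding 2 3 using 1 by simp
  qed (simp add: radial_def)
  have "reg_pairing sc herm k \<phi> f g = P + a 0 * (complex_of_real (radial (2 - k) (of_rat (- 0)) 1) + (if 1 - complex_of_real k = 0 then 0 else 1 / (1 - of_real k))) +
      (\<Sum>n\<in>S1. a n * of_real (radial (2 - k) (of_rat (- n)) 1)) + (\<Sum>n\<in>S1. a n * E 0 n) - \<i> * (\<Sum>n\<in>S1. a n * of_real (Im (E 0 n)))"
    unfolding reg_pairing_def CT im L0 sumS by (simp add: algebra_simps)
  also have "(\<Sum>n\<in>S1. a n * of_real (radial (2 - k) (of_rat (- n)) 1)) = (\<Sum>n\<in>S1. - (a n * of_real (Re (E 0 n))))"
    by (intro sum.cong refl) (simp add: rad)
  also have "P + a 0 * (complex_of_real (radial (2 - k) (of_rat (- 0)) 1) + (if 1 - complex_of_real k = 0 then 0 else 1 / (1 - of_real k))) +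
      (\<Sum>n\<in>S1. - (a n * of_real (Re (E 0 n)))) + (\<Sum>n\<in>S1. a n * E 0 n) - \<i> * (\<Sum>n\<in>S1. a n * of_real (Im (E 0 n))) =
      P + (\<Sum>n\<in>S1. - (a n * of_real (Re (E 0 n))) + a n * E 0 n - \<i> * (a n * of_real (Im (E 0 n))))"
    unfolding rad0 by (simp only: sum.distrib sum_subtractf sum_distrib_left) simp
  also have "(\<Sum>n\<in>S1. - (a n * of_real (Re (E 0 n))) + a n * E 0 n - \<i> * (a n * of_real (Im (E 0 n)))) = 0"
  proof (rule sum.neutral, rule ballI)
    fix n
    have "- (a n * of_real (Re (E 0 n))) + a n * E 0 n - \<i> * (a n * of_real (Im (E 0 n))) =
        a n * (E 0 n - (of_real (Re (E 0 n)) + \<i> * of_real (Im (E 0 n))))"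
      by (simp only: ring_distribs) (simp add: algebra_simps)
    then show "- (a n * of_real (Re (E 0 n))) + a n * E 0 n - \<i> * (a n * of_real (Im (E 0 n))) = 0"
      by (simp add: complex_eq[symmetric])
  qed
  finally show ?thesis by (simp add: P_def)
qed

end

end

theorem theorem4p1:
  fixes sc :: "complex \<Rightarrow> 'v::euclidean_space \<Rightarrow> 'v"
    and herm :: "'v \<Rightarrow> 'v \<Rightarrow> complex"
    and \<rho> :: "mp2 \<Rightarrow> 'v \<Rightarrow> 'v"
    and k \<phi> :: real
    and f g G :: "complex \<Rightarrow> 'v"
  assumes "2 * k \<in> \<int>"
    and "hermitian_space sc herm"
    and "\<rho> \<in> hom Mp2Z (unitary_group sc herm)"
    and "factors_through_finite_quotient \<rho>"
    and "f \<in> weakly_holomorphic_forms sc k \<rho>"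
    and "g \<in> weakly_holomorphic_forms sc k \<rho>"
    and "G \<in> harmonic_maass_forms (conj_sc sc) (2 - k) \<rho>"
    and "\<forall>\<tau>\<in>\<H>. xi sc (2 - k) G \<tau> = g \<tau>"
    and "\<phi> \<in> {pi / 2 <..< 3 * pi / 2} - {pi}"
  shows "finite {n. herm (q_coeff sc f n) (q_coeff_plus (conj_sc sc) (2 - k) G (- n)) \<noteq> 0} \<and>
    reg_pairing sc herm k \<phi> f g =
      (\<Sum>n | herm (q_coeff sc f n) (q_coeff_plus (conj_sc sc) (2 - k) G (- n)) \<noteq> 0.
        herm (q_coeff sc f n) (q_coeff_plus (conj_sc sc) (2 - k) G (- n)))"
proof -
  interpret hermitian_space sc herm by (rule assms(2))
  obtain N where N: "0 < N" "\<rho> (translation_mp (int N)) = id"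
    by (rule exists_trivial_translation[OF assms(4)])
  show ?thesis
    using finite_coeff_pairing(1)[OF assms(1,3) N assms(5-8)] pairing_formula[OF assms(1,3) N assms(5-9)] by blast
qed

end
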